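(* (a) For all integers $d\ge 3$ and $0\le k\le d-3$, there exists a stacked $d$-polytope that is not $k$-scribable. (b) For every $d\ge 3$, every stacked $d$-polytope is $(d-1)$-scribable (circumscribable) and $(d-2)$-scribable (ridge-scribable).
   Context: Let $\mathbb S^d=\{x\in\mathbb R^{d+1}:\|x\|_2=1\}$, with coordinates $x_0,\dots,x_d$. A spherical polytope is an intersection of finitely many closed hemispheres of $\mathbb S^d$ containing no two antipodal points; equivalently, $\mathcal P=\mathcal K\cap\mathbb S^d$ for a pointed polyhedral cone $\mathcal K\subset\mathbb R^{d+1}$. Its $k$-faces are the intersections with $\mathbb S^d$ of the $(k+1)$-dimensional faces of $\mathcal K$. A $d$-polytope is a polytope of dimension $d$. Every Euclidean $d$-polytope has the same face lattice as some spherical $d$-polytope and conversely. A realization of a combinatorial type of $d$-polytope is a spherical $d$-polytope in $\mathbb S^d$ with isomorphic face lattice. Let $\mathcal B=\{x\in\mathbb S^d: x_0\ge 0,\ -x_0^2+x_1^2+\dots+x_d^2\le 0\}$ (a spherical cap) and let $\mathcal S=\partial\mathcal B$ be its boundary sphere. For a face $F$, $\operatorname{Span}(F)$ denotes the intersection of the linear span of $F$ with $\mathbb S^d$. A face $F$ is tangent to $\mathcal S$ if $\operatorname{relint}(F)\cap\mathcal S$ consists of a single point and $\operatorname{Span}(F)$ does not meet the interior of $\mathcal B$. A spherical $d$-polytope is (strongly) $k$-scribed if every $k$-face is tangent to $\mathcal S$; a (combinatorial type of) $d$-polytope is $k$-scribable if it has a $k$-scribed realization. Stacking a vertex onto a simplicial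 facet $F$ of a $d$-polytope $\mathcal P$ means taking the convex hull of $\mathcal P\cup\{p\}$ for a point $p\notin \mathcal P$ close enough to the barycenter of $F$. A stacked $d$-polytope is any $d$-polytope obtained (combinatorially) from a $d$-simplex by repeatedly stacking vertices onto facets. *)

theory Defs
  imports "HOL-Analysis.Analysis"
begin

section \<open>Spherical polytopes\<close>

definition closed_hemisphere :: "'a::euclidean_space \<Rightarrow> 'a set" where
  "closed_hemisphere a = {x \<in> sphere 0 1. a \<bullet> x \<le> 0}"

definition spherical_polytope :: "'a::euclidean_space set \<Rightarrow> bool" where
  "spherical_polytope P \<longleftrightarrow>
     (\<exists>A. finite A \<and> 0 \<notin> A \<and> P = sphere 0 1 \<inter> (\<Inter>a\<in>A. closed_hemisphere a)) \<and>
     (\<forall>x\<in>P. - x \<notin> P)"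

text \<open>If \<open>P\<close> is a spherical polytope, then \<open>convex_cone hull P\<close> is the pointed polyhedral cone
  \<open>K\<close> with \<open>P = K \<inter> sphere 0 1\<close>. For \<open>P = {}\<close> it is \<open>{0}\<close>, so that the empty face has
  dimension \<open>-1\<close>.\<close>

definition spherical_dim :: "'a::euclidean_space set \<Rightarrow> int" where
  "spherical_dim X = aff_dim (convex_cone hull X) - 1"

definition spherical_faces :: "'a::euclidean_space set \<Rightarrow> 'a set set" where
  "spherical_faces P = {G \<inter> sphere 0 1 | G. G face_of (convex_cone hull P)}"

definition spherical_span :: "'a::euclidean_space set \<Rightarrow> 'a set" where
  "spherical_span F = span F \<inter> sphere 0 1"

definition spherical_relint :: "'a::euclidean_space set \<Rightarrow> 'a set" where
  "spherical_relint F = rel_interior (convex_cone hull F) \<inter> sphere 0 1"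

section \<open>Scribed polytopes\<close>

text \<open>We represent \<open>\<real>\<^sup>d\<^sup>+\<^sup>1\<close> as \<open>real \<times> (real ^ 'n)\<close> with \<open>d = CARD('n)\<close>; the coordinate \<open>x\<^sub>0\<close> is
  \<open>fst x\<close>. The interior and the boundary of the cap are taken in the sphere \<open>\<S>\<^sup>d\<close>.\<close>

definition cap :: "(real \<times> (real ^ 'n::finite)) set" where
  "cap = {x \<in> sphere 0 1. fst x \<ge> 0 \<and> - (fst x)\<^sup>2 + (\<Sum>i\<in>UNIV. (snd x $ i)\<^sup>2) \<le> 0}"

definition cap_interior :: "(real \<times> (real ^ 'n::finite)) set" where
  "cap_interior = (top_of_set (sphere 0 1)) interior_of cap"

definition cap_boundary :: "(real \<times> (real ^ 'n::finite)) set" where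
  "cap_boundary = (top_of_set (sphere 0 1)) frontier_of cap"

definition tangent_face :: "(real \<times> (real ^ 'n::finite)) set \<Rightarrow> bool" where
  "tangent_face F \<longleftrightarrow>
     (\<exists>x. spherical_relint F \<inter> cap_boundary = {x}) \<and> spherical_span F \<inter> cap_interior = {}"

definition scribed :: "nat \<Rightarrow> (real \<times> (real ^ 'n::finite)) set \<Rightarrow> bool" where
  "scribed k P \<longleftrightarrow> (\<forall>F\<in>spherical_faces P. spherical_dim F = int k \<longrightarrow> tangent_face F)"

section \<open>Combinatorial types\<close>

definition lattice_isomorphic :: "'a set set \<Rightarrow> 'b set set \<Rightarrow> bool" where
  "lattice_isomorphic L M \<longleftrightarrow>
     (\<exists>f. bij_betw f L M \<and> (\<forall>A\<in>L. \<forall>B\<in>L. A \<subseteq> B \<longleftrightarrow> f A \<subseteq> f B))"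

definition faces :: "'a::euclidean_space set \<Rightarrow> 'a set set" where
  "faces P = {F. F face_of P}"

text \<open>Combinatorial types of \<open>d\<close>-polytopes are represented by Euclidean \<open>d\<close>-polytopes in
  \<open>real ^ 'n\<close>; their realizations are spherical \<open>d\<close>-polytopes in \<open>\<S>\<^sup>d\<close>.\<close>

definition d_polytope :: "(real ^ 'n::finite) set \<Rightarrow> bool" where
  "d_polytope P \<longleftrightarrow> polytope P \<and> aff_dim P = int CARD('n)"

definition realization :: "(real \<times> (real ^ 'n::finite)) set \<Rightarrow> (real ^ 'n) set \<Rightarrow> bool" where
  "realization Q P \<longleftrightarrow>
     spherical_polytope Q \<and> spherical_dim Q = int CARD('n) \<and>
     lattice_isomorphic (faces P) (spherical_faces Q)"

definition scribable :: "nat \<Rightarrow> (real ^ 'n::finite) set \<Rightarrow> bool" where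
  "scribable k P \<longleftrightarrow> (\<exists>Q. realization Q P \<and> scribed k Q)"

section \<open>Stacked polytopes\<close>

definition barycenter :: "'a::euclidean_space set \<Rightarrow> 'a" where
  "barycenter F = (let V = {v. v extreme_point_of F} in (1 / real (card V)) *\<^sub>R \<Sum>V)"

text \<open>\<open>stacking P F Q\<close>: the polytope \<open>Q\<close> has the combinatorial type obtained from \<open>P\<close> by stacking a
  vertex onto its simplicial facet \<open>F\<close>. The filter expresses ``for all \<open>p \<notin> P\<close> close enough to the
  barycenter of \<open>F\<close>''; it is nontrivial, as \<open>F\<close> lies in the boundary of \<open>P\<close>.\<close>

definition stacking :: "(real ^ 'n::finite) set \<Rightarrow> (real ^ 'n) set \<Rightarrow> (real ^ 'n) set \<Rightarrow> bool" where
  "stacking P F Q \<longleftrightarrow>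
     d_polytope P \<and> F facet_of P \<and> (int CARD('n) - 1) simplex F \<and> d_polytope Q \<and>
     (\<forall>\<^sub>F p in at (barycenter F) within - P.
        lattice_isomorphic (faces Q) (faces (convex hull (insert p P))))"

inductive stacked :: "(real ^ 'n::finite) set \<Rightarrow> bool" where
  simplex: "int CARD('n) simplex P \<Longrightarrow> stacked (P :: (real ^ 'n) set)"
| stack: "stacked P \<Longrightarrow> stacking P F Q \<Longrightarrow> stacked Q"

end

theory Submission
  imports Defs
begin

text \<open>Both parts work with cones in \<open>\<real>\<^sup>d\<^sup>+\<^sup>1\<close> carrying the Lorentz form. A stacked polytope is a union of simplices glued
  along facets.

  (a) Stack a \<open>d\<close>-simplex on four of its facets. If the result is \<open>k\<close>-scribed, choose \<open>k\<close> vertices of the simplex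
  other than the four opposite to these facets, and project orthogonally (for the Lorentz form) along their span.
  The tangency points of the \<open>k\<close>-faces through these vertices show that the other vertices are projected to null
  vectors. Four of them span an ideal tetrahedron on whose four facets tetrahedra are
  attached, and the hyperbolic dihedral angles around its six edges sum up to at least \<open>6 * pi\<close>, although
  convexity requires less than \<open>pi\<close> around each edge.

  (b) A vertex stacked onto the facet with normal \<open>n\<close> of a simplex with facet normals \<open>n\<close>, \<open>c j\<close> creates
  facets with normals \<open>c j + a j *\<^sub>R n\<close>. If all normals of a simplex have norm \<open>1\<close> and all inner products of two of
  them are \<open>- 1\<close>, then its ridges are tangent to the sphere, and reflecting it in its facets gives a ridge-scribed
  polytope. For the circumscribed case the \<open>a j\<close> are chosen such that facets which are stacked later
  cut the sphere slightly, while all others are tangent to it.\<close>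

section \<open>Stacked simplicial complexes\<close>

text \<open>A scribability claim sees a polytope only through its face lattice. Both parts therefore
  work with \<open>realizes\<close>: labelled rays and facet normals that certify each other. Such
  data can be recovered from any lattice isomorphism, and a stacking becomes one new ray with new
  normals \<open>m j\<close>. The count in (a): an ideal tetrahedron has dihedral angles of sum
  \<open>2 * pi\<close>, equal at opposite edges, and an ideal tetrahedron attached to a facet adds
  \<open>pi\<close> along the three edges of this facet, so four of them give \<open>6 * pi\<close>
  in total. If \<open>k + 3 < d\<close>, further vertices remain; they contribute causal vectors
  that turn the equalities into inequalities of the right direction. The obstacle in (b): for null
  \<open>n\<close> and \<open>c j\<close> with product - 1, the vector
  \<open>c j + a *\<^sub>R n\<close> has norm \<open>- 2 * a\<close>, so for \<open>a > 0\<close>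
  the new facet would miss the sphere. No simplex can thus be attached to a tangent facet of this
  kind. A facet that awaits its stacking must have a small positive norm \<open>\<epsilon>\<close>;
  then \<open>a\<close> is about \<open>2 / \<epsilon>\<close>, and all errors have to be controlled
  up to a factor \<open>\<epsilon>\<close>.\<close>

definition face_poset :: "'i set set \<Rightarrow> 'i set set" where
  "face_poset FF = {A. \<exists>F\<in>FF. A \<subseteq> F} \<union> {\<Union>FF}"

definition stack_family :: "'i set set \<Rightarrow> 'i set \<Rightarrow> 'i \<Rightarrow> 'i set set" where
  "stack_family FF F p = FF - {F} \<union> (\<lambda>j. insert p (F - {j})) ` F"

text \<open>Labels are natural numbers, so that a fresh vertex is always available; the base case is
  the boundary complex of a simplex.\<close>

inductive stacked_family :: "nat \<Rightarrow> nat set set \<Rightarrow> bool" for d where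
  base: "stacked_family d {F. F \<subseteq> {0..d} \<and> card F = d}"
| step: "stacked_family d FF \<Longrightarrow> F \<in> FF \<Longrightarrow> p \<notin> \<Union>FF \<Longrightarrow> stacked_family d (stack_family FF F p)"

text \<open>A weak form of a pseudomanifold without boundary: across every ridge there is a second
  facet. The common cardinality makes the facets an antichain.\<close>

definition facet_family :: "nat \<Rightarrow> 'i set set \<Rightarrow> bool" where
  "facet_family d FF \<longleftrightarrow> finite FF \<and> FF \<noteq> {} \<and> (\<forall>F\<in>FF. finite F \<and> card F = d) \<and>
     (\<forall>F\<in>FF. \<forall>j\<in>F. \<exists>G\<in>FF. G \<noteq> F \<and> F - {j} \<subseteq> G)"

lemma facet_familyD:
  assumes "facet_family d FF"
  shows "finite FF" "FF \<noteq> {}" "\<And>F. F \<in> FF \<Longrightarrow> finite F" "\<And>F. F \<in> FF \<Longrightarrow> card F = d"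
    "\<And>F j. F \<in> FF \<Longrightarrow> j \<in> F \<Longrightarrow> \<exists>G\<in>FF. G \<noteq> F \<and> F - {j} \<subseteq> G" "finite (\<Union>FF)"
  using assms unfolding facet_family_def by auto

lemma facet_family_eq:
  assumes "facet_family d FF" "F \<in> FF" "G \<in> FF" "F \<subseteq> G" shows "F = G"
  using facet_familyD(3,4)[OF assms(1)] assms(2-4) by (metis card_subset_eq)

text \<open>The facet across the ridge \<open>F - {i}\<close> cannot contain \<open>i\<close>, as it
  would then contain \<open>F\<close>.\<close>

lemma facet_family_missed:
  assumes "facet_family d FF" "i \<in> \<Union>FF"
  shows "\<exists>F\<in>FF. i \<notin> F"
proof -
  obtain F where F: "F \<in> FF" "i \<in> F" using assms by auto
  obtain G where G: "G \<in> FF" "G \<noteq> F" "F - {i} \<subseteq> G" using facet_familyD(5)[OF assms(1) F] by auto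
  have "i \<notin> G" using facet_family_eq[OF assms(1) F(1) G(1)] G by auto
  with G show ?thesis by auto
qed

lemma facet_family_neq_Union:
  assumes "facet_family d FF" "F \<in> FF" "d \<ge> 1"
  shows "F \<noteq> \<Union>FF"
proof
  assume F: "F = \<Union>FF"
  have "F \<noteq> {}" using facet_familyD(3,4)[OF assms(1,2)] assms(3) by auto
  then obtain j where "j \<in> F" by auto
  then obtain G where G: "G \<in> FF" "G \<noteq> F" using facet_familyD(5)[OF assms(1,2)] by auto
  then show False using facet_family_eq[OF assms(1) G(1) assms(2)] F by auto
qed

lemma facet_family_simplex:
  assumes "d \<ge> 1"
  shows "facet_family d {F. F \<subseteq> {0..d} \<and> card F = d}"
  unfolding facet_family_def
proof (intro conjI ballI)
  show "finite {F. F \<subseteq> {0..d} \<and> card F = d}" by (rule finite_subset[of _ "Pow {0..d}"]) auto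
  show "{F. F \<subseteq> {0..d} \<and> card F = d} \<noteq> {}"
    by (auto intro!: exI[of _ "{1..d}"])
  fix F assume "F \<in> {F. F \<subseteq> {0..d} \<and> card F = d}"
  then have F: "F \<subseteq> {0..d}" "card F = d" by auto
  then show finF: "finite F" and "card F = d" using finite_subset by auto
  fix j assume j: "j \<in> F"
  \<comment> \<open>\<open>F\<close> omits exactly one label \<open>i\<close>; exchanging
    \<open>j\<close> for \<open>i\<close> gives the facet across the ridge.\<close>
  have "card ({0..d} - F) = 1" using F finF by (simp add: card_Diff_subset)
  then obtain i where i: "{0..d} - F = {i}" by (auto simp: card_1_singleton_iff)
  have "card (insert i (F - {j})) = d"
    using finF F i j assms by (subst card_insert_disjoint) auto
  then show "\<exists>G\<in>{F. F \<subseteq> {0..d} \<and> card F = d}. G \<noteq> F \<and> F - {j} \<subseteq> G"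
    using i F by (intro bexI[of _ "insert i (F - {j})"]) auto
qed

text \<open>For \<open>d \<ge> 2\<close> every label of \<open>F\<close> survives in a new facet,
  one that drops some other label.\<close>

lemma Union_stack_family:
  assumes "facet_family d FF" "F \<in> FF" "d \<ge> 2"
  shows "\<Union>(stack_family FF F p) = insert p (\<Union>FF)"
proof -
  have ne: "card F \<ge> 2" "finite F" using facet_familyD(3,4)[OF assms(1,2)] assms(3) by auto
  then have "F \<noteq> {}" by auto
  have sub: "\<Union>((\<lambda>j. insert p (F - {j})) ` F) = insert p F"
  proof (intro subset_antisym subsetI)
    fix i assume "i \<in> insert p F"
    then consider "i = p" | "i \<in> F" by auto
    then show "i \<in> \<Union>((\<lambda>j. insert p (F - {j})) ` F)"
    proof cases
      case 1
      then show ?thesis using \<open>F \<noteq> {}\<close> by auto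
    next
      case 2
      have "card (F - {i}) \<noteq> 0" using ne 2 by simp
      then have "F - {i} \<noteq> {}" by (metis card.empty)
      then obtain j where "j \<in> F" "j \<noteq> i" by auto
      then show ?thesis using 2 by auto
    qed
  qed (auto split: if_splits)
  have "\<Union>(stack_family FF F p) = \<Union>(FF - {F}) \<union> insert p F"
    unfolding stack_family_def Union_Un_distrib sub ..
  also have "\<dots> = insert p (\<Union>FF)" using assms(2) by auto
  finally show ?thesis .
qed

text \<open>An old ridge that bordered \<open>F\<close> now borders a new facet. A ridge of a new
  facet that contains \<open>p\<close> is shared with another new facet; the one without
  \<open>p\<close> is a ridge of \<open>F\<close> and keeps its old neighbour.\<close>

lemma facet_family_stack:
  assumes FF: "facet_family d FF" and F: "F \<in> FF" and p: "p \<notin> \<Union>FF" and d: "d \<ge> 1"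
  shows "facet_family d (stack_family FF F p)"
  unfolding facet_family_def
proof (intro conjI ballI)
  note D = facet_familyD[OF FF]
  have finF: "finite F" "card F = d" "p \<notin> F" using D F p by auto
  show "finite (stack_family FF F p)" unfolding stack_family_def using D(1) finF by auto
  have "F \<noteq> {}" using finF d by auto
  then show "stack_family FF F p \<noteq> {}" unfolding stack_family_def by auto
  have cardn: "card (insert p (F - {j})) = d" if "j \<in> F" for j
    using finF that d by (subst card_insert_disjoint) auto
  fix G assume G: "G \<in> stack_family FF F p"
  then show "finite G" "card G = d" using D finF cardn by (auto simp: stack_family_def)
  fix k assume k: "k \<in> G"
  consider "G \<in> FF" "G \<noteq> F" | j where "j \<in> F" "G = insert p (F - {j})"
    using G by (auto simp: stack_family_def)
  then show "\<exists>H\<in>stack_family FF F p. H \<noteq> G \<and> G - {k} \<subseteq> H"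
  proof cases
    case 1
    obtain H where H: "H \<in> FF" "H \<noteq> G" "G - {k} \<subseteq> H" using D(5)[OF 1(1) k] by auto
    show ?thesis
    proof (cases "H = F")
      case False
      then show ?thesis using H by (auto simp: stack_family_def)
    next
      case True
      have "\<not> F \<subseteq> G - {k}" using facet_family_eq[OF FF F 1(1)] 1(2) by auto
      then obtain j where j: "j \<in> F" "j \<notin> G - {k}" by auto
      have "p \<notin> G" using p 1 by auto
      then show ?thesis using H True j
        by (intro bexI[of _ "insert p (F - {j})"]) (auto simp: stack_family_def)
    qed
  next
    case 2
    show ?thesis
    proof (cases "k = p")
      case True
      obtain H where H: "H \<in> FF" "H \<noteq> F" "F - {j} \<subseteq> H" using D(5)[OF F 2(1)] by auto
      have "p \<notin> H" using p H by auto
      then show ?thesis using H 2 True by (intro bexI[of _ H]) (auto simp: stack_family_def)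
    next
      case False
      then have "k \<in> F" "k \<noteq> j" using 2 k by auto
      then show ?thesis using 2 finF False
        by (intro bexI[of _ "insert p (F - {k})"]) (auto simp: stack_family_def)
    qed
  qed
qed

lemma stacked_family_facet_family:
  assumes "stacked_family d FF" "d \<ge> 1" shows "facet_family d FF"
  using assms by induction (auto intro: facet_family_simplex facet_family_stack)

lemma lattice_isomorphic_sym: "lattice_isomorphic L M \<Longrightarrow> lattice_isomorphic M L"
  unfolding lattice_isomorphic_def
proof (elim exE conjE)
  fix f assume f: "bij_betw f L M" "\<forall>A\<in>L. \<forall>B\<in>L. (A \<subseteq> B) = (f A \<subseteq> f B)"
  have "bij_betw (inv_into L f) M L" using f(1) by (rule bij_betw_inv_into)
  moreover have "\<forall>A\<in>M. \<forall>B\<in>M. (A \<subseteq> B) = (inv_into L f A \<subseteq> inv_into L f B)"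
    using f by (metis bij_betw_def f_inv_into_f inv_into_into)
  ultimately show "\<exists>f. bij_betw f M L \<and> (\<forall>A\<in>M. \<forall>B\<in>M. (A \<subseteq> B) = (f A \<subseteq> f B))" by blast
qed

lemma lattice_isomorphic_trans:
  assumes "lattice_isomorphic L M" "lattice_isomorphic M N" shows "lattice_isomorphic L N"
proof -
  obtain f where f: "bij_betw f L M" "\<forall>A\<in>L. \<forall>B\<in>L. (A \<subseteq> B) = (f A \<subseteq> f B)"
    using assms(1) unfolding lattice_isomorphic_def by auto
  obtain g where g: "bij_betw g M N" "\<forall>A\<in>M. \<forall>B\<in>M. (A \<subseteq> B) = (g A \<subseteq> g B)"
    using assms(2) unfolding lattice_isomorphic_def by auto
  have "bij_betw (g \<circ> f) L N" using bij_betw_trans[OF f(1) g(1)] .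
  moreover have "\<forall>A\<in>L. \<forall>B\<in>L. (A \<subseteq> B) = ((g \<circ> f) A \<subseteq> (g \<circ> f) B)"
    using f g by (auto simp: bij_betw_def) blast+
  ultimately show ?thesis unfolding lattice_isomorphic_def by blast
qed

lemma lattice_isomorphic_image:
  assumes "\<And>A B. A \<in> L \<Longrightarrow> B \<in> L \<Longrightarrow> f A \<subseteq> f B \<longleftrightarrow> A \<subseteq> B"
  shows "lattice_isomorphic L (f ` L)"
  unfolding lattice_isomorphic_def
proof (intro exI conjI ballI)
  show "bij_betw f L (f ` L)" unfolding bij_betw_def inj_on_def using assms by (metis subset_antisym subset_refl)
qed (use assms in auto)

section \<open>Cones over simplicial complexes\<close>

text \<open>Indexed by labels instead of sets of generators, so that faces of the complex and faces
  of the cone can be matched even where \<open>v\<close> is not known to be injective.\<close>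

definition poscone :: "('i \<Rightarrow> 'a::real_vector) \<Rightarrow> 'i set \<Rightarrow> 'a set" where
  "poscone v A = {\<Sum>i\<in>A. c i *\<^sub>R v i | c. \<forall>i\<in>A. (c i :: real) \<ge> 0}"

lemma posconeI: "(\<And>i. i \<in> A \<Longrightarrow> c i \<ge> (0::real)) \<Longrightarrow> (\<Sum>i\<in>A. c i *\<^sub>R v i) \<in> poscone v A"
  unfolding poscone_def by auto

lemma posconeE:
  assumes "x \<in> poscone v A"
  obtains c where "\<And>i. i \<in> A \<Longrightarrow> c i \<ge> (0::real)" "x = (\<Sum>i\<in>A. c i *\<^sub>R v i)"
  using assms unfolding poscone_def by auto

lemma poscone_zero: "0 \<in> poscone v A"
  using posconeI[of A "\<lambda>_. 0" v] by simp

lemma poscone_empty [simp]: "poscone v {} = {0}"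
  unfolding poscone_def by auto

lemma poscone_add: 
  assumes "x \<in> poscone v A" "y \<in> poscone v A" shows "x + y \<in> poscone v A"
proof -
  obtain c where "\<And>i. i \<in> A \<Longrightarrow> c i \<ge> (0::real)" "x = (\<Sum>i\<in>A. c i *\<^sub>R v i)" using assms(1) by (rule posconeE) blast
  moreover obtain b where "\<And>i. i \<in> A \<Longrightarrow> b i \<ge> (0::real)" "y = (\<Sum>i\<in>A. b i *\<^sub>R v i)" using assms(2) by (rule posconeE) blast
  ultimately show ?thesis using posconeI[of A "\<lambda>i. c i + b i" v]
    by (auto simp: scaleR_add_left sum.distrib)
qed

lemma poscone_scale: 
  assumes "x \<in> poscone v A" "t \<ge> 0" shows "t *\<^sub>R x \<in> poscone v A"
proof -
  obtain c where "\<And>i. i \<in> A \<Longrightarrow> c i \<ge> (0::real)" "x = (\<Sum>i\<in>A. c i *\<^sub>R v i)" using assms(1) by (rule posconeE) blast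
  then show ?thesis using posconeI[of A "\<lambda>i. t * c i" v] assms(2)
    by (auto simp: scaleR_sum_right)
qed

lemma convex_cone_poscone: "convex_cone (poscone v A)"
  unfolding convex_cone_iff using poscone_zero poscone_add poscone_scale by blast

lemma convex_poscone: "convex (poscone v A)"
  using convex_cone_poscone[of v A] by (simp add: convex_cone_def)

lemma poscone_mono: 
  assumes "A \<subseteq> B" "finite B" shows "poscone v A \<subseteq> poscone v B"
proof
  fix x assume "x \<in> poscone v A"
  then obtain c where c: "\<And>i. i \<in> A \<Longrightarrow> c i \<ge> (0::real)" "x = (\<Sum>i\<in>A. c i *\<^sub>R v i)" by (rule posconeE) blast
  have "x = (\<Sum>i\<in>B. (if i \<in> A then c i else 0) *\<^sub>R v i)"
    unfolding c(2) by (rule sum.mono_neutral_cong_left) (use assms in auto)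
  then show "x \<in> poscone v B" using c(1) posconeI[of B "\<lambda>i. if i \<in> A then c i else 0" v] by auto
qed

lemma poscone_member: 
  assumes "i \<in> A" "finite A" shows "v i \<in> poscone v A"
proof -
  have "v i = (\<Sum>j\<in>A. (if j = i then 1 else 0) *\<^sub>R v j)"
    using assms by (subst sum.mono_neutral_right[of A "{i}"]) auto
  then show ?thesis using posconeI[of A "\<lambda>j. if j = i then 1 else 0" v] by simp
qed

lemma poscone_least:
  assumes "convex_cone C" "\<And>i. i \<in> A \<Longrightarrow> v i \<in> C" 
  shows "poscone v A \<subseteq> C"
proof
  fix x assume "x \<in> poscone v A"
  then obtain c where c: "\<And>i. i \<in> A \<Longrightarrow> c i \<ge> (0::real)" "x = (\<Sum>i\<in>A. c i *\<^sub>R v i)" by (rule posconeE) blast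
  have "(\<Sum>i\<in>B. c i *\<^sub>R v i) \<in> C" if "B \<subseteq> A" for B
    using that
  proof (induction B rule: infinite_finite_induct)
    case (insert x F)
    then show ?case using assms c(1) by (simp add: convex_cone_add convex_cone_scaleR)
  qed (use assms(1) convex_cone_contains_0 in auto)
  then show "x \<in> C" using c by auto
qed

lemma poscone_subset_span: "poscone v A \<subseteq> span (v ` A)"
  unfolding poscone_def by (auto intro!: span_sum intro: span_scale span_base)

lemma poscone_eq_hull: "finite A \<Longrightarrow> convex_cone hull (v ` A) = poscone v A"
  by (intro subset_antisym hull_minimal poscone_least)
    (auto simp: convex_cone_poscone convex_cone_convex_cone_hull poscone_member intro: hull_inc)

text \<open>\<open>v\<close> gives the rays and \<open>n\<close> the outer normals. The first two
  clauses put the cone of the rays inside the half-spaces, the last one is the converse inclusion,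
  and independence makes all proper faces simplicial.\<close>

definition realizes :: "'i set set \<Rightarrow> ('i \<Rightarrow> 'a::euclidean_space) \<Rightarrow> ('i set \<Rightarrow> 'a) \<Rightarrow> bool" where
  "realizes FF v n \<longleftrightarrow>
     (\<forall>F\<in>FF. \<forall>i\<in>F. n F \<bullet> v i = 0) \<and> (\<forall>F\<in>FF. \<forall>i\<in>\<Union>FF - F. n F \<bullet> v i < 0) \<and>
     (\<forall>F\<in>FF. inj_on v F \<and> independent (v ` F)) \<and>
     (\<forall>x. (\<forall>F\<in>FF. n F \<bullet> x \<le> 0) \<longrightarrow> x \<in> poscone v (\<Union>FF))"

lemma realizesD:
  assumes "realizes FF v n"
  shows "\<And>F i. F \<in> FF \<Longrightarrow> i \<in> F \<Longrightarrow> n F \<bullet> v i = 0"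
    "\<And>F i. F \<in> FF \<Longrightarrow> i \<in> \<Union>FF \<Longrightarrow> i \<notin> F \<Longrightarrow> n F \<bullet> v i < 0"
    "\<And>F. F \<in> FF \<Longrightarrow> inj_on v F" "\<And>F. F \<in> FF \<Longrightarrow> independent (v ` F)"
    "\<And>x. (\<And>F. F \<in> FF \<Longrightarrow> n F \<bullet> x \<le> 0) \<Longrightarrow> x \<in> poscone v (\<Union>FF)"
  using assms unfolding realizes_def by auto

lemma realizes_le:
  assumes "realizes FF v n" "x \<in> poscone v (\<Union>FF)" "F \<in> FF"
  shows "n F \<bullet> x \<le> 0"
proof -
  obtain c where c: "\<And>i. i \<in> \<Union>FF \<Longrightarrow> c i \<ge> (0::real)" "x = (\<Sum>i\<in>\<Union>FF. c i *\<^sub>R v i)"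
    using assms(2) by (rule posconeE) blast
  have "n F \<bullet> v i \<le> 0" if "i \<in> \<Union>FF" for i
    using realizesD(1,2)[OF assms(1,3)] that by (cases "i \<in> F") (auto intro: less_imp_le)
  then show ?thesis unfolding c(2) inner_sum_right inner_scaleR_right
    by (intro sum_nonpos) (use c(1) in \<open>auto intro: mult_nonneg_nonpos\<close>)
qed

lemma independent_sum_eqD:
  fixes v :: "'i \<Rightarrow> 'a::real_vector"
  assumes "inj_on v A" "independent (v ` A)" "finite A" "(\<Sum>i\<in>A. c i *\<^sub>R v i) = (\<Sum>i\<in>A. b i *\<^sub>R v i)" "i \<in> A"
  shows "c i = b i"
proof -
  have "(\<Sum>w\<in>v ` A. (c (inv_into A v w) - b (inv_into A v w)) *\<^sub>R w) = (\<Sum>i\<in>A. (c i - b i) *\<^sub>R v i)"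
    using assms(1) by (subst sum.reindex) auto
  also have "\<dots> = 0" using assms(4) by (simp add: scaleR_diff_left sum_subtractf)
  finally have "c (inv_into A v (v i)) - b (inv_into A v (v i)) = 0"
    using assms by (intro independentD[OF assms(2), of "v ` A" "\<lambda>w. c (inv_into A v w) - b (inv_into A v w)" "v i"]) auto
  then show ?thesis using assms by simp
qed

text \<open>A vanishing sum of nonpositive terms has only zero terms, and rays off \<open>F\<close>
  have a strictly negative product with \<open>n F\<close>.\<close>

lemma realizes_face_coeffs:
  assumes "realizes FF v n" "finite (\<Union>FF)" "F \<in> FF" "\<And>i. i \<in> \<Union>FF \<Longrightarrow> c i \<ge> (0::real)"
    "n F \<bullet> (\<Sum>i\<in>\<Union>FF. c i *\<^sub>R v i) = 0" "i \<in> \<Union>FF" "i \<notin> F"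
  shows "c i = 0"
proof -
  have le: "n F \<bullet> v i \<le> 0" if "i \<in> \<Union>FF" for i
    using realizesD(1,2)[OF assms(1,3)] that by (cases "i \<in> F") (auto intro: less_imp_le)
  have "(\<Sum>i\<in>\<Union>FF. - (c i * (n F \<bullet> v i))) = 0"
    using assms(5) unfolding inner_sum_right inner_scaleR_right by (simp add: sum_negf)
  then have "- (c i * (n F \<bullet> v i)) = 0"
    using sum_nonneg_eq_0_iff[of "\<Union>FF" "\<lambda>i. - (c i * (n F \<bullet> v i))"] assms le
    by (auto simp: mult_nonneg_nonpos)
  then show ?thesis using realizesD(2)[OF assms(1,3,6,7)] by auto
qed

lemma poscone_facet:
  assumes "realizes FF v n" "finite (\<Union>FF)" "F \<in> FF"
  shows "poscone v F = {x \<in> poscone v (\<Union>FF). n F \<bullet> x = 0}"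
proof (intro subset_antisym subsetI)
  fix x assume x: "x \<in> poscone v F"
  then have "x \<in> poscone v (\<Union>FF)" using poscone_mono[of F "\<Union>FF"] assms by blast
  moreover obtain c where "x = (\<Sum>i\<in>F. c i *\<^sub>R v i)" using x by (rule posconeE) blast
  then have "n F \<bullet> x = 0" using realizesD(1)[OF assms(1,3)] by (simp add: inner_sum_right)
  ultimately show "x \<in> {x \<in> poscone v (\<Union>FF). n F \<bullet> x = 0}" by auto
next
  fix x assume x: "x \<in> {x \<in> poscone v (\<Union>FF). n F \<bullet> x = 0}"
  then obtain c where c: "\<And>i. i \<in> \<Union>FF \<Longrightarrow> c i \<ge> (0::real)" "x = (\<Sum>i\<in>\<Union>FF. c i *\<^sub>R v i)"
    by (elim CollectE conjE posconeE) blast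
  have "x = (\<Sum>i\<in>F. c i *\<^sub>R v i)" unfolding c(2)
  proof (rule sum.mono_neutral_right)
    have "n F \<bullet> (\<Sum>i\<in>\<Union>FF. c i *\<^sub>R v i) = 0" using x c(2) by simp
    then show "\<forall>i\<in>\<Union>FF - F. c i *\<^sub>R v i = 0"
      using realizes_face_coeffs[OF assms, of c] c(1) by (metis DiffE scale_zero_left)
  qed (use assms in auto)
  moreover have "\<And>i. i \<in> F \<Longrightarrow> c i \<ge> 0" using c(1) assms(3) by auto
  ultimately show "x \<in> poscone v F" using posconeI[of F c v] by auto
qed

text \<open>\<open>poscone v F\<close> is cut out by a supporting hyperplane. Inside this simplicial
  cone coefficients are unique, so a point between two others lies in \<open>poscone v A\<close>
  only if both of them do. Faces of faces are faces.\<close>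

lemma poscone_face_of:
  assumes R: "realizes FF v n" and fin: "finite (\<Union>FF)" and A: "A \<in> face_poset FF"
  shows "poscone v A face_of poscone v (\<Union>FF)"
proof (cases "A = \<Union>FF")
  case True
  then show ?thesis using convex_poscone face_of_refl by blast
next
  case False
  then obtain F where F: "F \<in> FF" "A \<subseteq> F" using A unfolding face_poset_def by auto
  have finF: "finite F" using F fin finite_subset by (metis Union_upper)
  have 1: "poscone v F face_of poscone v (\<Union>FF)"
  proof -
    have "poscone v F = poscone v (\<Union>FF) \<inter> {x. n F \<bullet> x = 0}" unfolding poscone_facet[OF R fin F(1)] by auto
    then show ?thesis
      using face_of_Int_supporting_hyperplane_le[OF convex_poscone] realizes_le[OF R _ F(1)] by metis
  qed
  have "poscone v A face_of poscone v F"
    unfolding face_of_def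
  proof (intro conjI ballI impI)
    show "poscone v A \<subseteq> poscone v F" using poscone_mono F finF by blast
    show "convex (poscone v A)" by (rule convex_poscone)
    fix a b x assume a: "a \<in> poscone v F" and b: "b \<in> poscone v F" and x: "x \<in> poscone v A" "x \<in> open_segment a b"
    obtain \<alpha> where \<alpha>: "\<And>i. i \<in> F \<Longrightarrow> \<alpha> i \<ge> (0::real)" "a = (\<Sum>i\<in>F. \<alpha> i *\<^sub>R v i)" using a by (rule posconeE) blast
    obtain \<beta> where \<beta>: "\<And>i. i \<in> F \<Longrightarrow> \<beta> i \<ge> (0::real)" "b = (\<Sum>i\<in>F. \<beta> i *\<^sub>R v i)" using b by (rule posconeE) blast
    obtain \<gamma> where \<gamma>: "\<And>i. i \<in> A \<Longrightarrow> \<gamma> i \<ge> (0::real)" "x = (\<Sum>i\<in>A. \<gamma> i *\<^sub>R v i)" using x(1) by (rule posconeE) blast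
    obtain t where t: "0 < t" "t < 1" "x = (1 - t) *\<^sub>R a + t *\<^sub>R b" using x(2) by (auto simp: in_segment)
    have "(\<Sum>i\<in>F. (if i \<in> A then \<gamma> i else 0) *\<^sub>R v i) = (\<Sum>i\<in>A. \<gamma> i *\<^sub>R v i)"
      using finF F by (intro sum.mono_neutral_cong_right) auto
    also have "\<dots> = (\<Sum>i\<in>F. ((1 - t) * \<alpha> i + t * \<beta> i) *\<^sub>R v i)"
      using \<gamma>(2) t(3) \<alpha>(2) \<beta>(2) by (simp add: scaleR_sum_right scaleR_add_left sum.distrib)
    finally have eq: "(if i \<in> A then \<gamma> i else 0) = (1 - t) * \<alpha> i + t * \<beta> i" if "i \<in> F" for i
      by (rule independent_sum_eqD[OF realizesD(3,4)[OF R F(1)] finF]) (use that in auto)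
    have z: "\<alpha> i = 0 \<and> \<beta> i = 0" if "i \<in> F" "i \<notin> A" for i
    proof -
      have "(1 - t) * \<alpha> i \<ge> 0" "t * \<beta> i \<ge> 0" using \<alpha>(1) \<beta>(1) that t by auto
      then show ?thesis using eq[OF that(1)] that(2) t by (auto simp: add_nonneg_eq_0_iff)
    qed
    have "a = (\<Sum>i\<in>A. \<alpha> i *\<^sub>R v i)" "b = (\<Sum>i\<in>A. \<beta> i *\<^sub>R v i)"
      unfolding \<alpha>(2) \<beta>(2) using z F finF by (auto intro!: sum.mono_neutral_right)
    then show "a \<in> poscone v A" "b \<in> poscone v A"
      using \<alpha>(1) \<beta>(1) F by (auto intro!: posconeI)
  qed
  then show ?thesis using 1 face_of_trans by blast
qed

lemma convex_cone_face_of: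
  fixes K :: "'a::euclidean_space set"
  assumes "convex_cone K" "G face_of K" "G \<noteq> {}"
  shows "convex_cone G"
proof -
  have "conic G" using face_of_conic[of K G] assms unfolding convex_cone_def by simp
  then show ?thesis using assms face_of_imp_convex unfolding convex_cone_def by blast
qed

text \<open>\<open>x + y\<close> is the midpoint of \<open>2 *\<^sub>R x\<close> and
  \<open>2 *\<^sub>R y\<close>, which belong to the cone, so the face property applies; for
  \<open>x = y\<close> it is a multiple of \<open>x\<close>.\<close>

lemma face_of_cone_summand:
  fixes K :: "'a::euclidean_space set"
  assumes "convex_cone K" "G face_of K" "x \<in> K" "y \<in> K" "x + y \<in> G"
  shows "x \<in> G"
proof -
  have G: "convex_cone G" using convex_cone_face_of assms by blast
  show ?thesis
  proof (cases "x = y")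
    case True
    have "(1/2::real) *\<^sub>R (x + y) \<in> G" using G assms(5) convex_cone_scaleR by (metis divide_nonneg_nonneg zero_le_numeral zero_le_one)
    then show ?thesis using True by (metis scaleR_half_double)
  next
    case False
    have K2: "2 *\<^sub>R x \<in> K" "2 *\<^sub>R y \<in> K" using assms by (simp_all add: convex_cone_scaleR)
    have "x + y \<in> open_segment (2 *\<^sub>R x) (2 *\<^sub>R y)"
      using False by (auto simp: in_segment intro!: exI[of _ "1/2"])
    then have "2 *\<^sub>R x \<in> G" using face_ofD[OF assms(2) _ K2] assms(5) by blast
    then have "(1/2::real) *\<^sub>R 2 *\<^sub>R x \<in> G" using G convex_cone_scaleR by (metis divide_nonneg_nonneg zero_le_numeral zero_le_one)
    then show ?thesis by simp
  qed
qed

text \<open>A face inside one of the facet hyperplanes is a face of a simplicial cone and is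
  generated by the rays that it contains. Any other face contains a point strictly inside all
  half-spaces and is the whole cone.\<close>

lemma face_of_poscone:
  assumes FF: "facet_family d FF" and R: "realizes FF v n" and G: "G face_of poscone v (\<Union>FF)" "G \<noteq> {}"
  shows "\<exists>A\<in>face_poset FF. G = poscone v A"
proof -
  let ?K = "poscone v (\<Union>FF)"
  note D = facet_familyD[OF FF]
  have GK: "G \<subseteq> ?K" using G face_of_imp_subset by blast
  have Gc: "convex_cone G" using convex_cone_face_of[OF convex_cone_poscone G] .
  show ?thesis
  proof (cases "\<exists>F\<in>FF. \<forall>x\<in>G. n F \<bullet> x = 0")
    case True
    then obtain F where F: "F \<in> FF" "\<forall>x\<in>G. n F \<bullet> x = 0" by auto
    let ?A = "{i\<in>F. v i \<in> G}"
    have "G \<subseteq> poscone v F" using F GK unfolding poscone_facet[OF R D(6) F(1)] by auto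
    have "G \<subseteq> poscone v ?A"
    proof
      fix x assume x: "x \<in> G"
      then obtain c where c: "\<And>i. i \<in> F \<Longrightarrow> c i \<ge> (0::real)" "x = (\<Sum>i\<in>F. c i *\<^sub>R v i)"
        using \<open>G \<subseteq> poscone v F\<close> by (auto elim: posconeE)
      have "v i \<in> G" if i: "i \<in> F" "c i > 0" for i
      proof -
        have "x = c i *\<^sub>R v i + (\<Sum>j\<in>F - {i}. c j *\<^sub>R v j)"
          unfolding c(2) using i D(3)[OF F(1)] by (simp add: sum.remove)
        moreover have "(\<Sum>j\<in>F - {i}. c j *\<^sub>R v j) \<in> ?K"
          using posconeI[of "F - {i}" c v] poscone_mono[of "F - {i}" "\<Union>FF" v] c F D(6) by blast
        moreover have "v i \<in> ?K" using i F D(6) by (auto intro: poscone_member)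
        then have "c i *\<^sub>R v i \<in> ?K" using i poscone_scale by (metis less_imp_le)
        ultimately have "c i *\<^sub>R v i \<in> G" using face_of_cone_summand[OF convex_cone_poscone G(1)] x by metis
        then have "(1 / c i) *\<^sub>R c i *\<^sub>R v i \<in> G" using Gc i by (metis convex_cone_scaleR divide_nonneg_pos zero_le_one)
        then show ?thesis using i by simp
      qed
      then have "x = (\<Sum>i\<in>?A. c i *\<^sub>R v i)" unfolding c(2)
        using D(3)[OF F(1)] c(1) by (intro sum.mono_neutral_right) (auto simp: less_eq_real_def)
      then show "x \<in> poscone v ?A" using c(1) by (auto intro!: posconeI)
    qed
    moreover have "poscone v ?A \<subseteq> G" using Gc by (intro poscone_least) auto
    moreover have "?A \<in> face_poset FF" using F by (auto simp: face_poset_def)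
    ultimately show ?thesis by blast
  next
    case False
    then have "\<forall>F\<in>FF. \<exists>x\<in>G. n F \<bullet> x < 0" using GK realizes_le[OF R] by (metis less_eq_real_def subsetD)
    then obtain x where x: "\<And>F. F \<in> FF \<Longrightarrow> x F \<in> G \<and> n F \<bullet> x F < 0" by metis
    \<comment> \<open>The sum of one witness per facet is strictly negative on all normals at
      once.\<close>
    define s where "s = (\<Sum>F\<in>FF. x F)"
    have "(\<Sum>F\<in>XX. x F) \<in> G" if "XX \<subseteq> FF" for XX
      using finite_subset[OF that D(1)] that
    proof (induction XX)
      case empty
      show ?case using Gc convex_cone_contains_0 by auto
    next
      case (insert y X)
      then show ?case using x Gc by (auto intro: convex_cone_add)
    qed
    then have sG: "s \<in> G" unfolding s_def by auto
    have sneg: "n F \<bullet> s < 0" if F: "F \<in> FF" for F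
    proof -
      have "n F \<bullet> s = n F \<bullet> x F + (\<Sum>H\<in>FF - {F}. n F \<bullet> x H)" unfolding s_def inner_sum_right using D(1) F by (simp add: sum.remove)
      moreover have "(\<Sum>H\<in>FF - {F}. n F \<bullet> x H) \<le> 0"
        using x GK realizes_le[OF R _ F] by (intro sum_nonpos) blast
      ultimately show ?thesis using x[OF F] by linarith
    qed
    have "?K \<subseteq> G"
    proof
      fix y assume y: "y \<in> ?K"
      define m where "m = Min ((\<lambda>F. - (n F \<bullet> s)) ` FF)"
      have m: "m > 0" "\<And>F. F \<in> FF \<Longrightarrow> m \<le> - (n F \<bullet> s)" unfolding m_def using D(1,2) sneg by auto
      define M where "M = Max ((\<lambda>F. \<bar>n F \<bullet> y\<bar>) ` FF) + 1"
      have M: "\<And>F. F \<in> FF \<Longrightarrow> \<bar>n F \<bullet> y\<bar> \<le> M" "M > 0"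
      proof -
        show *: "\<bar>n F \<bullet> y\<bar> \<le> M" if "F \<in> FF" for F
        proof -
          have "\<bar>n F \<bullet> y\<bar> \<le> Max ((\<lambda>F. \<bar>n F \<bullet> y\<bar>) ` FF)" using D(1) that by (intro Max_ge) auto
          then show ?thesis unfolding M_def by simp
        qed
        obtain F where "F \<in> FF" using D(2) by auto
        then have "0 \<le> Max ((\<lambda>F. \<bar>n F \<bullet> y\<bar>) ` FF)" using D(1) by (intro Max_ge_iff[THEN iffD2]) auto
        then show "M > 0" unfolding M_def by simp
      qed
      \<comment> \<open>The multiple of \<open>s\<close> is so large that subtracting
        \<open>y\<close> keeps all inequalities; thus \<open>y\<close> is a summand of a point of
        \<open>G\<close>.\<close>
      define z where "z = (M / m) *\<^sub>R s - y"
      have "z \<in> ?K"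
      proof (rule realizesD(5)[OF R])
        fix F assume F: "F \<in> FF"
        have "n F \<bullet> z = (M / m) * (n F \<bullet> s) - n F \<bullet> y" by (simp add: z_def inner_diff_right)
        also have "(M / m) * (n F \<bullet> s) \<le> (M/m) * (- m)" using m(1) m(2)[OF F] M(2) by (intro mult_left_mono) auto
        also have "(M/m) * (- m) = - M" using m by auto
        finally show "n F \<bullet> z \<le> 0" using M(1)[OF F] by linarith
      qed
      moreover have "y + z \<in> G" unfolding z_def using sG Gc m M by (simp add: convex_cone_scaleR)
      ultimately show "y \<in> G" using face_of_cone_summand[OF convex_cone_poscone G(1) y] by blast
    qed
    then show ?thesis using GK by (auto simp: face_poset_def)
  qed
qed

text \<open>A ray in the cone of \<open>B \<subseteq> F\<close> satisfies the equation of
  \<open>F\<close>, so its label belongs to \<open>F\<close>; uniqueness of coefficients on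
  \<open>F\<close> then puts the label into \<open>B\<close>.\<close>

lemma poscone_subset_iff:
  assumes FF: "facet_family d FF" and R: "realizes FF v n" and A: "A \<in> face_poset FF" and B: "B \<in> face_poset FF"
  shows "poscone v A \<inter> sphere 0 1 \<subseteq> poscone v B \<inter> sphere 0 1 \<longleftrightarrow> A \<subseteq> B"
proof
  note D = facet_familyD[OF FF]
  have sub: "A \<subseteq> \<Union>FF" "B \<subseteq> \<Union>FF" using A B by (auto simp: face_poset_def)
  then have fin: "finite A" "finite B" using D(6) finite_subset by blast+
  show "A \<subseteq> B \<Longrightarrow> poscone v A \<inter> sphere 0 1 \<subseteq> poscone v B \<inter> sphere 0 1"
    using poscone_mono fin by blast
  assume sp: "poscone v A \<inter> sphere 0 1 \<subseteq> poscone v B \<inter> sphere 0 1"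
  show "A \<subseteq> B"
  proof
    fix i assume i: "i \<in> A"
    show "i \<in> B"
    proof (cases "B = \<Union>FF")
      case True
      then show ?thesis using i sub by auto
    next
      case False
      then obtain F where F: "F \<in> FF" "B \<subseteq> F" using B by (auto simp: face_poset_def)
      obtain H where H: "H \<in> FF" "i \<notin> H" using facet_family_missed[OF FF, of i] i sub by blast
      have "n H \<bullet> v i < 0" using realizesD(2)[OF R H(1) _ H(2)] i sub by auto
      then have "v i \<noteq> 0" by auto
      then have "(1 / norm (v i)) *\<^sub>R v i \<in> poscone v A \<inter> sphere 0 1"
        using poscone_member[OF i fin(1)] by (auto intro!: poscone_scale)
      then have "(1 / norm (v i)) *\<^sub>R v i \<in> poscone v B" using sp by blast
      then have "norm (v i) *\<^sub>R (1 / norm (v i)) *\<^sub>R v i \<in> poscone v B" by (rule poscone_scale) auto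
      then have vB: "v i \<in> poscone v B" using \<open>v i \<noteq> 0\<close> by simp
      then have "v i \<in> poscone v F" using poscone_mono[OF F(2)] D(3)[OF F(1)] by blast
      then have "n F \<bullet> v i = 0" unfolding poscone_facet[OF R D(6) F(1)] by auto
      then have iF: "i \<in> F" using realizesD(2)[OF R F(1), of i] i sub by auto
      obtain c where c: "v i = (\<Sum>j\<in>B. c j *\<^sub>R v j)" using vB by (rule posconeE) blast
      have "(\<Sum>j\<in>F. (if j = i then 1 else 0) *\<^sub>R v j) = v i"
        using iF D(3)[OF F(1)] by (subst sum.mono_neutral_right[of F "{i}"]) auto
      moreover have "(\<Sum>j\<in>F. (if j \<in> B then c j else 0) *\<^sub>R v j) = v i"
        unfolding c by (rule sum.mono_neutral_cong_right) (use F D(3)[OF F(1)] in auto)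
      ultimately have "(\<lambda>j. if j = i then 1 else 0) i = (\<lambda>j. if j \<in> B then c j else 0) i"
        by (intro independent_sum_eqD[OF realizesD(3,4)[OF R F(1)] D(3)[OF F(1)] _ iF]) simp
      then show ?thesis by (auto split: if_splits)
    qed
  qed
qed

lemma empty_in_face_poset: "facet_family d FF \<Longrightarrow> {} \<in> face_poset FF"
  using facet_familyD(2) by (auto simp: face_poset_def)

lemma spherical_faces_poscone:
  assumes FF: "facet_family d FF" and R: "realizes FF v n" and Q: "convex_cone hull Q = poscone v (\<Union>FF)"
  shows "spherical_faces Q = (\<lambda>A. poscone v A \<inter> sphere 0 1) ` face_poset FF"
proof (intro subset_antisym subsetI)
  fix X assume "X \<in> spherical_faces Q"
  then obtain G where G: "G face_of poscone v (\<Union>FF)" "X = G \<inter> sphere 0 1"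
    unfolding spherical_faces_def Q by auto
  show "X \<in> (\<lambda>A. poscone v A \<inter> sphere 0 1) ` face_poset FF"
  proof (cases "G = {}")
    \<comment> \<open>The faces \<open>{}\<close> and \<open>{0}\<close> of the cone have the same
      trace on the sphere, the empty spherical face.\<close>
    case True
    then have "X = poscone v {} \<inter> sphere 0 1" using G by auto
    then show ?thesis using empty_in_face_poset[OF FF] by blast
  next
    case False
    then show ?thesis using face_of_poscone[OF FF R G(1)] G by blast
  qed
next
  fix X assume "X \<in> (\<lambda>A. poscone v A \<inter> sphere 0 1) ` face_poset FF"
  then show "X \<in> spherical_faces Q" unfolding spherical_faces_def Q
    using poscone_face_of[OF R facet_familyD(6)[OF FF]] by auto
qed

lemma lattice_isomorphic_spherical_faces:
  assumes FF: "facet_family d FF" and R: "realizes FF v n" and Q: "convex_cone hull Q = poscone v (\<Union>FF)"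
  shows "lattice_isomorphic (face_poset FF) (spherical_faces Q)"
  unfolding spherical_faces_poscone[OF assms]
  by (rule lattice_isomorphic_image) (use poscone_subset_iff[OF FF R] in blast)

section \<open>Stacking one ray onto a realized complex\<close>

lemma facet_spans:
  fixes x :: "'a::euclidean_space"
  assumes "inj_on v F" "independent (v ` F)" "finite F" "card F + 1 = DIM('a)"
    "\<And>i. i \<in> F \<Longrightarrow> m \<bullet> v i = 0" "m \<bullet> x \<noteq> 0"
  shows "x \<notin> v ` F" "independent (insert x (v ` F))" "span (insert x (v ` F)) = UNIV"
proof -
  have "m \<bullet> y = 0" if "y \<in> span (v ` F)" for y
    using that by (induction rule: span_induct) (auto simp: subspace_hyperplane assms(5))
  then have "x \<notin> span (v ` F)" using assms(6) by auto
  then show x: "x \<notin> v ` F" and ind: "independent (insert x (v ` F))"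
    using assms(2) span_base[of x "v ` F"] by (auto simp: independent_insert)
  have "card (insert x (v ` F)) = DIM('a)"
    using x assms(1,3,4) by (simp add: card_image)
  then show "span (insert x (v ` F)) = UNIV"
    using ind assms(3) by (metis card_eq_dim dim_UNIV dim_subset_UNIV finite_imageI finite_insert order_refl subset_UNIV top.extremum_uniqueI)
qed

lemma spanning_inner_zero:
  fixes u :: "'a::euclidean_space"
  assumes "span S = UNIV" "\<And>y. y \<in> S \<Longrightarrow> u \<bullet> y = 0"
  shows "u = 0"
proof -
  have "u \<bullet> y = 0" if "y \<in> span S" for y
    using that by (induction rule: span_induct) (auto simp: subspace_hyperplane assms(2))
  then have "u \<bullet> u = 0" using assms(1) by blast
  then show ?thesis by simp
qed

text \<open>\<open>x\<close> is beyond \<open>F\<close> and strictly beneath all other facets. Each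
  \<open>m j\<close> is a positive multiple of a positive combination of \<open>n F\<close> and the
  normal across the ridge \<open>F - {j}\<close>, hence negative on all rays off
  \<open>F\<close>.\<close>

lemma realizes_stack:
  fixes v :: "'i \<Rightarrow> 'a::euclidean_space"
  assumes FF: "facet_family d FF" and R: "realizes FF v n" and d: "d + 1 = DIM('a)" "d \<ge> 2"
    and F: "F \<in> FF" and p: "p \<notin> \<Union>FF" and x: "n F \<bullet> x > 0" "\<And>G. G \<in> FF \<Longrightarrow> G \<noteq> F \<Longrightarrow> n G \<bullet> x < 0"
    and m: "\<And>j. j \<in> F \<Longrightarrow> m j \<bullet> x = 0" "\<And>i j. j \<in> F \<Longrightarrow> i \<in> F \<Longrightarrow> i \<noteq> j \<Longrightarrow> m j \<bullet> v i = 0"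
      "\<And>j. j \<in> F \<Longrightarrow> m j \<bullet> v j < 0"
    and n': "\<And>G. G \<in> FF \<Longrightarrow> G \<noteq> F \<Longrightarrow> n' G = n G" "\<And>j. j \<in> F \<Longrightarrow> n' (insert p (F - {j})) = m j"
  shows "realizes (stack_family FF F p) (v(p := x)) n'"
proof -
  note D = facet_familyD[OF FF]
  note RD = realizesD[OF R]
  have finF: "finite F" "card F = d" "p \<notin> F" using D F p by auto
  have V': "\<Union>(stack_family FF F p) = insert p (\<Union>FF)" by (rule Union_stack_family[OF FF F d(2)])
  have sp: "x \<notin> v ` F" "independent (insert x (v ` F))" "span (insert x (v ` F)) = UNIV"
    using facet_spans[OF RD(3,4)[OF F] finF(1), of "n F" x] finF d RD(1)[OF F] x(1) by auto
  have combo: "m j \<bullet> v i < 0" if j: "j \<in> F" and i: "i \<in> \<Union>FF - F" for i j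
  proof -
    obtain G where G: "G \<in> FF" "G \<noteq> F" "F - {j} \<subseteq> G" using D(5)[OF F j] by auto
    have jG: "j \<notin> G" using facet_family_eq[OF FF F G(1)] G by auto
    \<comment> \<open>The combination of the two normals at the ridge \<open>F - {j}\<close> that
      vanishes at \<open>x\<close>; both coefficients are positive, as
      \<open>n F \<bullet> x > 0\<close> and \<open>n G \<bullet> x < 0\<close>.\<close>
    define c where "c = (n F \<bullet> x) *\<^sub>R n G - (n G \<bullet> x) *\<^sub>R n F"
    have cx: "c \<bullet> x = 0" by (simp add: c_def inner_diff_left)
    have ci: "c \<bullet> v i = 0" if "i \<in> F" "i \<noteq> j" for i
      using that RD(1)[OF F] RD(1)[OF G(1)] G(3) by (auto simp: c_def inner_diff_left)
    have nG: "n G \<bullet> v j < 0" using RD(2)[OF G(1) _ jG] j F by auto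
    have cj: "c \<bullet> v j < 0" using RD(1)[OF F j] nG x(1) by (simp add: c_def inner_diff_left mult_pos_neg)
    \<comment> \<open>\<open>m j\<close> and \<open>c\<close> both vanish at \<open>x\<close> and at
      the rays of \<open>F\<close> other than \<open>v j\<close>, so they are proportional, and
      their values at \<open>v j\<close> give the factor.\<close>
    define l where "l = (m j \<bullet> v j) / (c \<bullet> v j)"
    have l: "l > 0" unfolding l_def using cj m(3)[OF j] by (simp add: divide_neg_neg)
    have "m j - l *\<^sub>R c = 0"
    proof (rule spanning_inner_zero[OF sp(3)])
      fix y assume "y \<in> insert x (v ` F)"
      then consider "y = x" | "y = v j" | i where "i \<in> F" "i \<noteq> j" "y = v i" by auto
      then show "(m j - l *\<^sub>R c) \<bullet> y = 0"
      proof cases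
        case 1
        then show ?thesis using m(1)[OF j] cx by (simp add: inner_diff_left)
      next
        case 2
        then show ?thesis using cj by (simp add: inner_diff_left l_def)
      next
        case 3
        then show ?thesis using m(2)[OF j] ci by (simp add: inner_diff_left)
      qed
    qed
    then have "m j \<bullet> v i = l * (c \<bullet> v i)" by (metis eq_iff_diff_eq_0 inner_scaleR_left)
    moreover have "c \<bullet> v i < 0"
    proof -
      have "n G \<bullet> v i \<le> 0" using RD(1,2)[OF G(1)] i by (cases "i \<in> G") (auto intro: less_imp_le)
      then have "(n F \<bullet> x) * (n G \<bullet> v i) \<le> 0" using x(1) by (simp add: mult_nonneg_nonpos)
      moreover have "(n G \<bullet> x) * (n F \<bullet> v i) > 0" using RD(2)[OF F, of i] i x(2)[OF G(1,2)] by (auto simp: mult_neg_neg)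
      ultimately show ?thesis by (simp add: c_def inner_diff_left)
    qed
    ultimately show ?thesis using l by (simp add: mult_pos_neg)
  qed
  have cases: "(\<exists>j\<in>F. H = insert p (F - {j})) \<or> (H \<in> FF \<and> H \<noteq> F)" if "H \<in> stack_family FF F p" for H
    using that by (auto simp: stack_family_def)
  have vV: "(v(p := x)) i = v i" if "i \<in> \<Union>FF" for i using that p by auto
  show ?thesis
    unfolding realizes_def V'
  proof (intro conjI ballI allI impI)
    fix H i assume H: "H \<in> stack_family FF F p" and i: "i \<in> H"
    show "n' H \<bullet> (v(p := x)) i = 0"
      using cases[OF H]
    proof
      assume "\<exists>j\<in>F. H = insert p (F - {j})"
      then obtain j where j: "j \<in> F" "H = insert p (F - {j})" by auto
      then show ?thesis using i m(1,2)[OF j(1)] n'(2)[OF j(1)] finF(3) by auto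
    next
      assume "H \<in> FF \<and> H \<noteq> F"
      then show ?thesis using i p RD(1)[of H i] n'(1)[of H] by auto
    qed
  next
    fix H i assume H: "H \<in> stack_family FF F p" and i: "i \<in> insert p (\<Union>FF) - H"
    show "n' H \<bullet> (v(p := x)) i < 0"
      using cases[OF H]
    proof
      assume "\<exists>j\<in>F. H = insert p (F - {j})"
      then obtain j where j: "j \<in> F" "H = insert p (F - {j})" by auto
      then have "i \<noteq> p" "i \<in> \<Union>FF" "i \<notin> F \<or> i = j" using i by auto
      then show ?thesis using combo[OF j(1), of i] m(3)[OF j(1)] n'(2)[OF j(1)] j(2) by auto
    next
      assume "H \<in> FF \<and> H \<noteq> F"
      then show ?thesis using i x(2) RD(2)[of H i] n'(1)[of H] by auto
    qed
  next
    fix H assume H: "H \<in> stack_family FF F p"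
    have *: "inj_on (v(p := x)) H \<and> independent ((v(p := x)) ` H)"
      using cases[OF H]
    proof
      assume "\<exists>j\<in>F. H = insert p (F - {j})"
      then obtain j where j: "j \<in> F" "H = insert p (F - {j})" by auto
      have im: "(v(p := x)) ` H = insert x (v ` (F - {j}))" unfolding j(2) using finF(3) by auto
      have "inj_on (v(p := x)) (F - {j})"
        using RD(3)[OF F] finF(3) by (auto simp: inj_on_def)
      then have "inj_on (v(p := x)) H" unfolding j(2) using sp(1) finF(3) by auto
      moreover have "independent ((v(p := x)) ` H)" unfolding im by (rule independent_mono[OF sp(2)]) auto
      ultimately show ?thesis by auto
    next
      assume "H \<in> FF \<and> H \<noteq> F"
      then have H: "H \<in> FF" "p \<notin> H" using p by auto
      then have "(v(p := x)) ` H = v ` H" "inj_on (v(p := x)) H = inj_on v H"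
        by (auto intro!: inj_on_cong image_cong)
      then show ?thesis using RD(3,4)[OF H(1)] by simp
    qed
    then show "inj_on (v(p := x)) H" "independent ((v(p := x)) ` H)" by auto
  next
    fix y assume y: "\<forall>H\<in>stack_family FF F p. n' H \<bullet> y \<le> 0"
    show "y \<in> poscone (v(p := x)) (insert p (\<Union>FF))"
    proof (cases "n F \<bullet> y \<le> 0")
      case True
      have "n G \<bullet> y \<le> 0" if "G \<in> FF" for G
      proof (cases "G = F")
        case False
        then have "G \<in> stack_family FF F p" using that by (auto simp: stack_family_def)
        then show ?thesis using y n'(1)[OF that False] by auto
      qed (use True in auto)
      then have "y \<in> poscone v (\<Union>FF)" by (rule RD(5))
      also have "poscone v (\<Union>FF) = poscone (v(p := x)) (\<Union>FF)"
        unfolding poscone_def using vV by (metis (no_types, lifting) sum.cong)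
      also have "\<dots> \<subseteq> poscone (v(p := x)) (insert p (\<Union>FF))" using D(6) by (intro poscone_mono) auto
      finally show ?thesis .
    next
      case False
      \<comment> \<open>Now \<open>y\<close> is beyond \<open>F\<close> and belongs to the new
        simplicial cone: in the basis of \<open>x\<close> and the rays of \<open>F\<close>, the sign
        of the coefficient of \<open>x\<close> is given by \<open>n F\<close>, that of
        \<open>v j\<close> by \<open>m j\<close>.\<close>
      have "y \<in> span (insert x (v ` F))" using sp(3) by auto
      then obtain k where "y - k *\<^sub>R x \<in> span (v ` F)" by (auto simp: span_breakdown_eq)
      then obtain u where u: "y - k *\<^sub>R x = (\<Sum>w\<in>v ` F. u w *\<^sub>R w)" using finF(1) by (auto simp: span_finite)
      then have yk: "y = k *\<^sub>R x + (\<Sum>i\<in>F. u (v i) *\<^sub>R v i)" using RD(3)[OF F] by (simp add: sum.reindex algebra_simps)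
      have "n F \<bullet> y = k * (n F \<bullet> x)" unfolding yk using RD(1)[OF F] by (simp add: inner_add_right inner_sum_right)
      then have k: "k > 0" using False x(1) by (simp add: zero_less_mult_iff not_le)
      have uj: "u (v j) \<ge> 0" if j: "j \<in> F" for j
      proof -
        have "m j \<bullet> y = (\<Sum>i\<in>F. u (v i) * (m j \<bullet> v i))" unfolding yk using m(1)[OF j] by (simp add: inner_add_right inner_sum_right)
        also have "\<dots> = u (v j) * (m j \<bullet> v j)" using finF(1) j m(2)[OF j] by (subst sum.remove[OF _ j]) auto
        finally have my: "m j \<bullet> y = u (v j) * (m j \<bullet> v j)" .
        have "insert p (F - {j}) \<in> stack_family FF F p" using j by (auto simp: stack_family_def)
        then have "n' (insert p (F - {j})) \<bullet> y \<le> 0" using y by blast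
        then have "u (v j) * (m j \<bullet> v j) \<le> 0" using n'(2)[OF j] my by simp
        then show ?thesis using m(3)[OF j] by (simp add: mult_le_0_iff)
      qed
      have "(\<Sum>i\<in>F. u (v i) *\<^sub>R v i) = (\<Sum>i\<in>F. u (v i) *\<^sub>R (v(p := x)) i)"
        using finF(3) by (intro sum.cong) auto
      then have "(\<Sum>i\<in>F. u (v i) *\<^sub>R v i) \<in> poscone (v(p := x)) F"
        using posconeI[of F "\<lambda>i. u (v i)" "v(p := x)"] uj by presburger
      moreover have "poscone (v(p := x)) F \<subseteq> poscone (v(p := x)) (insert p (\<Union>FF))" using D(6) F by (intro poscone_mono) auto
      moreover have "(v(p := x)) p \<in> poscone (v(p := x)) (insert p (\<Union>FF))" using D(6) by (intro poscone_member) auto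
      then have "k *\<^sub>R x \<in> poscone (v(p := x)) (insert p (\<Union>FF))" using k poscone_scale by fastforce
      ultimately show ?thesis unfolding yk using poscone_add by blast
    qed
  qed
qed

text \<open>The new normals are explicit combinations of old ones, so only the position of
  \<open>x\<close> has to be supplied.\<close>

lemma realizes_stack_exists:
  fixes v :: "'i \<Rightarrow> 'a::euclidean_space"
  assumes FF: "facet_family d FF" and R: "realizes FF v n" and d: "d + 1 = DIM('a)" "d \<ge> 2"
    and F: "F \<in> FF" and p: "p \<notin> \<Union>FF" and x: "n F \<bullet> x > 0" "\<And>G. G \<in> FF \<Longrightarrow> G \<noteq> F \<Longrightarrow> n G \<bullet> x < 0"
  shows "\<exists>n'. realizes (stack_family FF F p) (v(p := x)) n'"
proof -
  note D = facet_familyD[OF FF]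
  note RD = realizesD[OF R]
  obtain G where G: "\<And>j. j \<in> F \<Longrightarrow> G j \<in> FF \<and> G j \<noteq> F \<and> F - {j} \<subseteq> G j" using D(5)[OF F] by metis
  define m where "m j = (n F \<bullet> x) *\<^sub>R n (G j) - (n (G j) \<bullet> x) *\<^sub>R n F" for j
  \<comment> \<open>A new facet contains \<open>p\<close>, which separates it from the old ones, and
    it determines the dropped label \<open>j\<close>.\<close>
  define n' where "n' H = (if H \<in> FF then n H else m (THE j. j \<in> F \<and> H = insert p (F - {j})))" for H
  have "realizes (stack_family FF F p) (v(p := x)) n'"
  proof (rule realizes_stack[OF FF R d F p x])
    fix j assume j: "j \<in> F"
    show "m j \<bullet> x = 0" by (simp add: m_def inner_diff_left)
    have jG: "j \<notin> G j" using facet_family_eq[OF FF F] G[OF j] by auto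
    have nG: "n (G j) \<bullet> v j < 0" using RD(2)[OF _ _ jG] j F G[OF j] by auto
    then show "m j \<bullet> v j < 0" using RD(1)[OF F j] x(1) by (simp add: m_def inner_diff_left mult_pos_neg)
    show "m j \<bullet> v i = 0" if "i \<in> F" "i \<noteq> j" for i
      using that RD(1)[OF F] RD(1)[of "G j"] G[OF j] by (auto simp: m_def inner_diff_left)
    have "insert p (F - {j}) \<notin> FF" using p by auto
    moreover have "(THE k. k \<in> F \<and> insert p (F - {j}) = insert p (F - {k})) = j"
      using j p F by (intro the_equality) auto
    ultimately show "n' (insert p (F - {j})) = m j" by (simp add: n'_def)
  qed (auto simp: n'_def)
  then show ?thesis by blast
qed

section \<open>Recovering rays and normals from a face lattice\<close>

lemma pointed_zero_face:
  fixes K :: "'a::euclidean_space set"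
  assumes "convex_cone K" "\<And>x. x \<in> K \<Longrightarrow> - x \<in> K \<Longrightarrow> x = 0"
  shows "{0} face_of K"
  unfolding face_of_singleton extreme_point_of_def
proof (intro conjI ballI notI)
  show "0 \<in> K" using assms(1) convex_cone_contains_0 by blast
  fix a b assume a: "a \<in> K" and b: "b \<in> K" and z: "0 \<in> open_segment a b"
  obtain u where u: "a \<noteq> b" "0 < u" "u < 1" "0 = (1 - u) *\<^sub>R a + u *\<^sub>R b" using z by (auto simp: in_segment)
  have 1: "(1 - u) *\<^sub>R a \<in> K" "u *\<^sub>R b \<in> K" using a b u assms(1) by (simp_all add: convex_cone_scaleR)
  have "u *\<^sub>R b = - ((1 - u) *\<^sub>R a)" using u(4) by (simp add: eq_neg_iff_add_eq_0 add.commute)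
  then have "(1 - u) *\<^sub>R a = 0" using 1 assms(2) by metis
  then have "a = 0" "u *\<^sub>R b = 0" using u by auto
  then show False using u by simp
qed

text \<open>Removing the empty face of the cone makes the trace on the sphere injective;
  \<open>{0}\<close> then stands for the empty spherical face.\<close>

lemma nonempty_faces_isomorphic:
  fixes Q :: "'a::euclidean_space set"
  assumes "\<And>x. x \<in> convex_cone hull Q \<Longrightarrow> - x \<in> convex_cone hull Q \<Longrightarrow> x = 0"
  shows "lattice_isomorphic {G. G face_of convex_cone hull Q \<and> G \<noteq> {}} (spherical_faces Q)"
proof -
  let ?K = "convex_cone hull Q" and ?L = "{G. G face_of convex_cone hull Q \<and> G \<noteq> {}}"
  have K: "convex_cone ?K" by (rule convex_cone_convex_cone_hull)
  have "spherical_faces Q = (\<lambda>G. G \<inter> sphere 0 1) ` ?L"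
  proof (intro subset_antisym subsetI)
    fix X assume "X \<in> spherical_faces Q"
    then obtain G where G: "G face_of ?K" "X = G \<inter> sphere 0 1" unfolding spherical_faces_def by auto
    show "X \<in> (\<lambda>G. G \<inter> sphere 0 1) ` ?L"
    proof (cases "G = {}")
      case True
      then have "X = {0} \<inter> sphere 0 1" using G by auto
      then show ?thesis using pointed_zero_face[OF K assms] by blast
    qed (use G in auto)
  qed (auto simp: spherical_faces_def)
  moreover have "G \<inter> sphere 0 1 \<subseteq> H \<inter> sphere 0 1 \<longleftrightarrow> G \<subseteq> H" if GH: "G \<in> ?L" "H \<in> ?L" for G H
  proof
    assume sub: "G \<inter> sphere 0 1 \<subseteq> H \<inter> sphere 0 1"
    have cc: "convex_cone G" "convex_cone H" using convex_cone_face_of[OF K] GH by auto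
    show "G \<subseteq> H"
    proof
      fix x assume x: "x \<in> G"
      show "x \<in> H"
      proof (cases "x = 0")
        case True
        then show ?thesis using cc convex_cone_contains_0 by auto
      next
        case False
        have "(1 / norm x) *\<^sub>R x \<in> G \<inter> sphere 0 1" using False x cc(1) by (simp add: convex_cone_scaleR)
        then have "(1 / norm x) *\<^sub>R x \<in> H" using sub by blast
        then have "norm x *\<^sub>R (1 / norm x) *\<^sub>R x \<in> H" using cc(2) by (metis convex_cone_scaleR norm_ge_zero)
        then show ?thesis using False by simp
      qed
    qed
  qed auto
  ultimately show ?thesis using lattice_isomorphic_image[of ?L "\<lambda>G. G \<inter> sphere 0 1"] by simp
qed

text \<open>Rays are picked in the images of singletons, normals come from hyperplanes that expose
  the images of the facets. The main work is to show that these rays generate every face.\<close>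

lemma realizes_from_lattice:
  fixes K :: "'a::euclidean_space set"
  assumes FF: "facet_family d FF" and d: "d + 1 = DIM('a)" "d \<ge> 1"
    and K: "polyhedron K" "convex_cone K" "\<And>x. x \<in> K \<Longrightarrow> - x \<in> K \<Longrightarrow> x = 0" "aff_dim K = DIM('a)"
    and iso: "lattice_isomorphic (face_poset FF) {G. G face_of K \<and> G \<noteq> {}}"
  shows "\<exists>v n. realizes FF v n \<and> K = poscone v (\<Union>FF)"
proof -
  note D = facet_familyD[OF FF]
  let ?L = "face_poset FF"
  obtain \<psi> where bij: "bij_betw \<psi> ?L {G. G face_of K \<and> G \<noteq> {}}"
    and mono: "\<And>A B. A \<in> ?L \<Longrightarrow> B \<in> ?L \<Longrightarrow> A \<subseteq> B \<longleftrightarrow> \<psi> A \<subseteq> \<psi> B"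
    using iso unfolding lattice_isomorphic_def by auto
  have face: "\<psi> A face_of K" "\<psi> A \<noteq> {}" if "A \<in> ?L" for A using bij that unfolding bij_betw_def by auto
  have surj: "\<exists>A\<in>?L. G = \<psi> A" if "G face_of K" "G \<noteq> {}" for G using bij that unfolding bij_betw_def by blast
  have cc: "convex_cone (\<psi> A)" if "A \<in> ?L" for A using convex_cone_face_of[OF K(2)] face that by blast
  have subK: "\<psi> A \<subseteq> K" if "A \<in> ?L" for A using face that face_of_imp_subset by blast
  have z: "0 \<in> \<psi> A" if "A \<in> ?L" for A using cc that convex_cone_contains_0 by blast
  have e: "{} \<in> ?L" by (rule empty_in_face_poset[OF FF])
  have VL: "\<Union>FF \<in> ?L" by (auto simp: face_poset_def)
  have finL: "finite A" if "A \<in> ?L" for A using that D(3,6) by (auto simp: face_poset_def intro: finite_subset)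
  have FL: "F \<in> ?L" if "F \<in> FF" for F using that by (auto simp: face_poset_def)
  have \<psi>0: "\<psi> {} = {0}"
  proof -
    obtain A where A: "A \<in> ?L" "{0} = \<psi> A" using surj[OF pointed_zero_face[OF K(2,3)]] by auto
    then have "\<psi> {} \<subseteq> {0}" using mono[OF e A(1)] by auto
    then show ?thesis using face(2)[OF e] by auto
  qed
  have \<psi>V: "\<psi> (\<Union>FF) = K"
  proof -
    have "K face_of K" "K \<noteq> {}" using K(1) polyhedron_imp_convex face_of_refl K(2) convex_cone_nonempty by auto
    then obtain A where A: "A \<in> ?L" "K = \<psi> A" using surj by auto
    have "A \<subseteq> \<Union>FF" using A(1) by (auto simp: face_poset_def)
    then show ?thesis using mono[OF A(1) VL] A subK[OF VL] by auto
  qed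
  have sing: "{i} \<in> ?L" if "i \<in> \<Union>FF" for i using that by (auto simp: face_poset_def)
  have "\<exists>x. x \<in> \<psi> {i} \<and> x \<noteq> 0" if i: "i \<in> \<Union>FF" for i
  proof (rule ccontr)
    assume "\<nexists>x. x \<in> \<psi> {i} \<and> x \<noteq> 0"
    then have "\<psi> {i} \<subseteq> \<psi> {}" using \<psi>0 by auto
    then show False using mono[OF sing[OF i] e] by auto
  qed
  then obtain v where v: "\<And>i. i \<in> \<Union>FF \<Longrightarrow> v i \<in> \<psi> {i} \<and> v i \<noteq> 0" by metis
  have vK: "v i \<in> K" if "i \<in> \<Union>FF" for i using v[OF that] subK[OF sing[OF that]] by auto
  \<comment> \<open>\<open>\<psi> A \<inter> \<psi> {i}\<close> is a face inside
    \<open>\<psi> {i}\<close> that contains the nonzero vector \<open>v i\<close>, so it is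
    \<open>\<psi> {i}\<close> itself.\<close>
  have mem: "v i \<in> \<psi> A \<longleftrightarrow> i \<in> A" if A: "A \<in> ?L" and i: "i \<in> \<Union>FF" for i A
  proof
    assume "i \<in> A"
    then show "v i \<in> \<psi> A" using mono[OF sing[OF i] A] v[OF i] by auto
  next
    assume vi: "v i \<in> \<psi> A"
    have "\<psi> A \<inter> \<psi> {i} face_of K" "v i \<in> \<psi> A \<inter> \<psi> {i}" using face_of_Int face A sing[OF i] v[OF i] vi by auto
    then obtain B where B: "B \<in> ?L" "\<psi> A \<inter> \<psi> {i} = \<psi> B" using surj by blast
    have "B \<subseteq> {i}" using mono[OF B(1) sing[OF i]] B(2) by auto
    moreover have "B \<noteq> {}" using B(2) \<psi>0 v[OF i] \<open>v i \<in> \<psi> A \<inter> \<psi> {i}\<close> by auto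
    ultimately have "B = {i}" by auto
    then show "i \<in> A" using mono[OF sing[OF i] A] B(2) by auto
  qed
  \<comment> \<open>Induction on \<open>A\<close>: a point of the face is moved in direction
    \<open>- v i\<close> until it reaches the relative boundary. The exit point lies in a facet of
    \<open>\<psi> A\<close>, which is \<open>\<psi> B\<close> for some
    \<open>B \<subset> A\<close>.\<close>
  have gen: "\<psi> A = poscone v A" if "A \<in> ?L" for A
    using finL[OF that] that
  proof (induction A rule: finite_psubset_induct)
    case (psubset A)
    have AV: "A \<subseteq> \<Union>FF" using psubset.prems by (auto simp: face_poset_def)
    have pcs: "poscone v A \<subseteq> \<psi> A" using mem[OF psubset.prems] AV by (intro poscone_least cc[OF psubset.prems]) blast
    show ?case
    proof (cases "A = {}")
      case True
      then show ?thesis using \<psi>0 by simp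
    next
      case False
      then obtain i where i: "i \<in> A" by auto
      let ?G = "\<psi> A"
      have vG: "v i \<in> ?G" using mem[OF psubset.prems] i AV by blast
      have polG: "polyhedron ?G" using face_of_polyhedron_polyhedron K(1) face psubset.prems by blast
      have clG: "closed ?G" using polG polyhedron_imp_closed by blast
      have nvG: "- v i \<notin> ?G"
        using K(3)[OF vK[of i]] subK[OF psubset.prems] v[of i] i AV by blast
      have "?G \<subseteq> poscone v A"
      proof
        fix x assume x: "x \<in> ?G"
        define T where "T = {t. t \<ge> 0 \<and> x - t *\<^sub>R v i \<in> ?G}"
        have clT: "closed T"
        proof -
          have "closed {t. 0 \<le> t \<and> x - t *\<^sub>R v i \<in> ?G} \<longleftrightarrow> closed ({0..} \<inter> (\<lambda>t. x - t *\<^sub>R v i) -` ?G)"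
            by (auto simp: Int_def vimage_def)
          moreover have "closed ({0..} \<inter> (\<lambda>t::real. x - t *\<^sub>R v i) -` ?G)"
            by (intro closed_Int closed_vimage clG continuous_intros)
          ultimately show ?thesis unfolding T_def by simp
        qed
        have "open (- ?G)" using clG by auto
        then obtain \<epsilon> where \<epsilon>: "\<epsilon> > 0" "ball (- v i) \<epsilon> \<subseteq> - ?G" using nvG open_contains_ball by blast
        \<comment> \<open>For large \<open>t\<close> the rescaled point
          \<open>(1 / t) *\<^sub>R (x - t *\<^sub>R v i)\<close> is near \<open>- v i\<close>, but
          pointedness and closedness keep the face away from there.\<close>
        have bdT: "t \<le> norm x / \<epsilon>" if t: "t \<in> T" for t
        proof (rule ccontr)
          assume "\<not> t \<le> norm x / \<epsilon>"
          then have tt: "t > norm x / \<epsilon>" by simp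
          then have tpos: "t > 0" using \<epsilon>(1) by (smt (verit) divide_nonneg_nonneg norm_ge_zero)
          have "(1 / t) *\<^sub>R (x - t *\<^sub>R v i) \<in> ?G"
            using t tpos cc[OF psubset.prems] unfolding T_def by (simp add: convex_cone_scaleR)
          moreover have "dist (- v i) ((1 / t) *\<^sub>R (x - t *\<^sub>R v i)) = norm x / t"
            using tpos by (simp add: dist_norm scaleR_diff_right)
          moreover have "norm x / t < \<epsilon>" using tt tpos \<epsilon>(1) by (simp add: field_simps)
          ultimately show False using \<epsilon>(2) by (metis ComplD mem_ball subsetD)
        qed
        have T0: "0 \<in> T" using x unfolding T_def by simp
        define s where "s = Sup T"
        have bda: "bdd_above T" using bdT by (auto simp: bdd_above_def)
        have sT: "s \<in> T" unfolding s_def using closed_contains_Sup[OF _ bda clT] T0 by auto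
        have smax: "t \<le> s" if "t \<in> T" for t unfolding s_def using cSup_upper[OF that bda] .
        define y where "y = x - s *\<^sub>R v i"
        have yG: "y \<in> ?G" using sT unfolding T_def y_def by auto
        have "y \<notin> rel_interior ?G"
        proof
          assume yr: "y \<in> rel_interior ?G"
          have "y + v i \<in> ?G" using yG vG cc[OF psubset.prems] by (simp add: convex_cone_add)
          then have "y + v i \<in> affine hull ?G" by (rule hull_inc)
          \<comment> \<open>From a relative interior point the movement could be continued a little,
            away from \<open>y + v i\<close>, contrary to the maximality of
            \<open>s\<close>.\<close>
          then obtain m where m: "m > 1" "\<And>e. e > 1 \<and> e \<le> m \<Longrightarrow> (1 - e) *\<^sub>R (y + v i) + e *\<^sub>R y \<in> ?G"
            using convex_rel_interior_if[OF polyhedron_imp_convex[OF polG] yr] by blast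
          have "(1 - m) *\<^sub>R (y + v i) + m *\<^sub>R y = x - (s + (m - 1)) *\<^sub>R v i"
            unfolding y_def by (simp add: algebra_simps)
          then have "s + (m - 1) \<in> T" using m(1) m(2)[of m] sT unfolding T_def by auto
          then show False using smax m(1) by fastforce
        qed
        then have "y \<in> rel_frontier ?G" unfolding rel_frontier_def using yG clG by simp
        then obtain H where H: "H facet_of ?G" "y \<in> H" unfolding rel_frontier_of_polyhedron[OF polG] by auto
        have HK: "H face_of K" using facet_of_imp_face_of[OF H(1)] face(1)[OF psubset.prems] face_of_trans by blast
        then obtain B where B: "B \<in> ?L" "H = \<psi> B" using surj H(2) by blast
        have "H \<subseteq> ?G" "H \<noteq> ?G" using facet_of_imp_subset H(1) by (auto simp: facet_of_irrefl)
        then have "B \<subset> A" using mono[OF B(1) psubset.prems] mono[OF psubset.prems B(1)] B(2) by auto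
        then have "H = poscone v B" using psubset.IH[OF _ B(1)] B(2) by auto
        then have "y \<in> poscone v A" using H(2) poscone_mono[of B A v] \<open>B \<subset> A\<close> psubset.hyps by blast
        moreover have "s *\<^sub>R v i \<in> poscone v A" using sT poscone_scale[OF poscone_member[OF i psubset.hyps]] unfolding T_def by blast
        ultimately have "y + s *\<^sub>R v i \<in> poscone v A" by (rule poscone_add)
        then show "x \<in> poscone v A" by (simp add: y_def)
      qed
      then show ?thesis using pcs by auto
    qed
  qed
  have FV: "F \<noteq> \<Union>FF" if "F \<in> FF" for F using facet_family_neq_Union[OF FF that d(2)] .
  have FK: "\<psi> F \<noteq> K" if "F \<in> FF" for F
    using mono[OF VL FL[OF that]] FV[OF that] \<psi>V that by blast
  have "\<exists>a. K \<subseteq> {x. a \<bullet> x \<le> 0} \<and> \<psi> F = K \<inter> {x. a \<bullet> x = 0}" if F: "F \<in> FF" for F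
  proof -
    have "\<psi> F exposed_face_of K" using exposed_face_of_polyhedron[OF K(1)] face(1)[OF FL[OF F]] by blast
    then obtain a b where ab: "K \<subseteq> {x. a \<bullet> x \<le> b}" "\<psi> F = K \<inter> {x. a \<bullet> x = b}"
      unfolding exposed_face_of using FK[OF F] face(2)[OF FL[OF F]] by blast
    then have "b = 0" using z[OF FL[OF F]] by auto
    then show ?thesis using ab by auto
  qed
  then obtain n where n: "\<And>F. F \<in> FF \<Longrightarrow> K \<subseteq> {x. n F \<bullet> x \<le> 0} \<and> \<psi> F = K \<inter> {x. n F \<bullet> x = 0}" by metis
  have maxl: "\<exists>F\<in>FF. B \<subseteq> F" if "B \<in> ?L" "\<psi> B \<noteq> K" for B using that \<psi>V by (auto simp: face_poset_def)
  have "realizes FF v n"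
    unfolding realizes_def
  proof (intro conjI ballI allI impI)
    fix F i assume F: "F \<in> FF" and i: "i \<in> F"
    then have "v i \<in> \<psi> F" using mem[OF FL[OF F], of i] by auto
    then show "n F \<bullet> v i = 0" using n[OF F] by auto
  next
    fix F i assume F: "F \<in> FF" and i: "i \<in> \<Union>FF - F"
    then have "v i \<notin> \<psi> F" using mem[OF FL[OF F], of i] by auto
    then show "n F \<bullet> v i < 0" using n[OF F] vK[of i] i by (auto simp: less_le)
  next
    fix F assume F: "F \<in> FF"
    obtain H where H: "H facet_of K" "\<psi> F \<subseteq> H"
      using face_of_polyhedron_subset_facet[OF K(1) face[OF FL[OF F]] FK[OF F]] by blast
    obtain B where B: "B \<in> ?L" "H = \<psi> B"
      using surj[OF facet_of_imp_face_of[OF H(1)]] H(1) by (auto simp: facet_of_def)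
    have "H \<noteq> K" using H(1) by auto
    then obtain F' where F': "F' \<in> FF" "B \<subseteq> F'" using maxl[OF B(1)] B(2) by auto
    have "F \<subseteq> B" using mono[OF FL[OF F] B(1)] B(2) H(2) by auto
    then have "F = B" using facet_family_eq[OF FF F F'(1)] F'(2) by auto
    \<comment> \<open>A facet of the cone has dimension \<open>d\<close>, so its \<open>d\<close>
      generators are distinct and independent.\<close>
    then have "aff_dim (poscone v F) = int d" using H(1) B(2) gen[OF FL[OF F]] K(4) d(1) by (auto simp: facet_of_def)
    moreover have "aff_dim (poscone v F) = int (dim (poscone v F))"
      by (rule aff_dim_zero) (simp add: hull_inc poscone_zero)
    ultimately have "dim (poscone v F) = d" by simp
    moreover have "dim (poscone v F) \<le> dim (v ` F)" by (metis dim_span dim_subset poscone_subset_span)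
    ultimately have dd: "d \<le> dim (v ` F)" by simp
    have fin: "finite F" using D F by auto
    have c1: "card (v ` F) \<le> d" using card_image_le[OF fin, of v] D(4)[OF F] by simp
    have c2: "dim (v ` F) \<le> card (v ` F)" using fin by (simp add: dim_le_card')
    have ceq: "card (v ` F) = card F" using dd c1 c2 D(4)[OF F] by linarith
    show "inj_on v F" using ceq fin by (simp add: eq_card_imp_inj_on)
    show "independent (v ` F)" using dd c1 c2 fin by (intro card_le_dim_spanning[of _ "span (v ` F)"]) (auto simp: span_superset)
  next
    fix x assume x: "\<forall>F\<in>FF. n F \<bullet> x \<le> 0"
    have "x \<in> K"
    proof (rule ccontr)
      assume xK: "x \<notin> K"
      have "interior K \<noteq> {}" using K(4) aff_dim_eq_full_gen interior_rel_interior_gen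
        by (metis K(1,2) aff_dim_eq_full convex_cone_nonempty interior_rel_interior polyhedron_imp_convex rel_interior_eq_empty)
      then obtain y where y: "y \<in> interior K" by auto
      have clK: "closed K" using K(1) polyhedron_imp_closed by blast
      \<comment> \<open>The segment from an interior point \<open>y\<close> to \<open>x\<close>
        leaves \<open>K\<close> through some facet. Its normal vanishes there, although it is
        negative at \<open>y\<close> and nonpositive at \<open>x\<close>.\<close>
      have "closed_segment y x \<inter> frontier K \<noteq> {}"
        using connected_Int_frontier[of "closed_segment y x" K] y xK interior_subset by (metis Diff_iff Int_iff connected_segment(1) empty_iff ends_in_segment(1,2) subsetD)
      then obtain q where q: "q \<in> closed_segment y x" "q \<in> frontier K" by auto
      then obtain u where u: "0 \<le> u" "u \<le> 1" "q = (1 - u) *\<^sub>R y + u *\<^sub>R x" by (auto simp: in_segment)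
      have qK: "q \<in> K" "q \<notin> interior K" using q(2) clK by (auto simp: frontier_def)
      have ri: "rel_interior K = interior K" using K(4) by (metis aff_dim_eq_full rel_interior_interior)
      then have "q \<in> rel_frontier K" using qK clK by (simp add: rel_frontier_def)
      then obtain H where H: "H facet_of K" "q \<in> H" unfolding rel_frontier_of_polyhedron[OF K(1)] by auto
      obtain B where B: "B \<in> ?L" "H = \<psi> B"
        using surj[OF facet_of_imp_face_of[OF H(1)]] H(2) by auto
      have "H \<noteq> K" using H(1) by auto
      then obtain F where F: "F \<in> FF" "B \<subseteq> F" using maxl[OF B(1)] B(2) by auto
      have "q \<in> \<psi> F" using mono[OF B(1) FL[OF F(1)]] F(2) B(2) H(2) by auto
      then have nq: "n F \<bullet> q = 0" using n[OF F(1)] by auto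
      have "y \<in> K" using y interior_subset by auto
      have "y \<notin> \<psi> F" using face_of_disjoint_interior[OF face(1)[OF FL[OF F(1)]] FK[OF F(1)]] y by auto
      then have ny: "n F \<bullet> y < 0" using n[OF F(1)] \<open>y \<in> K\<close> by (auto simp: less_le)
      have "u \<noteq> 1" using u(3) qK xK by auto
      then have "(1 - u) * (n F \<bullet> y) < 0" using u ny by (simp add: mult_pos_neg)
      moreover have "u * (n F \<bullet> x) \<le> 0" using u x F(1) by (simp add: mult_nonneg_nonpos)
      ultimately show False using nq unfolding u(3) by (simp add: inner_add_right)
    qed
    then show "x \<in> poscone v (\<Union>FF)" using gen[OF VL] \<psi>V by auto
  qed
  then show ?thesis using gen[OF VL] \<psi>V by metis
qed

section \<open>Euclidean polytopes and the cones over them\<close>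

text \<open>Homogenization: \<open>P\<close> is placed at height 1, so that Euclidean and spherical
  polytopes are both handled as cones.\<close>

definition coneover :: "'a::euclidean_space set \<Rightarrow> (real \<times> 'a) set" where
  "coneover P = convex_cone hull ({1} \<times> P)"

lemma mem_coneover:
  assumes "convex P"
  shows "(t, y) \<in> coneover P \<longleftrightarrow> t = 0 \<and> y = 0 \<or> t > 0 \<and> (1 / t) *\<^sub>R y \<in> P"
proof -
  have cv: "convex hull ({1} \<times> P) = {1} \<times> P" using assms by (simp add: convex_hull_Times hull_same)
  have "(t, y) \<in> coneover P \<longleftrightarrow> t = 0 \<and> y = 0 \<or> (\<exists>x\<in>P. \<exists>c\<ge>0. (t, y) = (c, c *\<^sub>R x))"
    unfolding coneover_def convex_cone_hull_convex_hull cv by (auto simp: zero_prod_def)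
  also have "\<dots> \<longleftrightarrow> t = 0 \<and> y = 0 \<or> t > 0 \<and> (1 / t) *\<^sub>R y \<in> P"
  proof (intro iffI; elim disjE)
    assume "\<exists>x\<in>P. \<exists>c\<ge>0. (t, y) = (c, c *\<^sub>R x)"
    then obtain x where x: "x \<in> P" "t \<ge> 0" "y = t *\<^sub>R x" by auto
    then show "t = 0 \<and> y = 0 \<or> t > 0 \<and> (1 / t) *\<^sub>R y \<in> P" by (cases "t = 0") auto
  next
    assume a: "t > 0 \<and> (1 / t) *\<^sub>R y \<in> P"
    then have "(t, y) = (t, t *\<^sub>R ((1 / t) *\<^sub>R y))" by simp
    then show "t = 0 \<and> y = 0 \<or> (\<exists>x\<in>P. \<exists>c\<ge>0. (t, y) = (c, c *\<^sub>R x))" using a by (metis less_imp_le)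
  qed auto
  finally show ?thesis .
qed

lemma coneover_subset_iff:
  assumes "convex A" "convex B" shows "coneover A \<subseteq> coneover B \<longleftrightarrow> A \<subseteq> B"
proof
  assume s: "coneover A \<subseteq> coneover B"
  show "A \<subseteq> B"
  proof
    fix x assume "x \<in> A"
    then have "(1, x) \<in> coneover A" using mem_coneover[OF assms(1)] by simp
    then have "(1, x) \<in> coneover B" using s by blast
    then show "x \<in> B" using mem_coneover[OF assms(2)] by simp
  qed
next
  assume "A \<subseteq> B"
  then show "coneover A \<subseteq> coneover B" unfolding coneover_def by (intro hull_mono) auto
qed

lemma coneover_eq_iff: "convex A \<Longrightarrow> convex B \<Longrightarrow> coneover A = coneover B \<longleftrightarrow> A = B"
  using coneover_subset_iff[of A B] coneover_subset_iff[of B A] by auto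

lemma convex_cone_coneover: "convex_cone (coneover P)"
  unfolding coneover_def by (rule convex_cone_convex_cone_hull)

lemma pointed_coneover:
  assumes "convex P" "z \<in> coneover P" "- z \<in> coneover P" shows "z = 0"
proof -
  obtain t y where z: "z = (t, y)" by (cases z)
  then show ?thesis using assms mem_coneover[OF assms(1), of t y] mem_coneover[OF assms(1), of "- t" "- y"]
    by (auto simp: zero_prod_def)
qed

lemma polyhedron_coneover:
  assumes "polytope P" shows "polyhedron (coneover P)"
  unfolding coneover_def by (intro polyhedron_convex_cone_hull_polytope polytope_Times polytope_sing assms)

lemma aff_dim_coneover:
  fixes P :: "'a::euclidean_space set"
  assumes "aff_dim P = DIM('a)" "convex P"
  shows "aff_dim (coneover P) = DIM(real \<times> 'a)"
proof -
  have "affine hull ({1} \<times> P) \<subseteq> {z. (1::real, 0::'a) \<bullet> z = 1}"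
    by (rule hull_minimal) (auto simp: affine_hyperplane)
  then have z: "(0 :: real \<times> 'a) \<notin> affine hull ({1} \<times> P)" by auto
  have "({1} \<times> P :: (real \<times> 'a) set) = (+) (1, 0) ` (Pair 0 ` P)" by (auto simp: image_iff)
  then have "aff_dim ({1} \<times> P :: (real \<times> 'a) set) = aff_dim ((Pair 0 :: 'a \<Rightarrow> real \<times> 'a) ` P)"
    using aff_dim_translation_eq by metis
  also have "\<dots> = aff_dim P"
    by (rule aff_dim_injective_linear_image) (auto simp: inj_on_def linear_iff)
  finally have "aff_dim (insert 0 ({1} \<times> P :: (real \<times> 'a) set)) = DIM(real \<times> 'a)"
    using assms z by (simp add: aff_dim_insert)
  moreover have "insert 0 ({1} \<times> P) \<subseteq> coneover P" unfolding coneover_def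
    by (simp add: convex_cone_hull_contains_0 hull_subset)
  ultimately show ?thesis using aff_dim_subset aff_dim_le_DIM by (metis order_antisym)
qed

text \<open>A nonempty face of the cone is recovered from its slice at height 1; conversely an
  inequality \<open>a \<bullet> x \<le> b\<close> for \<open>P\<close> becomes the homogeneous
  inequality with normal \<open>(- b, a)\<close>.\<close>

lemma faces_coneover:
  assumes P: "polytope P"
  shows "{G. G face_of coneover P \<and> G \<noteq> {}} = coneover ` {F. F face_of P}"
proof (intro subset_antisym subsetI)
  have cP: "convex P" using P polytope_imp_convex by blast
  note memP = mem_coneover[OF cP]
  {
    fix H assume "H \<in> {G. G face_of coneover P \<and> G \<noteq> {}}"
    then have H: "H face_of coneover P" "H \<noteq> {}" by auto
    have ccH: "convex_cone H" by (rule convex_cone_face_of[OF convex_cone_coneover H])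
    have HP: "H \<subseteq> coneover P" using H face_of_imp_subset by blast
    define F where "F = {x. (1, x) \<in> H}"
    have Feq: "F = Pair 1 -` H" unfolding F_def by auto
    have cvH: "convex H" using H face_of_imp_convex by blast
    have pc: "(1, (1 - u) *\<^sub>R a + u *\<^sub>R b) = (1 - u) *\<^sub>R (1, a) + u *\<^sub>R (1, b)" for u :: real and a b :: 'a
      by simp
    have cF: "convex F"
      unfolding convex_alt F_def
    proof (intro ballI allI impI, unfold mem_Collect_eq)
      fix a b and u :: real assume "(1, a) \<in> H" "(1, b) \<in> H" "0 \<le> u \<and> u \<le> 1"
      then show "(1, (1 - u) *\<^sub>R a + u *\<^sub>R b) \<in> H"
        unfolding pc using cvH unfolding convex_alt by blast
    qed
    have "F face_of P"
      unfolding face_of_def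
    proof (intro conjI ballI impI)
      show "F \<subseteq> P" unfolding F_def using HP memP by auto
      show "convex F" by (rule cF)
      fix a b x assume a: "a \<in> P" and b: "b \<in> P" and x: "x \<in> F" "x \<in> open_segment a b"
      have ab: "(1, a) \<in> coneover P" "(1, b) \<in> coneover P" using memP a b by auto
      have "(1, x) \<in> open_segment (1, a) (1, b)"
        using x(2) pc by (auto simp: in_segment)
      then show "a \<in> F" "b \<in> F" using face_ofD[OF H(1) _ ab] x(1) unfolding F_def by auto
    qed
    moreover have "H = coneover F"
    proof
      show "coneover F \<subseteq> H" unfolding coneover_def by (rule hull_minimal) (use ccH in \<open>auto simp: F_def\<close>)
      show "H \<subseteq> coneover F"
      proof (rule subrelI)
        fix t y assume ty: "(t, y) \<in> H"
        then have "(t, y) \<in> coneover P" using HP by auto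
        then consider "t = 0 \<and> y = 0" | "t > 0" using memP by auto
        then show "(t, y) \<in> coneover F"
        proof cases
          case 2
          have "(1 / t) *\<^sub>R (t, y) \<in> H" using ccH ty 2 by (simp only: convex_cone_scaleR divide_nonneg_nonneg less_imp_le zero_le_one)
          then show ?thesis using 2 mem_coneover[OF cF] by (simp add: F_def)
        qed (simp add: mem_coneover[OF cF])
      qed
    qed
    ultimately show "H \<in> coneover ` {F. F face_of P}" by blast
  }
  {
    fix H assume "H \<in> coneover ` {F. F face_of P}"
    then obtain F where F: "F face_of P" "H = coneover F" by auto
    have cF: "convex F" using F face_of_imp_convex by blast
    have FP: "F \<subseteq> P" using F face_of_imp_subset by blast
    have "F exposed_face_of P" using F exposed_face_of_polyhedron polytope_imp_polyhedron[OF P] by blast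
    then consider "F = {}" | "F = P" | a b where "P \<subseteq> {x. a \<bullet> x \<le> b}" "F = P \<inter> {x. a \<bullet> x = b}"
      unfolding exposed_face_of by blast
    then have "H face_of coneover P"
    proof cases
      case 1
      then have "H = {0}" using F by (simp add: coneover_def)
      then show ?thesis using pointed_zero_face[OF convex_cone_coneover pointed_coneover[OF cP]] by metis
    next
      case 2
      then show ?thesis using F face_of_refl convex_cone_coneover unfolding convex_cone_def by blast
    next
      case 3
      have le: "(- b, a) \<bullet> z \<le> 0" if "z \<in> coneover P" for z
      proof -
        obtain t y where z: "z = (t, y)" by (cases z)
        have "t = 0 \<and> y = 0 \<or> t > 0 \<and> (1 / t) *\<^sub>R y \<in> P" using memP[of t y] that z by simp
        then consider "t = 0 \<and> y = 0" | "t > 0" "(1 / t) *\<^sub>R y \<in> P" by blast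
        then show ?thesis
        proof cases
          case 2
          then have "a \<bullet> ((1 / t) *\<^sub>R y) \<le> b" using 3 by blast
          then show ?thesis using 2 z by (simp add: field_simps)
        qed (simp add: z)
      qed
      have "H = coneover P \<inter> {z. (- b, a) \<bullet> z = 0}"
        unfolding F(2)
      proof (intro set_eqI)
        fix z :: "real \<times> 'a"
        obtain t y where z: "z = (t, y)" by (cases z)
        have "x \<in> F \<longleftrightarrow> x \<in> P \<and> a \<bullet> x = b" for x using 3(2) by auto
        then have "(t, y) \<in> coneover F \<longleftrightarrow> t = 0 \<and> y = 0 \<or> t > 0 \<and> (1 / t) *\<^sub>R y \<in> P \<and> a \<bullet> ((1 / t) *\<^sub>R y) = b"
          using mem_coneover[OF cF, of t y] by simp
        moreover have "t > 0 \<Longrightarrow> a \<bullet> ((1 / t) *\<^sub>R y) = b \<longleftrightarrow> (- b, a) \<bullet> (t, y) = 0" by (auto simp: field_simps)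
        moreover have "t = 0 \<and> y = 0 \<Longrightarrow> (- b, a) \<bullet> (t, y) = 0" by simp
        ultimately show "z \<in> coneover F \<longleftrightarrow> z \<in> coneover P \<inter> {z. (- b, a) \<bullet> z = 0}"
          unfolding z Int_iff mem_Collect_eq using memP[of t y] by blast
      qed
      then show ?thesis
        using face_of_Int_supporting_hyperplane_le[of "coneover P" "(- b, a)" 0] le convex_cone_coneover unfolding convex_cone_def by metis
    qed
    moreover have "H \<noteq> {}" using F(2) convex_cone_coneover convex_cone_nonempty by blast
    ultimately show "H \<in> {G. G face_of coneover P \<and> G \<noteq> {}}" by auto
  }
qed

lemma lattice_isomorphic_coneover:
  assumes P: "polytope P"
  shows "lattice_isomorphic (faces P) {G. G face_of coneover P \<and> G \<noteq> {}}"
  unfolding faces_coneover[OF P] faces_def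
  by (rule lattice_isomorphic_image) (auto intro!: coneover_subset_iff dest: face_of_imp_convex)

lemma poscone_Pair:
  assumes "finite A"
  shows "poscone (\<lambda>i. (1::real, v i)) A = coneover (convex hull (v ` A))"
proof -
  have "coneover (convex hull (v ` A)) = convex_cone hull (convex hull ({1::real} \<times> v ` A))"
    unfolding coneover_def by (simp add: convex_hull_Times)
  also have "\<dots> = convex_cone hull ({1} \<times> v ` A)"
    unfolding convex_cone_hull_convex_hull[of "convex hull ({1} \<times> v ` A)"] convex_cone_hull_convex_hull[of "{1} \<times> v ` A"]
    by (simp only: hull_hull)
  also have "{1} \<times> v ` A = (\<lambda>i. (1::real, v i)) ` A" by auto
  finally show ?thesis using poscone_eq_hull[OF assms, of "\<lambda>i. (1::real, v i)"] by simp
qed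

lemma poscone_scaled:
  assumes "\<And>i. i \<in> A \<Longrightarrow> s i > (0::real)" "\<And>i. i \<in> A \<Longrightarrow> w i = s i *\<^sub>R v i"
  shows "poscone w A = poscone v A"
proof (intro subset_antisym subsetI)
  fix x assume "x \<in> poscone w A"
  then obtain c where c: "\<And>i. i \<in> A \<Longrightarrow> c i \<ge> (0::real)" "x = (\<Sum>i\<in>A. c i *\<^sub>R w i)" by (rule posconeE) blast
  have "x = (\<Sum>i\<in>A. (c i * s i) *\<^sub>R v i)" unfolding c(2) using assms(2) by (intro sum.cong) auto
  moreover have "\<And>i. i \<in> A \<Longrightarrow> c i * s i \<ge> 0" using c(1) assms(1) by (simp add: less_imp_le)
  ultimately show "x \<in> poscone v A" using posconeI[of A "\<lambda>i. c i * s i" v] by metis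
next
  fix x assume "x \<in> poscone v A"
  then obtain c where c: "\<And>i. i \<in> A \<Longrightarrow> c i \<ge> (0::real)" "x = (\<Sum>i\<in>A. c i *\<^sub>R v i)" by (rule posconeE) blast
  have "x = (\<Sum>i\<in>A. (c i / s i) *\<^sub>R w i)" unfolding c(2)
  proof (intro sum.cong refl)
    fix i assume "i \<in> A"
    then show "c i *\<^sub>R v i = (c i / s i) *\<^sub>R w i" using assms(1)[of i] assms(2)[of i] by simp
  qed
  moreover have "\<And>i. i \<in> A \<Longrightarrow> c i / s i \<ge> 0" using c(1) assms(1) by (simp add: less_imp_le)
  ultimately show "x \<in> poscone w A" using posconeI[of A "\<lambda>i. c i / s i" w] by metis
qed

lemma independent_scaled:
  fixes v :: "'i \<Rightarrow> 'a::real_vector"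
  assumes "finite A" "\<And>i. i \<in> A \<Longrightarrow> s i \<noteq> (0::real)" "\<And>i. i \<in> A \<Longrightarrow> w i = s i *\<^sub>R v i"
    "inj_on v A" "independent (v ` A)"
  shows "inj_on w A \<and> independent (w ` A)"
proof -
  have inj: "i = j" if ij: "i \<in> A" "j \<in> A" "w i = w j" for i j
  proof (rule ccontr)
    assume ne: "i \<noteq> j"
    have "(\<Sum>k\<in>A. (if k = i then s i else 0) *\<^sub>R v k) = s i *\<^sub>R v i"
      using assms(1) ij by (subst sum.mono_neutral_right[of A "{i}"]) auto
    moreover have "(\<Sum>k\<in>A. (if k = j then s j else 0) *\<^sub>R v k) = s j *\<^sub>R v j"
      using assms(1) ij by (subst sum.mono_neutral_right[of A "{j}"]) auto
    ultimately have "(\<Sum>k\<in>A. (if k = i then s i else 0) *\<^sub>R v k) = (\<Sum>k\<in>A. (if k = j then s j else 0) *\<^sub>R v k)"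
      using ij assms(3) by metis
    from independent_sum_eqD[OF assms(4,5,1) this ij(1)] show False using ne assms(2)[OF ij(1)] by simp
  qed
  then have injw: "inj_on w A" by (auto simp: inj_on_def)
  moreover have "independent (w ` A)"
  proof (rule independent_if_scalars_zero)
    show "finite (w ` A)" using assms(1) by simp
    fix f y assume f: "(\<Sum>x\<in>w ` A. f x *\<^sub>R x) = 0" and y: "y \<in> w ` A"
    obtain i where i: "i \<in> A" "y = w i" using y by auto
    have "(\<Sum>k\<in>A. (f (w k) * s k) *\<^sub>R v k) = (\<Sum>k\<in>A. f (w k) *\<^sub>R w k)" using assms(3) by (intro sum.cong) auto
    also have "\<dots> = (\<Sum>k\<in>A. 0 *\<^sub>R v k)" using f injw by (simp add: sum.reindex)
    finally have "(\<Sum>k\<in>A. (f (w k) * s k) *\<^sub>R v k) = (\<Sum>k\<in>A. 0 *\<^sub>R v k)" .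
    from independent_sum_eqD[OF assms(4,5,1) this i(1)] show "f y = 0" using assms(2)[OF i(1)] i(2) by simp
  qed
  ultimately show ?thesis by simp
qed

lemma realizes_scaled:
  fixes v :: "'i \<Rightarrow> 'a::euclidean_space"
  assumes FF: "facet_family d FF" and R: "realizes FF v n"
    and s: "\<And>i. i \<in> \<Union>FF \<Longrightarrow> s i > (0::real)" "\<And>i. i \<in> \<Union>FF \<Longrightarrow> w i = s i *\<^sub>R v i"
  shows "realizes FF w n"
  unfolding realizes_def
proof (intro conjI ballI allI impI)
  note RD = realizesD[OF R]
  fix F assume F: "F \<in> FF"
  show "n F \<bullet> w i = 0" if "i \<in> F" for i using RD(1)[OF F that] s(2)[of i] that F by (metis UnionI inner_scaleR_right mult_zero_right)
  show "n F \<bullet> w i < 0" if "i \<in> \<Union>FF - F" for i using RD(2)[OF F, of i] s[of i] that by (auto simp: mult_pos_neg)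
  have "inj_on w F \<and> independent (w ` F)"
    by (rule independent_scaled[of F s]) (use facet_familyD(3)[OF FF F] s F RD(3,4)[OF F] in \<open>force+\<close>)
  then show "inj_on w F" "independent (w ` F)" by auto
next
  fix x assume "\<forall>F\<in>FF. n F \<bullet> x \<le> 0"
  then have "x \<in> poscone v (\<Union>FF)" using realizesD(5)[OF R] by auto
  then show "x \<in> poscone w (\<Union>FF)" using poscone_scaled[of "\<Union>FF" s w v] s by metis
qed

text \<open>The rays of the cone over \<open>P\<close> have positive height and can be rescaled to
  height 1, where they generate \<open>P\<close>.\<close>

lemma polytope_from_lattice:
  fixes P :: "'a::euclidean_space set"
  assumes FF: "facet_family d FF" and d: "d = DIM('a)" and P: "polytope P" "aff_dim P = DIM('a)"
    and iso: "lattice_isomorphic (face_poset FF) (faces P)"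
  shows "\<exists>v n. realizes FF (\<lambda>i. (1::real, v i)) n \<and> P = convex hull (v ` \<Union>FF)"
proof -
  have cP: "convex P" using P polytope_imp_convex by blast
  have "\<exists>v n. realizes FF v n \<and> coneover P = poscone v (\<Union>FF)"
  proof (rule realizes_from_lattice[OF FF])
    show "d + 1 = DIM(real \<times> 'a)" "d \<ge> 1" using d by (auto simp: DIM_positive Suc_le_eq)
    show "polyhedron (coneover P)" using polyhedron_coneover P by blast
    show "lattice_isomorphic (face_poset FF) {G. G face_of coneover P \<and> G \<noteq> {}}"
      using lattice_isomorphic_trans[OF iso lattice_isomorphic_coneover[OF P(1)]] .
  qed (use convex_cone_coneover pointed_coneover[OF cP] aff_dim_coneover[OF P(2) cP] in auto)
  then obtain v n where v: "realizes FF v n" "coneover P = poscone v (\<Union>FF)" by auto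
  have pos: "fst (v i) > 0" if i: "i \<in> \<Union>FF" for i
  proof -
    have "v i \<in> coneover P" using v(2) poscone_member[OF i facet_familyD(6)[OF FF]] by auto
    then have "v i = 0 \<or> fst (v i) > 0" using mem_coneover[OF cP, of "fst (v i)" "snd (v i)"] by (auto simp: prod_eq_iff)
    moreover obtain H where "H \<in> FF" "i \<notin> H" using facet_family_missed[OF FF i] by auto
    then have "v i \<noteq> 0" using realizesD(2)[OF v(1) _ i] by force
    ultimately show ?thesis by auto
  qed
  define w where "w i = (1 / fst (v i)) *\<^sub>R snd (v i)" for i
  have w: "(1, w i) = (1 / fst (v i)) *\<^sub>R v i" if "i \<in> \<Union>FF" for i
    using pos[OF that] by (simp add: w_def prod_eq_iff)
  have "realizes FF (\<lambda>i. (1, w i)) n"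
    by (rule realizes_scaled[OF FF v(1), of "\<lambda>i. 1 / fst (v i)"]) (use w pos in auto)
  moreover have "P = convex hull (w ` \<Union>FF)"
  proof -
    have "coneover (convex hull (w ` \<Union>FF)) = poscone (\<lambda>i. (1, w i)) (\<Union>FF)"
      using poscone_Pair[OF facet_familyD(6)[OF FF]] by metis
    also have "\<dots> = poscone v (\<Union>FF)"
      by (rule poscone_scaled[of _ "\<lambda>i. 1 / fst (v i)"]) (use w pos in auto)
    finally show ?thesis using v(2) coneover_eq_iff[OF cP convex_convex_hull] by metis
  qed
  ultimately show ?thesis by blast
qed

text \<open>The link is the set \<open>{1} \<times> P\<close>: \<open>spherical_faces\<close> looks
  only at the cone that a set generates, and here this is the cone over \<open>P\<close>.\<close>

lemma polytope_to_lattice: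
  fixes v :: "'i \<Rightarrow> 'a::euclidean_space"
  assumes FF: "facet_family d FF" and R: "realizes FF (\<lambda>i. (1::real, v i)) n"
  shows "lattice_isomorphic (face_poset FF) (faces (convex hull (v ` \<Union>FF)))"
proof -
  let ?P = "convex hull (v ` \<Union>FF)"
  note fin = facet_familyD(6)[OF FF]
  have P: "polytope ?P" using fin by (simp add: polytope_convex_hull)
  have Q: "convex_cone hull ({1::real} \<times> ?P) = poscone (\<lambda>i. (1::real, v i)) (\<Union>FF)"
    using poscone_Pair[OF fin] unfolding coneover_def by metis
  have 1: "lattice_isomorphic (face_poset FF) (spherical_faces ({1::real} \<times> ?P))"
    by (rule lattice_isomorphic_spherical_faces[OF FF R Q])
  have 2: "lattice_isomorphic {G. G face_of coneover ?P \<and> G \<noteq> {}} (spherical_faces ({1::real} \<times> ?P))"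
    using nonempty_faces_isomorphic[of "{1::real} \<times> ?P"] pointed_coneover[of ?P] unfolding coneover_def by auto
  show ?thesis
    by (rule lattice_isomorphic_trans[OF lattice_isomorphic_trans[OF 1 lattice_isomorphic_sym[OF 2]]
          lattice_isomorphic_sym[OF lattice_isomorphic_coneover[OF P]]])
qed

section \<open>Stacking of Euclidean polytopes in terms of labels\<close>

lemma affine_independent_Pair:
  fixes v :: "'i \<Rightarrow> 'a::euclidean_space"
  assumes "finite A" "inj_on (\<lambda>i. (1::real, v i)) A" "independent ((\<lambda>i. (1::real, v i)) ` A)"
  shows "inj_on v A" "\<not> affine_dependent (v ` A)"
proof -
  show inj: "inj_on v A" using assms(2) by (auto simp: inj_on_def)
  show "\<not> affine_dependent (v ` A)"
  proof
    assume "affine_dependent (v ` A)"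
    then obtain U i where U: "sum U (v ` A) = 0" "i \<in> A" "U (v i) \<noteq> 0" "(\<Sum>w\<in>v ` A. U w *\<^sub>R w) = 0"
      using affine_dependent_explicit_finite[of "v ` A"] assms(1) by auto
    have "(\<Sum>i\<in>A. U (v i) *\<^sub>R (1::real, v i)) = (\<Sum>i\<in>A. 0 *\<^sub>R (1::real, v i))"
      using U(1,4) inj by (simp add: sum.reindex prod_eq_iff fst_sum snd_sum)
    from independent_sum_eqD[OF assms(2,3,1) this U(2)] show False using U(3) by simp
  qed
qed

context
  fixes d :: nat and FF :: "'i set set" and v :: "'i \<Rightarrow> 'a::euclidean_space" and n P
  assumes FF: "facet_family d FF" and d: "d = DIM('a)" "d \<ge> 2"
    and R: "realizes FF (\<lambda>i. (1::real, v i)) n" and P: "P = convex hull (v ` \<Union>FF)"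
begin

lemma mem_polytope_iff: "x \<in> P \<longleftrightarrow> (\<forall>F\<in>FF. n F \<bullet> (1, x) \<le> 0)"
proof -
  have "x \<in> P \<longleftrightarrow> (1, x) \<in> coneover P" unfolding P by (simp add: mem_coneover)
  also have "\<dots> \<longleftrightarrow> (1, x) \<in> poscone (\<lambda>i. (1::real, v i)) (\<Union>FF)"
    using poscone_Pair[OF facet_familyD(6)[OF FF]] P by metis
  also have "\<dots> \<longleftrightarrow> (\<forall>F\<in>FF. n F \<bullet> (1, x) \<le> 0)" using realizesD(5)[OF R] realizes_le[OF R] by metis
  finally show ?thesis .
qed

lemma facet_simplex:
  assumes F: "F \<in> FF"
  shows "inj_on v F" "\<not> affine_dependent (v ` F)" "card (v ` F) = d" "(int d - 1) simplex (convex hull (v ` F))"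
    "aff_dim (convex hull (v ` F)) = int d - 1"
proof -
  show 1: "inj_on v F" "\<not> affine_dependent (v ` F)"
    using affine_independent_Pair[OF facet_familyD(3)[OF FF F] realizesD(3,4)[OF R F]] by auto
  then show 2: "card (v ` F) = d" using facet_familyD(4)[OF FF F] by (simp add: card_image)
  show 3: "(int d - 1) simplex (convex hull (v ` F))"
    by (rule simplex_convex_hull) (use 1 2 in auto)
  then show "aff_dim (convex hull (v ` F)) = int d - 1" using aff_dim_simplex by blast
qed

lemma face_convex_hull:
  assumes A: "A \<in> face_poset FF"
  shows "convex hull (v ` A) face_of P"
proof -
  have polP: "polytope P" unfolding P using facet_familyD(6)[OF FF] by (simp add: polytope_convex_hull)
  have finA: "finite A" using A facet_familyD(3,6)[OF FF] by (auto simp: face_poset_def intro: finite_subset)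
  have "poscone (\<lambda>i. (1::real, v i)) A face_of coneover P"
    using poscone_face_of[OF R facet_familyD(6)[OF FF] A] poscone_Pair[OF facet_familyD(6)[OF FF], of v] P by simp
  moreover have "poscone (\<lambda>i. (1::real, v i)) A \<noteq> {}" using poscone_zero by blast
  ultimately have "coneover (convex hull (v ` A)) \<in> coneover ` {F. F face_of P}"
    using faces_coneover[OF polP] poscone_Pair[OF finA, of v] by auto
  then obtain H where H: "H face_of P" "coneover (convex hull (v ` A)) = coneover H" by auto
  then have "convex hull (v ` A) = H" using coneover_eq_iff[OF convex_convex_hull, of H] face_of_imp_convex by blast
  then show ?thesis using H by auto
qed

lemma face_obtain:
  assumes H: "H face_of P"
  shows "\<exists>A\<in>face_poset FF. H = convex hull (v ` A)"
proof -
  have polP: "polytope P" unfolding P using facet_familyD(6)[OF FF] by (simp add: polytope_convex_hull)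
  have "coneover H \<in> {G. G face_of coneover P \<and> G \<noteq> {}}" using faces_coneover[OF polP] H by blast
  then have "coneover H face_of poscone (\<lambda>i. (1::real, v i)) (\<Union>FF)" "coneover H \<noteq> {}"
    using poscone_Pair[OF facet_familyD(6)[OF FF], of v] P by auto
  then obtain A where A: "A \<in> face_poset FF" "coneover H = poscone (\<lambda>i. (1::real, v i)) A"
    using face_of_poscone[OF FF R] by blast
  have finA: "finite A" using A facet_familyD(3,6)[OF FF] by (auto simp: face_poset_def intro: finite_subset)
  have "coneover H = coneover (convex hull (v ` A))" using A(2) poscone_Pair[OF finA, of v] by simp
  then have "H = convex hull (v ` A)" using coneover_eq_iff[of H "convex hull (v ` A)"] H face_of_imp_convex by auto
  then show ?thesis using A by auto
qed

text \<open>A proper face has its labels in some \<open>F\<close> with \<open>d\<close> elements,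
  and dimension \<open>d - 1\<close> requires at least \<open>d\<close> labels.\<close>

lemma facet_obtain:
  assumes H: "H facet_of P" "aff_dim P = int d"
  shows "\<exists>F\<in>FF. H = convex hull (v ` F)"
proof -
  have Hd: "H face_of P" "aff_dim H = int d - 1" using H by (auto simp: facet_of_def)
  obtain A where A: "A \<in> face_poset FF" "H = convex hull (v ` A)" using face_obtain Hd by auto
  have "A \<noteq> \<Union>FF" using A(2) Hd(2) H(2) P by auto
  then obtain F where F: "F \<in> FF" "A \<subseteq> F" using A by (auto simp: face_poset_def)
  have finF: "finite F" "card F = d" using facet_familyD(3,4)[OF FF F(1)] by auto
  then have finA: "finite A" using F finite_subset by blast
  have "aff_dim H \<le> int (card (v ` A)) - 1" unfolding A(2) aff_dim_convex_hull using finA by (intro aff_dim_le_card) auto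
  then have "d \<le> card A" using Hd(2) card_image_le[OF finA, of v] by linarith
  then have "A = F" using finF F(2) by (metis card_seteq)
  then show ?thesis using A F by auto
qed

lemma facet_of_polytope:
  assumes F: "F \<in> FF" and dimP: "aff_dim P = int d"
  shows "convex hull (v ` F) facet_of P"
proof -
  have "F \<in> face_poset FF" using F by (auto simp: face_poset_def)
  moreover have "card (v ` F) \<noteq> 0" using facet_simplex(3)[OF F] d by simp
  then have "v ` F \<noteq> {}" by (metis card.empty)
  ultimately show ?thesis using face_convex_hull facet_simplex(5)[OF F] dimP unfolding facet_of_def by simp
qed

lemma barycenter_facet:
  assumes F: "F \<in> FF"
  shows "barycenter (convex hull (v ` F)) = (1 / real d) *\<^sub>R (\<Sum>i\<in>F. v i)"
proof -
  have "{x. x extreme_point_of (convex hull (v ` F))} = v ` F"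
    using extreme_point_of_convex_hull_affine_independent[OF facet_simplex(2)[OF F]] by auto
  then show ?thesis unfolding barycenter_def Let_def using facet_simplex(1,3)[OF F] by (simp add: sum.reindex)
qed

lemma barycenter_facet_inner:
  assumes F: "F \<in> FF"
  shows "n G \<bullet> (1, barycenter (convex hull (v ` F))) = (1 / real d) * (\<Sum>i\<in>F. n G \<bullet> (1, v i))"
proof -
  have cF: "card F = d" using facet_familyD(4)[OF FF F] .
  have "(1 / real d) *\<^sub>R (\<Sum>i\<in>F. (1::real, v i)) = (1, barycenter (convex hull (v ` F)))"
    unfolding barycenter_facet[OF F] using d cF by (simp add: prod_eq_iff fst_sum snd_sum)
  then have "n G \<bullet> (1, barycenter (convex hull (v ` F))) = n G \<bullet> ((1 / real d) *\<^sub>R (\<Sum>i\<in>F. (1::real, v i)))" by simp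
  then show ?thesis by (simp only: inner_scaleR_right inner_sum_right)
qed

text \<open>The barycenter satisfies all inequalities except that of \<open>F\<close> strictly, and
  this persists nearby; a nearby point outside \<open>P\<close> can then violate only the inequality
  of \<open>F\<close>.\<close>

lemma eventually_beyond:
  assumes F: "F \<in> FF"
  shows "\<forall>\<^sub>F p in at (barycenter (convex hull (v ` F))) within - P.
    n F \<bullet> (1, p) > 0 \<and> (\<forall>G\<in>FF. G \<noteq> F \<longrightarrow> n G \<bullet> (1, p) < 0)"
proof -
  let ?b = "barycenter (convex hull (v ` F))"
  note RD = realizesD[OF R]
  have "\<forall>\<^sub>F p in at ?b within - P. \<forall>G\<in>FF - {F}. n G \<bullet> (1, p) < 0"
  proof (rule eventually_ball_finite)
    show "finite (FF - {F})" using facet_familyD(1)[OF FF] by auto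
    show "\<forall>G\<in>FF - {F}. \<forall>\<^sub>F p in at ?b within - P. n G \<bullet> (1, p) < 0"
    proof
      fix G assume G: "G \<in> FF - {F}"
      have "\<not> F \<subseteq> G" using facet_family_eq[OF FF F, of G] G by auto
      then obtain j where j: "j \<in> F" "j \<notin> G" by auto
      have le: "n G \<bullet> (1, v i) \<le> 0" if "i \<in> F" for i
        using RD(1,2)[of G i] G that F by (cases "i \<in> G") (auto intro: less_imp_le)
      have "(\<Sum>i\<in>F. n G \<bullet> (1, v i)) < (\<Sum>i\<in>F. 0)"
        by (rule sum_strict_mono_ex1) (use le j RD(2)[of G j] G F facet_familyD(3)[OF FF F] in auto)
      then have neg: "n G \<bullet> (1, ?b) < 0" unfolding barycenter_facet_inner[OF F] using d by (simp add: divide_neg_pos)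
      have "((\<lambda>p. n G \<bullet> (1, p)) \<longlongrightarrow> n G \<bullet> (1, ?b)) (at ?b within - P)"
        by (intro tendsto_intros)
      then show "\<forall>\<^sub>F p in at ?b within - P. n G \<bullet> (1, p) < 0" using neg order_tendstoD(2) by blast
    qed
  qed
  moreover have "\<forall>\<^sub>F p in at ?b within - P. p \<in> - P" unfolding eventually_at_filter by simp
  ultimately show ?thesis
  proof eventually_elim
    case (elim p)
    have "n F \<bullet> (1, p) > 0"
    proof (rule ccontr)
      assume "\<not> n F \<bullet> (1, p) > 0"
      then have "p \<in> P" using elim(1) unfolding mem_polytope_iff by (metis DiffI less_imp_le not_less singletonD)
      then show False using elim(2) by auto
    qed
    then show ?case using elim(1) by auto
  qed
qed

lemma stacked_point_lattice:
  assumes F: "F \<in> FF" and q: "q \<notin> \<Union>FF" and p: "n F \<bullet> (1, p) > 0" "\<forall>G\<in>FF. G \<noteq> F \<longrightarrow> n G \<bullet> (1, p) < 0"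
  shows "lattice_isomorphic (face_poset (stack_family FF F q)) (faces (convex hull (insert p P)))"
proof -
  have "d + 1 = DIM(real \<times> 'a)" using d(1) by simp
  then have "\<exists>n'. realizes (stack_family FF F q) ((\<lambda>i. (1::real, v i))(q := (1, p))) n'"
    using p(2) by (intro realizes_stack_exists[OF FF R _ d(2) F q p(1)]) auto
  then obtain n' where n': "realizes (stack_family FF F q) ((\<lambda>i. (1::real, v i))(q := (1, p))) n'" by blast
  have "(\<lambda>i. (1::real, v i))(q := (1, p)) = (\<lambda>i. (1, (v(q := p)) i))" by auto
  then have R': "realizes (stack_family FF F q) (\<lambda>i. (1::real, (v(q := p)) i)) n'" using n' by simp
  have FF': "facet_family d (stack_family FF F q)" using facet_family_stack[OF FF F q] d by simp
  have "(v(q := p)) ` \<Union>(stack_family FF F q) = insert p (v ` \<Union>FF)"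
    unfolding Union_stack_family[OF FF F d(2)] using q by auto
  moreover have "convex hull (insert p P) = convex hull (insert p (v ` \<Union>FF))" unfolding P
    by (metis hull_hull hull_insert)
  ultimately show ?thesis using polytope_to_lattice[OF FF' R'] by simp
qed

text \<open>Guarantees that the eventuality in \<open>stacking\<close> is not vacuous, so that an
  actual point \<open>p\<close> can be extracted from it.\<close>

lemma barycenter_filter_nontrivial:
  assumes F: "F \<in> FF" and dimP: "aff_dim P = int d"
  shows "at (barycenter (convex hull (v ` F))) within - P \<noteq> bot"
proof -
  let ?b = "barycenter (convex hull (v ` F))"
  have Fac: "convex hull (v ` F) facet_of P" by (rule facet_of_polytope[OF F dimP])
  have "?b \<in> convex hull (v ` F)"
  proof -
    have "(\<Sum>i\<in>F. (1 / real d) *\<^sub>R v i) \<in> convex hull (v ` F)"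
      by (rule convex_sum) (use facet_familyD(3,4)[OF FF F] d in \<open>auto intro: hull_inc\<close>)
    then show ?thesis unfolding barycenter_facet[OF F] by (simp add: scaleR_sum_right)
  qed
  moreover have "convex hull (v ` F) \<noteq> P" using Fac by auto
  ultimately have b: "?b \<in> P" "?b \<notin> interior P"
    using face_of_disjoint_interior[OF facet_of_imp_face_of[OF Fac]] facet_of_imp_subset[OF Fac] by auto
  have "?b islimpt - P" unfolding islimpt_approachable
  proof (intro allI impI)
    fix e :: real assume "e > 0"
    then have "\<not> ball ?b e \<subseteq> P" using b(2) by (auto simp: mem_interior)
    then obtain y where "y \<notin> P" "dist y ?b < e" by (metis dist_commute mem_ball subsetI)
    then show "\<exists>x'\<in>- P. x' \<noteq> ?b \<and> dist x' ?b < e" using b(1) by (intro bexI[of _ y]) auto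
  qed
  then show ?thesis by (simp add: trivial_limit_within)
qed

end

text \<open>\<open>Q\<close> is known only up to isomorphism, so one suitable point \<open>p\<close>
  of the filter is fixed and the lattice of the hull of \<open>P\<close> and \<open>p\<close> is
  computed instead.\<close>

lemma stacking_lattice:
  fixes P Q :: "(real ^ 'n::finite) set"
  assumes FF: "facet_family CARD('n) FF" and d: "CARD('n) \<ge> 2" and iso: "lattice_isomorphic (face_poset FF) (faces P)"
    and st: "stacking P H Q"
  shows "\<exists>F\<in>FF. \<forall>q. q \<notin> \<Union>FF \<longrightarrow> lattice_isomorphic (face_poset (stack_family FF F q)) (faces Q)"
proof -
  have P: "polytope P" "aff_dim P = int CARD('n)" and H: "H facet_of P"
    and ev: "\<forall>\<^sub>F p in at (barycenter H) within - P. lattice_isomorphic (faces Q) (faces (convex hull (insert p P)))"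
    using st unfolding stacking_def d_polytope_def by auto
  obtain v n where R: "realizes FF (\<lambda>i. (1::real, v i)) n" and Pv: "P = convex hull (v ` \<Union>FF)"
    using polytope_from_lattice[OF FF _ P(1) _ iso] P(2) by auto
  have dd: "CARD('n) = DIM(real ^ 'n)" by simp
  note ctx = FF dd d R Pv
  obtain F where F: "F \<in> FF" "H = convex hull (v ` F)" using facet_obtain[OF ctx H P(2)] by auto
  have "\<forall>\<^sub>F p in at (barycenter H) within - P. lattice_isomorphic (faces Q) (faces (convex hull (insert p P))) \<and>
     n F \<bullet> (1, p) > 0 \<and> (\<forall>G\<in>FF. G \<noteq> F \<longrightarrow> n G \<bullet> (1, p) < 0)"
    using ev eventually_beyond[OF ctx F(1)] unfolding F(2) by eventually_elim auto
  moreover have "at (barycenter H) within - P \<noteq> bot"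
    using barycenter_filter_nontrivial[OF ctx F(1) P(2)] F(2) by simp
  ultimately obtain p where p: "lattice_isomorphic (faces Q) (faces (convex hull (insert p P)))"
     "n F \<bullet> (1, p) > 0" "\<forall>G\<in>FF. G \<noteq> F \<longrightarrow> n G \<bullet> (1, p) < 0"
    using eventually_happens' by blast
  show ?thesis
    using stacked_point_lattice[OF ctx F(1) _ p(2,3)] p(1) F(1) lattice_isomorphic_sym lattice_isomorphic_trans by blast
qed

text \<open>All admissible points near the barycenter give the same lattice, so the hull with any
  single one of them is a stacking.\<close>

lemma stacking_exists:
  fixes P :: "(real ^ 'n::finite) set"
  assumes FF: "facet_family CARD('n) FF" and d: "CARD('n) \<ge> 2" and iso: "lattice_isomorphic (face_poset FF) (faces P)"
    and P: "d_polytope P" and F: "F \<in> FF" and q: "q \<notin> \<Union>FF"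
  shows "\<exists>H Q. stacking P H Q \<and> lattice_isomorphic (face_poset (stack_family FF F q)) (faces Q)"
proof -
  have P': "polytope P" "aff_dim P = int CARD('n)" using P unfolding d_polytope_def by auto
  obtain v n where R: "realizes FF (\<lambda>i. (1::real, v i)) n" and Pv: "P = convex hull (v ` \<Union>FF)"
    using polytope_from_lattice[OF FF _ P'(1) _ iso] P'(2) by auto
  have dd: "CARD('n) = DIM(real ^ 'n)" by simp
  note ctx = FF dd d R Pv
  define H where "H = convex hull (v ` F)"
  have ev: "\<forall>\<^sub>F p in at (barycenter H) within - P. lattice_isomorphic (face_poset (stack_family FF F q)) (faces (convex hull (insert p P)))"
    using eventually_beyond[OF ctx F] unfolding H_def
    by eventually_elim (rule stacked_point_lattice[OF ctx F q], auto)
  moreover have "at (barycenter H) within - P \<noteq> bot"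
    using barycenter_filter_nontrivial[OF ctx F P'(2)] H_def by simp
  ultimately obtain p where p: "lattice_isomorphic (face_poset (stack_family FF F q)) (faces (convex hull (insert p P)))"
    using eventually_happens' by blast
  let ?Q = "convex hull (insert p P)"
  have "polytope ?Q" unfolding Pv using facet_familyD(6)[OF FF] by (metis finite_imageI finite_insert hull_hull hull_insert polytope_convex_hull)
  moreover have "P \<subseteq> ?Q" by (meson hull_subset insert_subset order_trans subset_insertI)
  then have "aff_dim P \<le> aff_dim ?Q" by (rule aff_dim_subset)
  then have "aff_dim ?Q = int CARD('n)" using P'(2) aff_dim_le_DIM[of ?Q] by simp
  ultimately have "d_polytope ?Q" unfolding d_polytope_def by simp
  moreover have "\<forall>\<^sub>F p' in at (barycenter H) within - P. lattice_isomorphic (faces ?Q) (faces (convex hull (insert p' P)))"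
    using ev by eventually_elim (use p lattice_isomorphic_sym lattice_isomorphic_trans in blast)
  ultimately have "stacking P H ?Q"
    unfolding stacking_def using P facet_of_polytope[OF ctx F P'(2)] facet_simplex(4)[OF ctx F] H_def by auto
  then show ?thesis using p by blast
qed

lemma simplex_lattice:
  fixes P :: "(real ^ 'n::finite) set"
  assumes "int CARD('n) simplex P"
  shows "lattice_isomorphic (face_poset {F. F \<subseteq> {0..CARD('n)} \<and> card F = CARD('n)}) (faces P)"
proof -
  let ?d = "CARD('n)"
  from Polytope.simplex[of "int ?d" P] assms
  have "\<exists>C. finite C \<and> \<not> affine_dependent C \<and> int (card C) = int ?d + 1 \<and> P = convex hull C" by (rule iffD1)
  then obtain C where C: "\<not> affine_dependent C" "int (card C) = int ?d + 1" "P = convex hull C" "finite C"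
    by (elim exE conjE)
  have cardC: "card C = ?d + 1" using C(2) by linarith
  have "card {0..?d} = card C" using cardC by simp
  then obtain h where h: "bij_betw h {0..?d} C"
    using finite_same_card_bij[OF finite_atLeastAtMost C(4)] by blast
  have Un: "\<Union>{F. F \<subseteq> {0..?d} \<and> card F = ?d} = {0..?d}"
  proof (intro subset_antisym subsetI)
    fix i assume i: "i \<in> {0..?d}"
    obtain j where j: "j \<in> {0..?d}" "j \<noteq> i" by (cases "i = 0") (auto intro: that[of 0] that[of ?d] simp: zero_less_card_finite)
    have "i \<in> {0..?d} - {j}" "card ({0..?d} - {j}) = ?d" using i j by auto
    then show "i \<in> \<Union>{F. F \<subseteq> {0..?d} \<and> card F = ?d}" by blast
  qed auto
  have fl: "face_poset {F. F \<subseteq> {0..?d} \<and> card F = ?d} = Pow {0..?d}"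
  proof (intro subset_antisym subsetI)
    fix A assume A: "A \<in> Pow {0..?d}"
    show "A \<in> face_poset {F. F \<subseteq> {0..?d} \<and> card F = ?d}"
    proof (cases "A = {0..?d}")
      case False
      then obtain j where j: "j \<in> {0..?d}" "j \<notin> A" using A by blast
      then have "A \<subseteq> {0..?d} - {j}" "card ({0..?d} - {j}) = ?d" using A by auto
      then show ?thesis unfolding face_poset_def by blast
    qed (auto simp: face_poset_def Un)
  qed (auto simp: face_poset_def Un)
  have sub: "S \<subseteq> T" if "S \<subseteq> C" "T \<subseteq> C" "convex hull S \<subseteq> convex hull T" for S T
  proof
    fix x assume x: "x \<in> S"
    show "x \<in> T"
    proof (rule ccontr)
      assume "x \<notin> T"
      then have "T \<subseteq> C - {x}" using that by auto
      then have "convex hull T \<subseteq> affine hull (C - {x})"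
        using convex_hull_subset_affine_hull[of T] hull_mono[of T "C - {x}" affine] by blast
      moreover have "x \<in> convex hull T" using hull_inc[OF x] that(3) by (rule subsetD[rotated])
      ultimately show False using C(1) x that(1) unfolding affine_dependent_def by blast
    qed
  qed
  have "faces P = (\<lambda>A. convex hull (h ` A)) ` Pow {0..?d}"
  proof (intro subset_antisym subsetI)
    fix X assume "X \<in> faces P"
    then obtain c where c: "c \<subseteq> C" "X = convex hull c"
      unfolding faces_def C(3) using face_of_convex_hull_affine_independent[OF C(1)] by auto
    then obtain A where "A \<subseteq> {0..?d}" "c = h ` A" using h by (metis bij_betw_def subset_imageE)
    then show "X \<in> (\<lambda>A. convex hull (h ` A)) ` Pow {0..?d}" using c by auto
  next
    fix X assume "X \<in> (\<lambda>A. convex hull (h ` A)) ` Pow {0..?d}"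
    then obtain A where "A \<subseteq> {0..?d}" "X = convex hull (h ` A)" by auto
    moreover from this have "h ` A \<subseteq> C" using h by (auto simp: bij_betw_def)
    ultimately show "X \<in> faces P" unfolding faces_def C(3) mem_Collect_eq
      face_of_convex_hull_affine_independent[OF C(1)] by blast
  qed
  moreover have "lattice_isomorphic (Pow {0..?d}) ((\<lambda>A. convex hull (h ` A)) ` Pow {0..?d})"
  proof (rule lattice_isomorphic_image)
    fix A B assume AB: "A \<in> Pow {0..?d}" "B \<in> Pow {0..?d}"
    have "h ` A \<subseteq> C" "h ` B \<subseteq> C" using AB h by (auto simp: bij_betw_def)
    then have "convex hull (h ` A) \<subseteq> convex hull (h ` B) \<longleftrightarrow> h ` A \<subseteq> h ` B" using sub hull_mono by metis
    also have "\<dots> \<longleftrightarrow> A \<subseteq> B" using AB h by (intro inj_on_image_subset_iff) (auto simp: bij_betw_def)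
    finally show "(convex hull h ` A \<subseteq> convex hull h ` B) = (A \<subseteq> B)" .
  qed
  ultimately show ?thesis unfolding fl by simp
qed

lemma stacked_lattice:
  fixes P :: "(real ^ 'n::finite) set"
  assumes "stacked P" "CARD('n) \<ge> 2"
  shows "\<exists>FF. stacked_family CARD('n) FF \<and> lattice_isomorphic (face_poset FF) (faces P)"
  using assms
proof (induction rule: stacked.induct)
  case (simplex P)
  then show ?case using simplex_lattice stacked_family.base by blast
next
  case (stack P H Q)
  then obtain FF where FF: "stacked_family CARD('n) FF" "lattice_isomorphic (face_poset FF) (faces P)" by auto
  have ff: "facet_family CARD('n) FF" using stacked_family_facet_family[OF FF(1)] by (simp add: Suc_le_eq)
  obtain F where F: "F \<in> FF" "\<forall>q. q \<notin> \<Union>FF \<longrightarrow> lattice_isomorphic (face_poset (stack_family FF F q)) (faces Q)"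
    using stacking_lattice[OF ff stack.prems FF(2) stack.hyps(2)] by auto
  obtain q where "q \<notin> \<Union>FF" using facet_familyD(6)[OF ff] ex_new_if_finite infinite_UNIV_nat by blast
  then show ?case using F stacked_family.step[OF FF(1) F(1)] by blast
qed

lemma stacked_exists:
  assumes "stacked_family d FF" "d = CARD('n::finite)" "d \<ge> 2"
  shows "\<exists>P :: (real ^ 'n) set. stacked P \<and> d_polytope P \<and> lattice_isomorphic (face_poset FF) (faces P)"
  using assms
proof (induction rule: stacked_family.induct)
  case base
  let ?C = "insert 0 Basis :: (real ^ 'n) set"
  have "\<not> affine_dependent ?C"
    using affine_dependent_iff_dependent[of "0 :: real ^ 'n" Basis] independent_Basis by simp
  moreover have "card ?C = CARD('n) + 1" by simp
  ultimately have s: "int CARD('n) simplex (convex hull ?C)" by (intro simplex_convex_hull) simp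
  then show ?case using stacked.simplex simplex_lattice[OF s] aff_dim_simplex[OF s] simplex_imp_polytope[OF s] base(1)
    unfolding d_polytope_def by blast
next
  case (step FF F p)
  then obtain P :: "(real ^ 'n) set" where P: "stacked P" "d_polytope P" "lattice_isomorphic (face_poset FF) (faces P)" by auto
  have ff: "facet_family CARD('n) FF" using stacked_family_facet_family[OF step.hyps(1)] step.prems by simp
  obtain H Q where Q: "stacking P H Q" "lattice_isomorphic (face_poset (stack_family FF F p)) (faces Q)"
    using stacking_exists[OF ff _ P(3,2) step.hyps(2,3)] step.prems by auto
  then show ?case using stacked.stack[OF P(1) Q(1)] unfolding stacking_def by blast
qed

section \<open>Four null vectors\<close>

text \<open>Polar coordinates of the complex number with real part \<open>x - cos \<alpha>\<close>
  and imaginary part \<open>sin \<alpha>\<close>; equivalently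
  \<open>x = sin (\<alpha> + \<theta>) / sin \<theta>\<close>.\<close>

lemma angle_exists:
  assumes "sin \<alpha> > 0"
  obtains r \<theta> where "r > (0::real)" "0 < \<theta>" "\<theta> < pi" "r * cos \<theta> = x - cos \<alpha>" "r * sin \<theta> = sin \<alpha>"
proof -
  define z where "z = Complex (x - cos \<alpha>) (sin \<alpha>)"
  have "Im z > 0" using assms by (simp add: z_def)
  then have "0 < Arg z" "Arg z < pi" "z \<noteq> 0" using Arg_lt_pi by auto
  moreover have "z = of_real (norm z) * cis (Arg z)" using \<open>z \<noteq> 0\<close> by (simp add: cis_conv_exp Arg_eq[symmetric] mult.commute)
  then have "norm z * cos (Arg z) = x - cos \<alpha>" "norm z * sin (Arg z) = sin \<alpha>"
    by (metis z_def Re_complex_of_real Im_complex_of_real complex.sel cis.sel mult_zero_left diff_zero add_0_right times_complex.sel)+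
  ultimately show thesis using that[of "norm z" "Arg z"] by auto
qed

lemma sin_pos_lt_pi:
  assumes "0 < t" "t < 2 * pi" "sin t > 0" shows "t < pi"
proof (rule ccontr)
  assume "\<not> t < pi"
  then have "sin (t - pi) \<ge> 0" using assms by (intro sin_ge_zero) auto
  then show False using assms(3) by simp
qed

text \<open>Law of sines for the triangle with sides \<open>A\<close>, \<open>B\<close>,
  \<open>C\<close>: \<open>h\<close> is Heron's product, 16 times the squared area, \<open>k\<close>
  is the reciprocal of the circumdiameter, and \<open>ca\<close>, \<open>cb\<close> are the cosines
  from the law of cosines.\<close>

lemma triangle_angles:
  fixes A B C :: real
  assumes pos: "A > 0" "B > 0" "C > 0" and tri: "A < B + C" "B < A + C" "C < A + B"
  obtains k \<alpha> \<beta> \<gamma> where "k > 0" "0 < \<alpha>" "0 < \<beta>" "0 < \<gamma>" "\<alpha> + \<beta> + \<gamma> = pi"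
    "sin \<alpha> = k * A" "sin \<beta> = k * B" "sin \<gamma> = k * C"
proof -
  define h where "h = (A + B + C) * (B + C - A) * (A + C - B) * (A + B - C)"
  have h: "h > 0" unfolding h_def using assms by (intro mult_pos_pos) auto
  define k where "k = sqrt h / (2 * A * B * C)"
  have k: "k > 0" unfolding k_def using h pos by simp
  have k2: "k\<^sup>2 * (4 * A\<^sup>2 * B\<^sup>2 * C\<^sup>2) = h" unfolding k_def using h pos by (simp add: power_divide power_mult_distrib)
  define ca where "ca = (B\<^sup>2 + C\<^sup>2 - A\<^sup>2) / (2 * B * C)"
  define cb where "cb = (A\<^sup>2 + C\<^sup>2 - B\<^sup>2) / (2 * A * C)"
  have ca2: "(2 * B * C) * ca = B\<^sup>2 + C\<^sup>2 - A\<^sup>2" unfolding ca_def using pos by simp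
  have cb2: "(2 * A * C) * cb = A\<^sup>2 + C\<^sup>2 - B\<^sup>2" unfolding cb_def using pos by simp
  have "(4 * B\<^sup>2 * C\<^sup>2) * (ca\<^sup>2 + (k * A)\<^sup>2) = ((2 * B * C) * ca)\<^sup>2 + k\<^sup>2 * (4 * A\<^sup>2 * B\<^sup>2 * C\<^sup>2)"
    by (simp add: algebra_simps power2_eq_square)
  also have "\<dots> = 4 * B\<^sup>2 * C\<^sup>2" unfolding ca2 k2 h_def by (simp add: algebra_simps power2_eq_square)
  finally have sa: "ca\<^sup>2 + (k * A)\<^sup>2 = 1" using pos by simp
  have "(4 * A\<^sup>2 * C\<^sup>2) * (cb\<^sup>2 + (k * B)\<^sup>2) = ((2 * A * C) * cb)\<^sup>2 + k\<^sup>2 * (4 * A\<^sup>2 * B\<^sup>2 * C\<^sup>2)"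
    by (simp add: algebra_simps power2_eq_square)
  also have "\<dots> = 4 * A\<^sup>2 * C\<^sup>2" unfolding cb2 k2 h_def by (simp add: algebra_simps power2_eq_square)
  finally have sb: "cb\<^sup>2 + (k * B)\<^sup>2 = 1" using pos by simp
  have kA: "k * A > 0" and kB: "k * B > 0" using k pos by auto
  have "\<exists>t. 0 < t \<and> t < pi \<and> cos t = c \<and> sin t = s" if "c\<^sup>2 + s\<^sup>2 = 1" "s > 0" for c s :: real
  proof -
    have "c\<^sup>2 < 1" using that by (smt (verit) zero_less_power2)
    then have "\<bar>c\<bar> < 1" by (simp add: abs_square_less_1)
    then have c: "-1 < c" "c < 1" by auto
    have "sin (arccos c) = sqrt (1 - c\<^sup>2)" using c by (simp add: sin_arccos)
    also have "1 - c\<^sup>2 = s\<^sup>2" using that by simp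
    finally have "sin (arccos c) = s" using that by simp
    moreover have "0 < arccos c" "arccos c < pi" using arccos_lt_bounded c by auto
    ultimately show ?thesis using c cos_arccos[of c] by (intro exI[of _ "arccos c"]) auto
  qed
  then obtain \<alpha> \<beta> where a: "0 < \<alpha>" "\<alpha> < pi" "cos \<alpha> = ca" "sin \<alpha> = k * A"
    and b: "0 < \<beta>" "\<beta> < pi" "cos \<beta> = cb" "sin \<beta> = k * B"
    using sa sb kA kB by metis
  have "(2 * C) * (A * cb + B * ca) = (2 * A * C) * cb + (2 * B * C) * ca" by (simp add: algebra_simps)
  also have "\<dots> = (2 * C) * C" unfolding ca2 cb2 by (simp add: power2_eq_square)
  finally have "A * cb + B * ca = C" using pos by simp
  moreover have "sin (\<alpha> + \<beta>) = k * (A * cb + B * ca)" unfolding sin_add a b by (simp add: algebra_simps)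
  ultimately have sg: "sin (\<alpha> + \<beta>) = k * C" by simp
  have "\<alpha> + \<beta> < pi" using sin_pos_lt_pi[of "\<alpha> + \<beta>"] a b sg k pos by simp
  moreover have "sin (pi - \<alpha> - \<beta>) = k * C" using sg sin_pi_minus[of "\<alpha> + \<beta>"] by (simp add: algebra_simps)
  ultimately show thesis using that[of k \<alpha> \<beta> "pi - \<alpha> - \<beta>"] k a b by auto
qed

text \<open>If \<open>A\<close>, \<open>B\<close>, \<open>C\<close> are proportional to the sines of angles \<open>\<alpha>\<close>, \<open>\<beta>\<close>, \<open>\<gamma>\<close> of sum \<open>pi\<close>, and
  \<open>x = sin (\<alpha> + \<theta>1) / sin \<theta>1\<close>, and \<open>y\<close>, \<open>z\<close> likewise, then the equation says that
  \<open>\<theta>1 + \<theta>2 + \<theta>3 = pi\<close>, and \<open>x * x' > 1\<close> says that \<open>\<theta>1 + \<alpha> + \<theta>1' < pi\<close>.\<close>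

lemma four_triples:
  fixes A B C :: real and x y z :: "nat \<Rightarrow> real"
  assumes pos: "A > 0" "B > 0" "C > 0" and tri: "A < B + C" "B < A + C" "C < A + B"
    and xyz: "\<And>i. x i > 0 \<and> y i > 0 \<and> z i > 0"
    and eq: "\<And>i. A * x i + B * y i + C * z i = A * (y i * z i) + B * (x i * z i) + C * (x i * y i)"
    and pairs: "x 1 * x 2 > 1" "x 3 * x 4 > 1" "y 1 * y 3 > 1" "y 2 * y 4 > 1" "z 1 * z 4 > 1" "z 2 * z 3 > 1"
  shows False
proof -
  obtain k \<alpha> \<beta> \<gamma> where ang: "k > 0" "0 < \<alpha>" "0 < \<beta>" "0 < \<gamma>" "\<alpha> + \<beta> + \<gamma> = pi"
    "sin \<alpha> = k * A" "sin \<beta> = k * B" "sin \<gamma> = k * C" using triangle_angles[OF pos tri] by blast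
  have "\<exists>R. \<forall>t. fst (R t) > (0::real) \<and> 0 < snd (R t) \<and> snd (R t) < pi \<and> fst (R t) * cos (snd (R t)) = t - cos \<delta> \<and> fst (R t) * sin (snd (R t)) = sin \<delta>"
    if "sin \<delta> > 0" for \<delta>
  proof -
    have "\<forall>t. \<exists>p. fst p > (0::real) \<and> 0 < snd p \<and> snd p < pi \<and> fst p * cos (snd p) = t - cos \<delta> \<and> fst p * sin (snd p) = sin \<delta>"
      using angle_exists[OF that] by (metis fst_conv snd_conv)
    then show ?thesis by metis
  qed
  then have ex: "\<exists>r \<theta>. \<forall>t. r t > (0::real) \<and> 0 < \<theta> t \<and> \<theta> t < pi \<and> r t * cos (\<theta> t) = t - cos \<delta> \<and> r t * sin (\<theta> t) = sin \<delta>"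
    if "sin \<delta> > 0" for \<delta>
    using that by meson
  have sp: "sin \<alpha> > 0" "sin \<beta> > 0" "sin \<gamma> > 0" using ang pos by auto
  obtain r1 \<theta>1 where
    1: "\<And>t. r1 t > (0::real) \<and> 0 < \<theta>1 t \<and> \<theta>1 t < pi \<and> r1 t * cos (\<theta>1 t) = t - cos \<alpha> \<and> r1 t * sin (\<theta>1 t) = sin \<alpha>"
    using ex[OF sp(1)] by blast
  obtain r2 \<theta>2 where
    2: "\<And>t. r2 t > (0::real) \<and> 0 < \<theta>2 t \<and> \<theta>2 t < pi \<and> r2 t * cos (\<theta>2 t) = t - cos \<beta> \<and> r2 t * sin (\<theta>2 t) = sin \<beta>"
    using ex[OF sp(2)] by blast
  obtain r3 \<theta>3 where
    3: "\<And>t. r3 t > (0::real) \<and> 0 < \<theta>3 t \<and> \<theta>3 t < pi \<and> r3 t * cos (\<theta>3 t) = t - cos \<gamma> \<and> r3 t * sin (\<theta>3 t) = sin \<gamma>"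
    using ex[OF sp(3)] by blast
  \<comment> \<open>Since \<open>r * sin (\<theta> + \<delta>) = t * sin \<delta>\<close>,
    positivity of \<open>t\<close> keeps \<open>\<theta> + \<delta>\<close> below
    \<open>pi\<close>.\<close>
  have lt: "\<theta> < pi - \<delta>" if "r > 0" "0 < \<theta>" "\<theta> < pi" "r * cos \<theta> = t - cos \<delta>" "r * sin \<theta> = sin \<delta>" "t > 0" "0 < \<delta>" "\<delta> < pi"
    for r \<theta> t \<delta> :: real
  proof -
    have "r * sin (\<theta> + \<delta>) = (r * sin \<theta>) * cos \<delta> + (r * cos \<theta>) * sin \<delta>" by (simp add: sin_add algebra_simps)
    also have "\<dots> = t * sin \<delta>" unfolding that(4,5) by (simp add: algebra_simps)
    finally have "r * sin (\<theta> + \<delta>) > 0" using that sin_gt_zero by simp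
    then have "sin (\<theta> + \<delta>) > 0" using that(1) by (simp add: zero_less_mult_iff)
    then show ?thesis using sin_pos_lt_pi[of "\<theta> + \<delta>"] that by simp
  qed
  \<comment> \<open>The same with two angles: \<open>r * r' * sin (\<theta> + \<theta>' + \<delta>)
    = (t * t' - 1) * sin \<delta>\<close>.\<close>
  have pair: "\<theta> + \<theta>' < pi - \<delta>" if "r > 0" "0 < \<theta>" "\<theta> < pi - \<delta>" "r * cos \<theta> = t - cos \<delta>" "r * sin \<theta> = sin \<delta>"
     "r' > 0" "0 < \<theta>'" "\<theta>' < pi - \<delta>" "r' * cos \<theta>' = t' - cos \<delta>" "r' * sin \<theta>' = sin \<delta>" "t * t' > 1" "0 < \<delta>" "\<delta> < pi"
    for r \<theta> t \<delta> r' \<theta>' t' :: real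
  proof -
    have "(r * r') * sin (\<theta> + \<theta>' + \<delta>) = ((r * sin \<theta>) * (r' * cos \<theta>') + (r * cos \<theta>) * (r' * sin \<theta>')) * cos \<delta>
      + ((r * cos \<theta>) * (r' * cos \<theta>') - (r * sin \<theta>) * (r' * sin \<theta>')) * sin \<delta>"
      by (simp add: sin_add cos_add algebra_simps)
    also have "\<dots> = (t * t' - ((sin \<delta>)\<^sup>2 + (cos \<delta>)\<^sup>2)) * sin \<delta>"
    proof -
      have "(s * (t' - c) + (t - c) * s) * c + ((t - c) * (t' - c) - s * s) * s = (t * t' - (s\<^sup>2 + c\<^sup>2)) * s" for s c :: real
        by (simp add: algebra_simps power2_eq_square)
      then show ?thesis unfolding that(4,5,9,10) .
    qed
    also have "\<dots> = (t * t' - 1) * sin \<delta>" by simp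
    finally have "(r * r') * sin (\<theta> + \<theta>' + \<delta>) > 0" using that sin_gt_zero by simp
    then have "sin (\<theta> + \<theta>' + \<delta>) > 0" using mult_pos_pos[OF that(1,6)] by (rule zero_less_mult_pos)
    then show ?thesis using sin_pos_lt_pi[of "\<theta> + \<theta>' + \<delta>"] that by simp
  qed
  have apos: "0 < \<alpha>" "\<alpha> < pi" "0 < \<beta>" "\<beta> < pi" "0 < \<gamma>" "\<gamma> < pi" using ang by auto
  have l1: "\<theta>1 (x i) < pi - \<alpha>" and l2: "\<theta>2 (y i) < pi - \<beta>" and l3: "\<theta>3 (z i) < pi - \<gamma>" for i
    using lt[of "r1 (x i)" "\<theta>1 (x i)" "x i" \<alpha>] 1[of "x i"] lt[of "r2 (y i)" "\<theta>2 (y i)" "y i" \<beta>] 2[of "y i"]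
      lt[of "r3 (z i)" "\<theta>3 (z i)" "z i" \<gamma>] 3[of "z i"] xyz[of i] apos by auto
  \<comment> \<open>By \<open>eq\<close> the sine of the sum is zero, and the bounds
    \<open>pi - \<alpha>\<close>, \<open>pi - \<beta>\<close>, \<open>pi - \<gamma>\<close> on the
    three angles place the sum strictly between 0 and \<open>2 * pi\<close>.\<close>
  have sum: "\<theta>1 (x i) + \<theta>2 (y i) + \<theta>3 (z i) = pi" for i
  proof -
    define S where "S = \<theta>1 (x i) + \<theta>2 (y i) + \<theta>3 (z i)"
    have cg: "cos \<gamma> = sin \<alpha> * sin \<beta> - cos \<alpha> * cos \<beta>" and sg: "sin \<gamma> = sin \<alpha> * cos \<beta> + cos \<alpha> * sin \<beta>"
    proof -
      have g: "\<gamma> = pi - (\<alpha> + \<beta>)" using ang by simp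
      show "cos \<gamma> = sin \<alpha> * sin \<beta> - cos \<alpha> * cos \<beta>" unfolding g cos_pi_minus cos_add by simp
      show "sin \<gamma> = sin \<alpha> * cos \<beta> + cos \<alpha> * sin \<beta>" unfolding g sin_pi_minus sin_add by simp
    qed
    have id: "sa * (Y - cb) * (Z - cg) + (X - ca) * sb * (Z - cg) + (X - ca) * (Y - cb) * sg - sa * sb * sg
        = X * Y * sg + X * Z * sb + Y * Z * sa - X * sa - Y * sb - Z * sg"
      if "sa * sa + ca * ca = 1" "sb * sb + cb * cb = 1" "cg = sa * sb - ca * cb" "sg = sa * cb + ca * sb"
      for sa ca sb cb sg cg X Y Z :: real
    proof -
      have "sg * sg + cg * cg = (sa * sa + ca * ca) * (sb * sb + cb * cb)" unfolding that(3,4) by (simp add: algebra_simps)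
      then have g1: "sg * sg + cg * cg = 1" using that by simp
      show ?thesis using that by algebra
    qed
    have "r1 (x i) * r2 (y i) * r3 (z i) * sin S =
      (r1 (x i) * sin (\<theta>1 (x i))) * (r2 (y i) * cos (\<theta>2 (y i))) * (r3 (z i) * cos (\<theta>3 (z i)))
     + (r1 (x i) * cos (\<theta>1 (x i))) * (r2 (y i) * sin (\<theta>2 (y i))) * (r3 (z i) * cos (\<theta>3 (z i)))
     + (r1 (x i) * cos (\<theta>1 (x i))) * (r2 (y i) * cos (\<theta>2 (y i))) * (r3 (z i) * sin (\<theta>3 (z i)))
     - (r1 (x i) * sin (\<theta>1 (x i))) * (r2 (y i) * sin (\<theta>2 (y i))) * (r3 (z i) * sin (\<theta>3 (z i)))"
      unfolding S_def sin_add cos_add by (simp add: algebra_simps)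
    also have "\<dots> = sin \<alpha> * (y i - cos \<beta>) * (z i - cos \<gamma>) + (x i - cos \<alpha>) * sin \<beta> * (z i - cos \<gamma>)
       + (x i - cos \<alpha>) * (y i - cos \<beta>) * sin \<gamma> - sin \<alpha> * sin \<beta> * sin \<gamma>"
      using 1[of "x i"] 2[of "y i"] 3[of "z i"] by simp
    also have "\<dots> = x i * y i * sin \<gamma> + x i * z i * sin \<beta> + y i * z i * sin \<alpha> - x i * sin \<alpha> - y i * sin \<beta> - z i * sin \<gamma>"
      by (rule id) (use cg sg in \<open>auto simp flip: power2_eq_square\<close>)
    also have "\<dots> = k * ((A * (y i * z i) + B * (x i * z i) + C * (x i * y i)) - (A * x i + B * y i + C * z i))"
      unfolding ang by (simp add: algebra_simps)
    also have "\<dots> = 0" using eq[of i] by simp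
    finally have "sin S = 0" using 1[of "x i"] 2[of "y i"] 3[of "z i"] by (smt (verit) mult_eq_0_iff)
    moreover have "0 < S" "S < 2 * pi" using 1[of "x i"] 2[of "y i"] 3[of "z i"] l1[of i] l2[of i] l3[of i] ang(5) unfolding S_def by auto
    ultimately have "S = pi"
      using sin_gt_zero[of S] sin_gt_zero[of "S - pi"] by (smt (verit) sin_periodic_pi sin_minus minus_minus sin_minus_pi)
    then show ?thesis unfolding S_def .
  qed
  have "\<theta>1 (x 1) + \<theta>1 (x 2) < pi - \<alpha>" "\<theta>1 (x 3) + \<theta>1 (x 4) < pi - \<alpha>"
    by (rule pair[OF _ _ l1 _ _ _ _ l1 _ _ pairs(1) apos(1,2)] pair[OF _ _ l1 _ _ _ _ l1 _ _ pairs(2) apos(1,2)]; use 1 in blast)+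
  moreover have "\<theta>2 (y 1) + \<theta>2 (y 3) < pi - \<beta>" "\<theta>2 (y 2) + \<theta>2 (y 4) < pi - \<beta>"
    by (rule pair[OF _ _ l2 _ _ _ _ l2 _ _ pairs(3) apos(3,4)] pair[OF _ _ l2 _ _ _ _ l2 _ _ pairs(4) apos(3,4)]; use 2 in blast)+
  moreover have "\<theta>3 (z 1) + \<theta>3 (z 4) < pi - \<gamma>" "\<theta>3 (z 2) + \<theta>3 (z 3) < pi - \<gamma>"
    by (rule pair[OF _ _ l3 _ _ _ _ l3 _ _ pairs(5) apos(5,6)] pair[OF _ _ l3 _ _ _ _ l3 _ _ pairs(6) apos(5,6)]; use 3 in blast)+
  \<comment> \<open>The four triples sum to \<open>4 * pi\<close>, whereas the six pairs sum to less
    than \<open>2 * (3 * pi - (\<alpha> + \<beta> + \<gamma>)) = 4 * pi\<close>.\<close>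
  ultimately show False using sum[of 1] sum[of 2] sum[of 3] sum[of 4] ang(5) by linarith
qed

section \<open>The Lorentz form and causal vectors\<close>

definition lor :: "real \<times> 'b::euclidean_space \<Rightarrow> real \<times> 'b \<Rightarrow> real" where
  "lor x y = snd x \<bullet> snd y - fst x * fst y"

lemma lor_simps:
  "lor (x + y) z = lor x z + lor y z" "lor z (x + y) = lor z x + lor z y"
  "lor (x - y) z = lor x z - lor y z" "lor z (x - y) = lor z x - lor z y"
  "lor (c *\<^sub>R x) z = c * lor x z" "lor z (c *\<^sub>R x) = c * lor z x"
  "lor (- x) z = - lor x z" "lor z (- x) = - lor z x" "lor 0 z = 0" "lor z 0 = 0"
  by (simp_all add: lor_def algebra_simps inner_simps)

lemma lor_sum: "lor (sum f A) z = (\<Sum>a\<in>A. lor (f a) z)" "lor z (sum f A) = (\<Sum>a\<in>A. lor z (f a))"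
  by (induction A rule: infinite_finite_induct) (auto simp: lor_simps)

lemma lor_commute: "lor x y = lor y x"
  by (simp add: lor_def inner_commute mult.commute)

lemma causal_norm: "lor x x \<le> 0 \<Longrightarrow> fst x \<ge> 0 \<Longrightarrow> norm (snd x) \<le> fst x"
  by (rule power2_le_imp_le) (simp_all add: lor_def power2_norm_eq_inner power2_eq_square[of "fst x"])

lemma lor_causal_le:
  assumes "lor x x \<le> 0" "fst x \<ge> 0" "lor y y \<le> 0" "fst y \<ge> 0" shows "lor x y \<le> 0"
proof -
  have "snd x \<bullet> snd y \<le> norm (snd x) * norm (snd y)" by (rule norm_cauchy_schwarz)
  also have "\<dots> \<le> fst x * fst y" using assms causal_norm[of x] causal_norm[of y] by (intro mult_mono) auto
  finally show ?thesis by (simp add: lor_def)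
qed

lemma null_norm: "lor x x = 0 \<Longrightarrow> fst x \<ge> 0 \<Longrightarrow> norm (snd x) = fst x"
  by (rule power2_eq_imp_eq) (simp_all add: lor_def power2_norm_eq_inner power2_eq_square[of "fst x"])

text \<open>The equality case of Cauchy-Schwarz for the space parts.\<close>

lemma lor_null_parallel:
  assumes "lor x x = 0" "fst x \<ge> 0" "lor y y = 0" "fst y \<ge> 0" "lor x y = 0"
  shows "fst x *\<^sub>R y = fst y *\<^sub>R x"
proof -
  have n: "norm (snd x) = fst x" "norm (snd y) = fst y" using null_norm[of x] null_norm[of y] assms by auto
  then have "snd x \<bullet> snd y = norm (snd x) * norm (snd y)" using assms(5) by (simp add: lor_def)
  then have "norm (snd x) *\<^sub>R snd y = norm (snd y) *\<^sub>R snd x" by (simp add: norm_cauchy_schwarz_eq)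
  then show ?thesis by (simp add: n prod_eq_iff)
qed

text \<open>Orthogonality means \<open>fst s * fst u = snd s \<bullet> snd u\<close>. As the time
  part of \<open>s\<close> dominates its space part, Cauchy-Schwarz forces the space part of
  \<open>u\<close> to dominate.\<close>

lemma lor_orthogonal_timelike:
  assumes "lor s s < 0" "lor s u = 0" "u \<noteq> 0" shows "lor u u > 0"
proof (cases "fst u = 0")
  case True
  then have "snd u \<noteq> 0" using assms(3) by (simp add: prod_eq_iff)
  then show ?thesis using True by (simp add: lor_def)
next
  case False
  have sl: "norm (snd s) < \<bar>fst s\<bar>"
  proof (rule power2_less_imp_less)
    have "snd s \<bullet> snd s < fst s * fst s" using assms(1) unfolding lor_def by linarith
    then show "(norm (snd s))\<^sup>2 < \<bar>fst s\<bar>\<^sup>2" unfolding power2_norm_eq_inner power2_abs power2_eq_square[of "fst s"] .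
  qed simp
  have "\<bar>fst s\<bar> * \<bar>fst u\<bar> = \<bar>snd s \<bullet> snd u\<bar>" using assms(2) by (simp add: lor_def abs_mult)
  also have "\<dots> \<le> norm (snd s) * norm (snd u)" by (rule Cauchy_Schwarz_ineq2)
  finally have le: "\<bar>fst s\<bar> * \<bar>fst u\<bar> \<le> norm (snd s) * norm (snd u)" .
  have "fst s \<noteq> 0" using sl by (metis abs_zero norm_ge_zero not_less)
  then have "\<bar>fst s\<bar> * \<bar>fst u\<bar> > 0" using False by simp
  then have "norm (snd s) * norm (snd u) > 0" using le by linarith
  then have "norm (snd u) > 0" by (simp add: zero_less_mult_iff)
  then have "norm (snd s) * norm (snd u) < \<bar>fst s\<bar> * norm (snd u)" using sl by simp
  then have "\<bar>fst s\<bar> * \<bar>fst u\<bar> < \<bar>fst s\<bar> * norm (snd u)" using le by linarith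
  then have "\<bar>fst u\<bar> < norm (snd u)" using \<open>fst s \<noteq> 0\<close> by simp
  then have "\<bar>fst u\<bar>\<^sup>2 < (norm (snd u))\<^sup>2" by (intro power_strict_mono) auto
  then show ?thesis by (simp add: lor_def power2_norm_eq_inner power2_eq_square[of "fst u"])
qed

lemma lor_timelike_add:
  assumes "lor q q < 0" "fst q \<ge> 0" "lor r r \<le> 0" "fst r \<ge> 0" shows "lor (q + r) (q + r) < 0"
  using lor_causal_le[of q r] assms by (simp add: lor_simps lor_commute[of r q])

text \<open>If \<open>m - x\<close> were timelike and future-directed, adding the causal vector
  \<open>r\<close> would leave it timelike; if past-directed, its negative plus \<open>m\<close>,
  which is \<open>x\<close>, would be timelike.\<close>

lemma lor_not_timelike:
  assumes x: "lor x x = 0" and m: "lor m m \<le> 0" "fst m \<ge> 0" and r: "lor r r \<le> 0" "fst r \<ge> 0"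
    and y: "lor (m - x + r) (m - x + r) = 0"
  shows "lor (m - x) (m - x) \<ge> 0"
proof (rule ccontr)
  assume "\<not> ?thesis"
  then have q: "lor (m - x) (m - x) < 0" by simp
  show False
  proof (cases "fst (m - x) \<ge> 0")
    case True
    then show ?thesis using lor_timelike_add[OF q _ r] y by simp
  next
    case False
    have "lor (- (m - x)) (- (m - x)) < 0" using q by (simp add: lor_simps)
    then have "lor (- (m - x) + m) (- (m - x) + m) < 0" using lor_timelike_add[of "- (m - x)" m] m False by simp
    then show ?thesis using x by simp
  qed
qed

text \<open>The null vectors \<open>x1\<close>, \<open>x2\<close>, \<open>x3\<close>, \<open>x4\<close> span an ideal tetrahedron; \<open>- x1 + a12 *\<^sub>R x2 + \<dots>\<close> is the apex
  of a tetrahedron attached to the facet opposite to \<open>x1\<close>. The condition \<open>a12 * a21 > 1\<close> says that the three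
  tetrahedra around an edge have dihedral angles of sum less than \<open>pi\<close>, while the sum over all six edges
  has to be at least \<open>6 * pi\<close>.\<close>

lemma four_null_vectors:
  fixes x1 x2 x3 x4 r1 r2 r3 r4 :: "real \<times> 'b::euclidean_space"
  assumes nx: "lor x1 x1 = 0" "lor x2 x2 = 0" "lor x3 x3 = 0" "lor x4 x4 = 0"
    and fx: "fst x1 > 0" "fst x2 > 0" "fst x3 > 0" "fst x4 > 0"
    and nr: "lor r1 r1 \<le> 0" "lor r2 r2 \<le> 0" "lor r3 r3 \<le> 0" "lor r4 r4 \<le> 0"
    and fr: "fst r1 \<ge> 0" "fst r2 \<ge> 0" "fst r3 \<ge> 0" "fst r4 \<ge> 0"
    and indep: "\<And>c1 c2 c3 c4. c1 *\<^sub>R x1 + c2 *\<^sub>R x2 + c3 *\<^sub>R x3 + c4 *\<^sub>R x4 = 0 \<Longrightarrow> c1 = 0 \<and> c2 = 0 \<and> c3 = 0 \<and> c4 = 0"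
    and a: "a12 > 0" "a13 > 0" "a14 > 0" "a21 > 0" "a23 > 0" "a24 > 0" "a31 > 0" "a32 > 0" "a34 > 0" "a41 > 0" "a42 > 0" "a43 > 0"
    and pr: "a12 * a21 > 1" "a13 * a31 > 1" "a14 * a41 > 1" "a23 * a32 > 1" "a24 * a42 > 1" "a34 * a43 > 1"
    and y: "\<And>y. y = a12 *\<^sub>R x2 + a13 *\<^sub>R x3 + a14 *\<^sub>R x4 - x1 + r1 \<Longrightarrow> lor y y = 0"
      "\<And>y. y = a21 *\<^sub>R x1 + a23 *\<^sub>R x3 + a24 *\<^sub>R x4 - x2 + r2 \<Longrightarrow> lor y y = 0"
      "\<And>y. y = a31 *\<^sub>R x1 + a32 *\<^sub>R x2 + a34 *\<^sub>R x4 - x3 + r3 \<Longrightarrow> lor y y = 0"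
      "\<And>y. y = a41 *\<^sub>R x1 + a42 *\<^sub>R x2 + a43 *\<^sub>R x3 - x4 + r4 \<Longrightarrow> lor y y = 0"
  shows False
proof -
  have wpos: "lor u v < 0"
    if "lor u u = 0" "lor v v = 0" "fst u > 0" "fst v > 0" "fst v *\<^sub>R u \<noteq> fst u *\<^sub>R v" for u v :: "real \<times> 'b"
    using lor_causal_le[of u v] lor_null_parallel[of u v] that by fastforce
  define w12 w13 w14 w23 w24 w34 where w_defs: "w12 = - lor x1 x2" "w13 = - lor x1 x3" "w14 = - lor x1 x4"
    "w23 = - lor x2 x3" "w24 = - lor x2 x4" "w34 = - lor x3 x4"
  have W: "w12 > 0" "w13 > 0" "w14 > 0" "w23 > 0" "w24 > 0" "w34 > 0"
    unfolding w_defs using nx fx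
      indep[of "fst x2" "- fst x1" 0 0] indep[of "fst x3" 0 "- fst x1" 0] indep[of "fst x4" 0 0 "- fst x1"]
      indep[of 0 "fst x3" "- fst x2" 0] indep[of 0 "fst x4" 0 "- fst x2"] indep[of 0 0 "fst x4" "- fst x3"]
    by (auto intro!: wpos)
  have l: "lor x1 x2 = - w12" "lor x1 x3 = - w13" "lor x1 x4 = - w14" "lor x2 x3 = - w23" "lor x2 x4 = - w24" "lor x3 x4 = - w34"
    "lor x2 x1 = - w12" "lor x3 x1 = - w13" "lor x4 x1 = - w14" "lor x3 x2 = - w23" "lor x4 x2 = - w24" "lor x4 x3 = - w34"
    unfolding w_defs by (auto simp: lor_commute)
  have causal3: "lor (a *\<^sub>R u + b *\<^sub>R v + c *\<^sub>R w) (a *\<^sub>R u + b *\<^sub>R v + c *\<^sub>R w) \<le> 0 \<and> fst (a *\<^sub>R u + b *\<^sub>R v + c *\<^sub>R w) \<ge> 0"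
    if "a > 0" "b > 0" "c > 0" "lor u u = 0" "lor v v = 0" "lor w w = 0" "fst u > 0" "fst v > 0" "fst w > 0" for a b c and u v w :: "real \<times> 'b"
  proof -
    have le: "lor u v \<le> 0" "lor u w \<le> 0" "lor v w \<le> 0"
      using lor_causal_le[of u v] lor_causal_le[of u w] lor_causal_le[of v w] that by simp_all
    have "lor (a *\<^sub>R u + b *\<^sub>R v + c *\<^sub>R w) (a *\<^sub>R u + b *\<^sub>R v + c *\<^sub>R w) = 2 * (a * b * lor u v) + 2 * (a * c * lor u w) + 2 * (b * c * lor v w)"
      using that by (simp add: lor_simps lor_commute[of v u] lor_commute[of w u] lor_commute[of w v] algebra_simps)
    moreover have "a * b * lor u v \<le> 0" "a * c * lor u w \<le> 0" "b * c * lor v w \<le> 0"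
      using le that by (auto intro!: mult_nonneg_nonpos)
    ultimately show ?thesis using that by simp
  qed
  \<comment> \<open>Writes out that the combination without \<open>r\<close> is not timelike; as the
    vectors are null, only mixed products remain.\<close>
  have main: "b * wb + c * wc + e * we \<ge> b * c * wbc + b * e * wbe + c * e * wce"
    if "b > 0" "c > 0" "e > 0" "lor u u = 0" "lor v v = 0" "lor w w = 0" "lor s s = 0" "fst u > 0" "fst v > 0" "fst w > 0"
      "lor r r \<le> 0" "fst r \<ge> 0" "lor (b *\<^sub>R u + c *\<^sub>R v + e *\<^sub>R w - s + r) (b *\<^sub>R u + c *\<^sub>R v + e *\<^sub>R w - s + r) = 0"
      "lor u s = - wb" "lor v s = - wc" "lor w s = - we" "lor u v = - wbc" "lor u w = - wbe" "lor v w = - wce"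
    for b c e wb wc we wbc wbe wce and u v w s r :: "real \<times> 'b"
  proof -
    have "lor (b *\<^sub>R u + c *\<^sub>R v + e *\<^sub>R w - s) (b *\<^sub>R u + c *\<^sub>R v + e *\<^sub>R w - s) \<ge> 0"
      using lor_not_timelike[of s "b *\<^sub>R u + c *\<^sub>R v + e *\<^sub>R w" r] causal3[OF that(1-6,8-10)] that(7,11-13) by auto
    then show ?thesis using that(4-7,14-19)
      by (simp add: lor_simps lor_commute[of v u] lor_commute[of w u] lor_commute[of w v] lor_commute[of s u] lor_commute[of s v] lor_commute[of s w] algebra_simps)
  qed
  have i1: "a12 * w12 + a13 * w13 + a14 * w14 \<ge> a12 * a13 * w23 + a12 * a14 * w24 + a13 * a14 * w34"
    by (rule main[OF a(1,2,3) nx(2,3,4,1) fx(2,3,4) nr(1) fr(1) y(1)[OF refl] l(7,8,9,4,5,6)])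
  have i2: "a21 * w12 + a23 * w23 + a24 * w24 \<ge> a21 * a23 * w13 + a21 * a24 * w14 + a23 * a24 * w34"
    by (rule main[OF a(4,5,6) nx(1,3,4,2) fx(1,3,4) nr(2) fr(2) y(2)[OF refl] l(1,10,11,2,3,6)])
  have i3: "a31 * w13 + a32 * w23 + a34 * w34 \<ge> a31 * a32 * w12 + a31 * a34 * w14 + a32 * a34 * w24"
    by (rule main[OF a(7,8,9) nx(1,2,4,3) fx(1,2,4) nr(3) fr(3) y(3)[OF refl] l(2,4,12,1,3,5)])
  have i4: "a41 * w14 + a42 * w24 + a43 * w34 \<ge> a41 * a42 * w12 + a41 * a43 * w13 + a42 * a43 * w23"
    by (rule main[OF a(10,11,12) nx(1,2,3,4) fx(1,2,3) nr(4) fr(4) y(4)[OF refl] l(3,5,6,1,2,4)])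
  \<comment> \<open>After rescaling the null vectors by these factors, opposite edges have equal
    products: \<open>A\<close> for 12 and 34, \<open>B\<close> for 13 and 24, \<open>C\<close> for
    14 and 23. This is the equality of opposite dihedral angles of an ideal tetrahedron.\<close>
  define t1 t2 t3 t4 where t_defs: "t1 = sqrt (w23 * w24 * w34)" "t2 = sqrt (w13 * w14 * w34)"
    "t3 = sqrt (w12 * w14 * w24)" "t4 = sqrt (w12 * w13 * w23)"
  have T: "t1 > 0" "t2 > 0" "t3 > 0" "t4 > 0" unfolding t_defs using W by auto
  define A B C where ABC: "A = t1 * t2 * w12" "B = t1 * t3 * w13" "C = t1 * t4 * w14"
  define s12 s13 s14 s23 s24 s34 where s_defs: "s12 = sqrt w12" "s13 = sqrt w13" "s14 = sqrt w14" "s23 = sqrt w23" "s24 = sqrt w24" "s34 = sqrt w34"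
  have ws: "w12 = s12 * s12" "w13 = s13 * s13" "w14 = s14 * s14" "w23 = s23 * s23" "w24 = s24 * s24" "w34 = s34 * s34"
    unfolding s_defs using W by auto
  have ts: "t1 = s23 * s24 * s34" "t2 = s13 * s14 * s34" "t3 = s12 * s14 * s24" "t4 = s12 * s13 * s23"
    unfolding t_defs s_defs by (simp_all add: real_sqrt_mult)
  have A': "A = t3 * t4 * w34" and B': "B = t2 * t4 * w24" and C': "C = t2 * t3 * w23"
    unfolding ABC ts ws by (simp_all add: algebra_simps)
  have pos: "A > 0" "B > 0" "C > 0" unfolding ABC using T W by auto
  define S where "S = t1 *\<^sub>R x1 + t2 *\<^sub>R x2 + t3 *\<^sub>R x3 + t4 *\<^sub>R x4"
  have SS: "lor S S < 0"
  proof -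
    have "lor S S = - 2 * (t1 * t2 * w12 + t1 * t3 * w13 + t1 * t4 * w14 + t2 * t3 * w23 + t2 * t4 * w24 + t3 * t4 * w34)"
      unfolding S_def by (simp add: lor_simps nx l algebra_simps)
    also have "\<dots> = - 4 * (A + B + C)" unfolding ABC[symmetric] A'[symmetric] B'[symmetric] C'[symmetric] by simp
    finally show ?thesis using pos by simp
  qed
  have prods: "t1 * (t2 * w12) = A" "t1 * (t3 * w13) = B" "t1 * (t4 * w14) = C" "t2 * (t3 * w23) = C" "t2 * (t4 * w24) = B" "t3 * (t4 * w34) = A"
    "t2 * (t1 * w12) = A" "t3 * (t1 * w13) = B" "t4 * (t1 * w14) = C" "t3 * (t2 * w23) = C" "t4 * (t2 * w24) = B" "t4 * (t3 * w34) = A"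
    using ABC A' B' C' by (simp_all add: mult.assoc mult.left_commute)
  \<comment> \<open>A combination with two plus and two minus signs is orthogonal to the timelike
    \<open>S\<close>, hence spacelike; its norm is 4 times the slack in one triangle
    inequality.\<close>
  have tri: "A < B + C" "B < A + C" "C < A + B"
  proof -
    let ?u = "t1 *\<^sub>R x1 + t2 *\<^sub>R x2 - t3 *\<^sub>R x3 - t4 *\<^sub>R x4"
    have "lor S ?u = 0" unfolding S_def by (simp add: lor_simps nx l distrib_left distrib_right right_diff_distrib prods)
    moreover have "?u \<noteq> 0" using indep[of t1 t2 "- t3" "- t4"] T by auto
    ultimately have "lor ?u ?u > 0" using lor_orthogonal_timelike[OF SS] by blast
    then show "A < B + C" by (simp add: lor_simps nx l distrib_left distrib_right right_diff_distrib prods)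
    let ?u = "t1 *\<^sub>R x1 - t2 *\<^sub>R x2 + t3 *\<^sub>R x3 - t4 *\<^sub>R x4"
    have "lor S ?u = 0" unfolding S_def by (simp add: lor_simps nx l distrib_left distrib_right right_diff_distrib prods)
    moreover have "?u \<noteq> 0" using indep[of t1 "- t2" t3 "- t4"] T by auto
    ultimately have "lor ?u ?u > 0" using lor_orthogonal_timelike[OF SS] by blast
    then show "B < A + C" by (simp add: lor_simps nx l distrib_left distrib_right right_diff_distrib prods)
    let ?u = "t1 *\<^sub>R x1 - t2 *\<^sub>R x2 - t3 *\<^sub>R x3 + t4 *\<^sub>R x4"
    have "lor S ?u = 0" unfolding S_def by (simp add: lor_simps nx l distrib_left distrib_right right_diff_distrib prods)
    moreover have "?u \<noteq> 0" using indep[of t1 "- t2" "- t3" t4] T by auto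
    ultimately have "lor ?u ?u > 0" using lor_orthogonal_timelike[OF SS] by blast
    then show "C < A + B" by (simp add: lor_simps nx l distrib_left distrib_right right_diff_distrib prods)
  qed
  \<comment> \<open>One side is linear and the other quadratic in the triple, so scaling by
    \<open>L / R \<ge> 1\<close> turns the inequality into the equation of
    \<open>four_triples\<close>. Factors of at least 1 keep the products above 1.\<close>
  have vertex: "\<exists>m\<ge>1. A * (m * x) + B * (m * y) + C * (m * z) = A * ((m * y) * (m * z)) + B * ((m * x) * (m * z)) + C * ((m * x) * (m * y))"
    if xyz: "x > 0" "y > 0" "z > 0" and le: "A * x + B * y + C * z \<ge> A * (y * z) + B * (x * z) + C * (x * y)" for x y z :: real
  proof -
    define L R where LR: "L = A * x + B * y + C * z" "R = A * (y * z) + B * (x * z) + C * (x * y)"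
    have R: "R > 0" unfolding LR using pos xyz by (intro add_pos_pos mult_pos_pos)
    have m: "L / R \<ge> 1" using le R unfolding LR by (simp add: le_divide_eq)
    define q where "q = L / R"
    have "A * (q * x) + B * (q * y) + C * (q * z) = q * L" unfolding LR(1) by (simp add: algebra_simps)
    also have "\<dots> = q * q * R" using R by (simp add: q_def)
    also have "\<dots> = A * ((q * y) * (q * z)) + B * ((q * x) * (q * z)) + C * ((q * x) * (q * y))"
      unfolding LR(2) by (simp add: algebra_simps)
    finally show ?thesis using m unfolding q_def by blast
  qed
  \<comment> \<open>\<open>a12 * t1 / t2\<close> is the coefficient of
    \<open>t2 *\<^sub>R x2\<close> after multiplying the combination at \<open>x1\<close> by
    \<open>t1\<close>; products such as \<open>a12 * a21\<close> are not affected by this.\<close>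
  have "\<exists>m1\<ge>1. A * (m1 * (a12 * t1 / t2)) + B * (m1 * (a13 * t1 / t3)) + C * (m1 * (a14 * t1 / t4)) =
     A * ((m1 * (a13 * t1 / t3)) * (m1 * (a14 * t1 / t4))) + B * ((m1 * (a12 * t1 / t2)) * (m1 * (a14 * t1 / t4))) + C * ((m1 * (a12 * t1 / t2)) * (m1 * (a13 * t1 / t3)))"
  proof (rule vertex)
    have "A * (a12 * t1 / t2) + B * (a13 * t1 / t3) + C * (a14 * t1 / t4) = t1 * t1 * (a12 * w12 + a13 * w13 + a14 * w14)"
      unfolding ABC using T by (simp add: field_simps)
    moreover have "A * (a13 * t1 / t3 * (a14 * t1 / t4)) + B * (a12 * t1 / t2 * (a14 * t1 / t4)) + C * (a12 * t1 / t2 * (a13 * t1 / t3))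
       = t1 * t1 * (a12 * a13 * w23 + a12 * a14 * w24 + a13 * a14 * w34)"
      unfolding A' B' C' using T by (simp add: field_simps)
    ultimately show "A * (a13 * t1 / t3 * (a14 * t1 / t4)) + B * (a12 * t1 / t2 * (a14 * t1 / t4)) + C * (a12 * t1 / t2 * (a13 * t1 / t3))
      \<le> A * (a12 * t1 / t2) + B * (a13 * t1 / t3) + C * (a14 * t1 / t4)" using i1 by (simp add: mult_left_mono)
  qed (use a T in auto)
  then obtain m1 where m1: "m1 \<ge> 1" "A * (m1 * (a12 * t1 / t2)) + B * (m1 * (a13 * t1 / t3)) + C * (m1 * (a14 * t1 / t4)) =
     A * ((m1 * (a13 * t1 / t3)) * (m1 * (a14 * t1 / t4))) + B * ((m1 * (a12 * t1 / t2)) * (m1 * (a14 * t1 / t4))) + C * ((m1 * (a12 * t1 / t2)) * (m1 * (a13 * t1 / t3)))" by blast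
  have "\<exists>m2\<ge>1. A * (m2 * (a21 * t2 / t1)) + B * (m2 * (a24 * t2 / t4)) + C * (m2 * (a23 * t2 / t3)) =
     A * ((m2 * (a24 * t2 / t4)) * (m2 * (a23 * t2 / t3))) + B * ((m2 * (a21 * t2 / t1)) * (m2 * (a23 * t2 / t3))) + C * ((m2 * (a21 * t2 / t1)) * (m2 * (a24 * t2 / t4)))"
  proof (rule vertex)
    have "A * (a21 * t2 / t1) + B * (a24 * t2 / t4) + C * (a23 * t2 / t3) = t2 * t2 * (a21 * w12 + a23 * w23 + a24 * w24)"
      unfolding ABC(1) B' C' using T by (simp add: field_simps)
    moreover have "A * (a24 * t2 / t4 * (a23 * t2 / t3)) + B * (a21 * t2 / t1 * (a23 * t2 / t3)) + C * (a21 * t2 / t1 * (a24 * t2 / t4))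
       = t2 * t2 * (a21 * a23 * w13 + a21 * a24 * w14 + a23 * a24 * w34)"
      unfolding A' ABC(2,3) using T by (simp add: field_simps)
    ultimately show "A * (a24 * t2 / t4 * (a23 * t2 / t3)) + B * (a21 * t2 / t1 * (a23 * t2 / t3)) + C * (a21 * t2 / t1 * (a24 * t2 / t4))
      \<le> A * (a21 * t2 / t1) + B * (a24 * t2 / t4) + C * (a23 * t2 / t3)" using i2 by (simp add: mult_left_mono)
  qed (use a T in auto)
  then obtain m2 where m2: "m2 \<ge> 1" "A * (m2 * (a21 * t2 / t1)) + B * (m2 * (a24 * t2 / t4)) + C * (m2 * (a23 * t2 / t3)) =
     A * ((m2 * (a24 * t2 / t4)) * (m2 * (a23 * t2 / t3))) + B * ((m2 * (a21 * t2 / t1)) * (m2 * (a23 * t2 / t3))) + C * ((m2 * (a21 * t2 / t1)) * (m2 * (a24 * t2 / t4)))" by blast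
  have "\<exists>m3\<ge>1. A * (m3 * (a34 * t3 / t4)) + B * (m3 * (a31 * t3 / t1)) + C * (m3 * (a32 * t3 / t2)) =
     A * ((m3 * (a31 * t3 / t1)) * (m3 * (a32 * t3 / t2))) + B * ((m3 * (a34 * t3 / t4)) * (m3 * (a32 * t3 / t2))) + C * ((m3 * (a34 * t3 / t4)) * (m3 * (a31 * t3 / t1)))"
  proof (rule vertex)
    have "A * (a34 * t3 / t4) + B * (a31 * t3 / t1) + C * (a32 * t3 / t2) = t3 * t3 * (a31 * w13 + a32 * w23 + a34 * w34)"
      unfolding A' ABC(2) C' using T by (simp add: field_simps)
    moreover have "A * (a31 * t3 / t1 * (a32 * t3 / t2)) + B * (a34 * t3 / t4 * (a32 * t3 / t2)) + C * (a34 * t3 / t4 * (a31 * t3 / t1))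
       = t3 * t3 * (a31 * a32 * w12 + a31 * a34 * w14 + a32 * a34 * w24)"
      unfolding ABC(1,3) B' using T by (simp add: field_simps)
    ultimately show "A * (a31 * t3 / t1 * (a32 * t3 / t2)) + B * (a34 * t3 / t4 * (a32 * t3 / t2)) + C * (a34 * t3 / t4 * (a31 * t3 / t1))
      \<le> A * (a34 * t3 / t4) + B * (a31 * t3 / t1) + C * (a32 * t3 / t2)" using i3 by (simp add: mult_left_mono)
  qed (use a T in auto)
  then obtain m3 where m3: "m3 \<ge> 1" "A * (m3 * (a34 * t3 / t4)) + B * (m3 * (a31 * t3 / t1)) + C * (m3 * (a32 * t3 / t2)) =
     A * ((m3 * (a31 * t3 / t1)) * (m3 * (a32 * t3 / t2))) + B * ((m3 * (a34 * t3 / t4)) * (m3 * (a32 * t3 / t2))) + C * ((m3 * (a34 * t3 / t4)) * (m3 * (a31 * t3 / t1)))" by blast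
  have "\<exists>m4\<ge>1. A * (m4 * (a43 * t4 / t3)) + B * (m4 * (a42 * t4 / t2)) + C * (m4 * (a41 * t4 / t1)) =
     A * ((m4 * (a42 * t4 / t2)) * (m4 * (a41 * t4 / t1))) + B * ((m4 * (a43 * t4 / t3)) * (m4 * (a41 * t4 / t1))) + C * ((m4 * (a43 * t4 / t3)) * (m4 * (a42 * t4 / t2)))"
  proof (rule vertex)
    have "A * (a43 * t4 / t3) + B * (a42 * t4 / t2) + C * (a41 * t4 / t1) = t4 * t4 * (a41 * w14 + a42 * w24 + a43 * w34)"
      unfolding A' B' ABC(3) using T by (simp add: field_simps)
    moreover have "A * (a42 * t4 / t2 * (a41 * t4 / t1)) + B * (a43 * t4 / t3 * (a41 * t4 / t1)) + C * (a43 * t4 / t3 * (a42 * t4 / t2))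
       = t4 * t4 * (a41 * a42 * w12 + a41 * a43 * w13 + a42 * a43 * w23)"
      unfolding ABC(1,2) C' using T by (simp add: field_simps)
    ultimately show "A * (a42 * t4 / t2 * (a41 * t4 / t1)) + B * (a43 * t4 / t3 * (a41 * t4 / t1)) + C * (a43 * t4 / t3 * (a42 * t4 / t2))
      \<le> A * (a43 * t4 / t3) + B * (a42 * t4 / t2) + C * (a41 * t4 / t1)" using i4 by (simp add: mult_left_mono)
  qed (use a T in auto)
  then obtain m4 where m4: "m4 \<ge> 1" "A * (m4 * (a43 * t4 / t3)) + B * (m4 * (a42 * t4 / t2)) + C * (m4 * (a41 * t4 / t1)) =
     A * ((m4 * (a42 * t4 / t2)) * (m4 * (a41 * t4 / t1))) + B * ((m4 * (a43 * t4 / t3)) * (m4 * (a41 * t4 / t1))) + C * ((m4 * (a43 * t4 / t3)) * (m4 * (a42 * t4 / t2)))" by blast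
  have mm: "(m * (b * t / u)) * (m' * (c * u / t)) > 1" if "m \<ge> 1" "m' \<ge> 1" "b * c > 1" "t > 0" "u > 0" for m m' b c t u :: real
  proof -
    have "(m * (b * t / u)) * (m' * (c * u / t)) = (m * m') * (b * c)" using that by (simp add: field_simps)
    moreover have "1 * 1 \<le> m * m'" using that by (intro mult_mono) auto
    ultimately show ?thesis using that by (smt (verit) mult_less_cancel_right2 mult_le_cancel_right2)
  qed
  \<comment> \<open>\<open>X\<close>, \<open>Y\<close>, \<open>Z\<close> sort the coefficients by
    pairs of opposite edges, in the order of \<open>A\<close>, \<open>B\<close>, \<open>C\<close>.
    All indices other than 1, 2, 3 get the fourth value, because \<open>four_triples\<close>
    quantifies over all naturals.\<close>
  define X where "X i = (if i = 1 then m1 * (a12 * t1 / t2) else if i = 2 then m2 * (a21 * t2 / t1) else if i = 3 then m3 * (a34 * t3 / t4) else m4 * (a43 * t4 / t3))" for i :: nat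
  define Y where "Y i = (if i = 1 then m1 * (a13 * t1 / t3) else if i = 2 then m2 * (a24 * t2 / t4) else if i = 3 then m3 * (a31 * t3 / t1) else m4 * (a42 * t4 / t2))" for i :: nat
  define Z where "Z i = (if i = 1 then m1 * (a14 * t1 / t4) else if i = 2 then m2 * (a23 * t2 / t3) else if i = 3 then m3 * (a32 * t3 / t2) else m4 * (a41 * t4 / t1))" for i :: nat
  show False
  proof (rule four_triples[OF pos tri])
    show "X i > 0 \<and> Y i > 0 \<and> Z i > 0" for i
      unfolding X_def Y_def Z_def using m1(1) m2(1) m3(1) m4(1) a T by auto
    show "A * X i + B * Y i + C * Z i = A * (Y i * Z i) + B * (X i * Z i) + C * (X i * Y i)" for i
      unfolding X_def Y_def Z_def using m1(2) m2(2) m3(2) m4(2) by (simp split: if_split)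
    show "X 1 * X 2 > 1" "X 3 * X 4 > 1" "Y 1 * Y 3 > 1" "Y 2 * Y 4 > 1" "Z 1 * Z 4 > 1" "Z 2 * Z 3 > 1"
      unfolding X_def Y_def Z_def using mm m1(1) m2(1) m3(1) m4(1) pr T by simp_all
  qed
qed

section \<open>Tangency in terms of the Lorentz form\<close>

lemma cap_eq: "cap = {x :: real \<times> (real ^ 'n::finite). x \<in> sphere 0 1 \<and> fst x \<ge> 0 \<and> lor x x \<le> 0}"
proof -
  have "(\<Sum>i\<in>UNIV. (snd x $ i)\<^sup>2) = snd x \<bullet> snd x" for x :: "real \<times> (real ^ 'n)"
    by (simp add: inner_vec_def power2_eq_square)
  then show ?thesis unfolding cap_def lor_def by (auto simp: power2_eq_square)
qed

lemma continuous_on_lor [continuous_intros]: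
  "continuous_on S f \<Longrightarrow> continuous_on S g \<Longrightarrow> continuous_on S (\<lambda>t. lor (f t) (g t))"
  unfolding lor_def by (intro continuous_intros)

lemma cap_interiorI:
  fixes x :: "real \<times> (real ^ 'n::finite)"
  assumes "x \<in> sphere 0 1" "fst x > 0" "lor x x < 0"
  shows "x \<in> cap_interior"
proof -
  let ?U = "{x :: real \<times> (real ^ 'n). 0 < fst x} \<inter> {x. lor x x < 0}"
  have "open ?U" by (intro open_Int open_Collect_less continuous_intros)
  then have "openin (top_of_set (sphere 0 1)) (sphere 0 1 \<inter> ?U)" by (rule openin_open_Int)
  then have "sphere 0 1 \<inter> ?U \<subseteq> cap_interior" unfolding cap_interior_def
    by (intro interior_of_maximal) (auto simp: cap_eq)
  then show ?thesis using assms by auto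
qed

text \<open>A null point of the cap is not interior: stretching its space part slightly and
  normalizing gives points of the sphere nearby that are outside the cap.\<close>

lemma cap_interiorD:
  fixes x :: "real \<times> (real ^ 'n::finite)"
  assumes "x \<in> cap_interior"
  shows "x \<in> sphere 0 1" "fst x > 0" "lor x x < 0"
proof -
  have "x \<in> cap" using assms interior_of_subset[of "top_of_set (sphere 0 1)" cap] unfolding cap_interior_def by auto
  then have x: "x \<in> sphere 0 1" "fst x \<ge> 0" "lor x x \<le> 0" unfolding cap_eq by auto
  show "lor x x < 0"
  proof (rule ccontr)
    assume "\<not> lor x x < 0"
    then have l0: "lor x x = 0" using x by simp
    have "x \<noteq> 0" using x(1) by auto
    have "norm (snd x) = fst x" using null_norm l0 x(2) by blast
    then have s0: "snd x \<noteq> 0" using \<open>x \<noteq> 0\<close> by (auto simp: prod_eq_iff)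
    obtain U where U: "openin (top_of_set (sphere 0 1)) U" "x \<in> U" "U \<subseteq> cap"
      using assms unfolding cap_interior_def interior_of_def by auto
    obtain T where T: "open T" "U = sphere 0 1 \<inter> T" using U(1) unfolding openin_open by auto
    define z where "z t = (fst x, (1 + t) *\<^sub>R snd x)" for t :: real
    have z0: "z 0 = x" unfolding z_def by simp
    have "isCont (\<lambda>t. (1 / norm (z t)) *\<^sub>R z t) 0"
      unfolding z_def by (intro continuous_intros) (use s0 in auto)
    then have "((\<lambda>t. (1 / norm (z t)) *\<^sub>R z t) \<longlongrightarrow> x) (at 0)" using z0 x(1) unfolding isCont_def by simp
    then have "((\<lambda>t. (1 / norm (z t)) *\<^sub>R z t) \<longlongrightarrow> x) (at_right 0)" by (rule tendsto_mono[rotated]) (simp add: at_within_le_at)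
    then have "\<forall>\<^sub>F t in at_right 0. (1 / norm (z t)) *\<^sub>R z t \<in> T" using T U(2) topological_tendstoD by blast
    moreover have "\<forall>\<^sub>F t::real in at_right 0. t > 0" by (simp add: eventually_at_right_less)
    ultimately have "\<forall>\<^sub>F t in at_right 0. (1 / norm (z t)) *\<^sub>R z t \<in> T \<and> t > 0" by (rule eventually_conj)
    then obtain t where t: "(1 / norm (z t)) *\<^sub>R z t \<in> T" "t > 0"
      using eventually_happens'[OF trivial_limit_at_right_real] by blast
    have zn: "z t \<noteq> 0" using s0 t unfolding z_def by (auto simp: prod_eq_iff)
    then have "(1 / norm (z t)) *\<^sub>R z t \<in> cap" using t T U(3) by auto
    then have le: "(1 / norm (z t)) * ((1 / norm (z t)) * lor (z t) (z t)) \<le> 0" unfolding cap_eq by (simp add: lor_simps)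
    have "lor (z t) (z t) = (1 + t) * (1 + t) * (snd x \<bullet> snd x) - fst x * fst x" by (simp add: z_def lor_def)
    also have "\<dots> = (2 * t + t * t) * (snd x \<bullet> snd x)" using l0 by (simp add: lor_def algebra_simps)
    also have "\<dots> > 0" using t s0 by (intro mult_pos_pos) (auto intro: add_pos_pos)
    finally show False using le zn by (simp add: mult_le_0_iff zero_less_mult_iff not_less[symmetric])
  qed
  then have "fst x \<noteq> 0" by (auto simp: lor_def) (metis inner_ge_zero not_less)
  then show "fst x > 0" using x by simp
  show "x \<in> sphere 0 1" by (rule x(1))
qed

lemma cap_boundary_iff:
  fixes x :: "real \<times> (real ^ 'n::finite)"
  shows "x \<in> cap_boundary \<longleftrightarrow> x \<in> sphere 0 1 \<and> fst x \<ge> 0 \<and> lor x x = 0"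
proof -
  let ?U = "{x :: real \<times> (real ^ 'n). 0 \<le> fst x} \<inter> {x. lor x x \<le> 0}"
  have "closed ?U" by (intro closed_Int closed_Collect_le continuous_intros)
  then have "closedin (top_of_set (sphere 0 1)) (sphere 0 1 \<inter> ?U)" by (rule closedin_closed_Int)
  moreover have "sphere 0 1 \<inter> ?U = cap" by (auto simp: cap_eq)
  ultimately have "closedin (top_of_set (sphere 0 1)) (cap :: (real \<times> (real ^ 'n)) set)" by simp
  then have "(top_of_set (sphere 0 1)) closure_of (cap :: (real \<times> (real ^ 'n)) set) = cap" by (rule closure_of_closedin)
  then have "x \<in> cap_boundary \<longleftrightarrow> x \<in> cap \<and> x \<notin> cap_interior"
    unfolding cap_boundary_def frontier_of_def cap_interior_def by auto
  also have "\<dots> \<longleftrightarrow> x \<in> sphere 0 1 \<and> fst x \<ge> 0 \<and> lor x x = 0"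
  proof
    assume a: "x \<in> cap \<and> x \<notin> cap_interior"
    then have c: "x \<in> sphere 0 1" "fst x \<ge> 0" "lor x x \<le> 0" by (auto simp: cap_eq)
    have "lor x x = 0"
    proof (rule ccontr)
      assume "lor x x \<noteq> 0"
      then have l: "lor x x < 0" using c by simp
      then have "fst x \<noteq> 0" by (auto simp: lor_def) (metis inner_ge_zero not_less)
      then show False using cap_interiorI[of x] a c l by simp
    qed
    then show "x \<in> sphere 0 1 \<and> fst x \<ge> 0 \<and> lor x x = 0" using c by auto
  qed (use cap_interiorD[of x] in \<open>auto simp: cap_eq\<close>)
  finally show ?thesis .
qed

section \<open>Cones over spherical polytopes and their relative interiors\<close>

lemma convex_cone_hull_sphere:
  fixes C :: "'a::euclidean_space set"
  assumes "convex_cone C"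
  shows "convex_cone hull (C \<inter> sphere 0 1) = C"
proof
  show "convex_cone hull (C \<inter> sphere 0 1) \<subseteq> C" by (rule hull_minimal) (use assms in auto)
  show "C \<subseteq> convex_cone hull (C \<inter> sphere 0 1)"
  proof
    fix x assume x: "x \<in> C"
    show "x \<in> convex_cone hull (C \<inter> sphere 0 1)"
    proof (cases "x = 0")
      case True
      then show ?thesis using convex_cone_hull_contains_0 by auto
    next
      case False
      have "(1 / norm x) *\<^sub>R x \<in> C" using assms x by (simp add: convex_cone_scaleR)
      then have "(1 / norm x) *\<^sub>R x \<in> C \<inter> sphere 0 1" using False by simp
      then have "(1 / norm x) *\<^sub>R x \<in> convex_cone hull (C \<inter> sphere 0 1)" by (rule hull_inc)
      then have "norm x *\<^sub>R (1 / norm x) *\<^sub>R x \<in> convex_cone hull (C \<inter> sphere 0 1)" by (rule convex_cone_hull_mul) simp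
      then show ?thesis using False by simp
    qed
  qed
qed

lemma spherical_polytope_cone:
  fixes Q :: "'a::euclidean_space set"
  assumes "spherical_polytope Q"
  shows "polyhedron (convex_cone hull Q)" "\<And>x. x \<in> convex_cone hull Q \<Longrightarrow> - x \<in> convex_cone hull Q \<Longrightarrow> x = 0"
proof -
  obtain A where A: "finite A" "Q = sphere 0 1 \<inter> (\<Inter>a\<in>A. closed_hemisphere a)" and anti: "\<forall>x\<in>Q. - x \<notin> Q"
    using assms unfolding spherical_polytope_def by auto
  define K where "K = (\<Inter>a\<in>A. {x. a \<bullet> x \<le> 0})"
  have Q: "Q = K \<inter> sphere 0 1" unfolding A(2) K_def closed_hemisphere_def by auto
  have "convex_cone K" unfolding K_def by (intro convex_cone_Inter) (auto simp: convex_cone_halfspace_le)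
  then have hull: "convex_cone hull Q = K" unfolding Q by (rule convex_cone_hull_sphere)
  have "polyhedron K" unfolding K_def using A(1) by (intro polyhedron_Inter) (auto simp: polyhedron_halfspace_le)
  then show "polyhedron (convex_cone hull Q)" using hull by simp
  fix x assume x: "x \<in> convex_cone hull Q" "- x \<in> convex_cone hull Q"
  show "x = 0"
  proof (rule ccontr)
    assume x0: "x \<noteq> 0"
    have "x \<in> K" "- x \<in> K" using x hull by auto
    then have "(1 / norm x) *\<^sub>R x \<in> K" "(1 / norm x) *\<^sub>R (- x) \<in> K"
      using \<open>convex_cone K\<close> by (simp_all only: convex_cone_scaleR divide_nonneg_nonneg norm_ge_zero zero_le_one)
    then have "(1 / norm x) *\<^sub>R x \<in> Q" "- ((1 / norm x) *\<^sub>R x) \<in> Q" using x0 unfolding Q by auto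
    then show False using anti by blast
  qed
qed

lemma span_poscone: "finite A \<Longrightarrow> span (poscone v A) = span (v ` A)"
  by (intro subset_antisym span_minimal poscone_subset_span subspace_span) (auto intro!: span_base poscone_member)

lemma aff_dim_poscone:
  fixes v :: "'i \<Rightarrow> 'a::euclidean_space"
  assumes "finite A" "inj_on v A" "independent (v ` A)"
  shows "aff_dim (poscone v A) = int (card A)"
proof -
  have "aff_dim (poscone v A) = int (dim (poscone v A))"
    by (rule aff_dim_zero) (simp add: hull_inc poscone_zero)
  also have "dim (poscone v A) = dim (v ` A)" using span_poscone[OF assms(1), of v] by (metis dim_span)
  also have "\<dots> = card A" using assms by (simp add: dim_eq_card_independent card_image)
  finally show ?thesis .
qed

text \<open>Moving slightly past \<open>x\<close>, away from \<open>v i\<close>, stays in the cone,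
  and the new coefficient \<open>1 - m + m * c i\<close> with \<open>m > 1\<close> is nonnegative
  only if \<open>c i > 0\<close>.\<close>

lemma rel_interior_poscone_pos:
  fixes v :: "'i \<Rightarrow> 'a::euclidean_space"
  assumes "finite A" "inj_on v A" "independent (v ` A)" "x \<in> rel_interior (poscone v A)" "x = (\<Sum>i\<in>A. c i *\<^sub>R v i)" "i \<in> A"
  shows "c i > 0"
proof -
  have "v i \<in> affine hull (poscone v A)" by (intro hull_inc poscone_member assms)
  then obtain m where m: "m > 1" "(1 - m) *\<^sub>R v i + m *\<^sub>R x \<in> poscone v A"
    using convex_rel_interior_if[OF convex_poscone assms(4)] by (metis order_refl)
  obtain b where b: "\<And>i. i \<in> A \<Longrightarrow> b i \<ge> (0::real)" "(1 - m) *\<^sub>R v i + m *\<^sub>R x = (\<Sum>i\<in>A. b i *\<^sub>R v i)" using m(2) by (rule posconeE) blast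
  have "(\<Sum>j\<in>A. (if j = i then 1 - m else 0) *\<^sub>R v j) = (1 - m) *\<^sub>R v i"
    using assms by (subst sum.mono_neutral_right[of A "{i}"]) auto
  then have "(\<Sum>j\<in>A. ((if j = i then 1 - m else 0) + m * c j) *\<^sub>R v j) = (\<Sum>i\<in>A. b i *\<^sub>R v i)"
    unfolding b(2)[symmetric] assms(5) by (simp add: scaleR_add_left sum.distrib scaleR_sum_right)
  from independent_sum_eqD[OF assms(2,3,1) this assms(6)] have "1 - m + m * c i = b i" by simp
  then have "m * c i > 0" using b(1)[OF assms(6)] m(1) by linarith
  then show ?thesis using m(1) by (simp add: zero_less_mult_iff)
qed

lemma rel_interior_posconeI:
  fixes v :: "'i \<Rightarrow> 'a::euclidean_space"
  assumes "finite A" "\<And>i. i \<in> A \<Longrightarrow> c i > 0" "x = (\<Sum>i\<in>A. c i *\<^sub>R v i)"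
  shows "x \<in> rel_interior (poscone v A)"
proof (rule convex_rel_interior_only_if)
  show "convex (poscone v A)" by (rule convex_poscone)
  show "poscone v A \<noteq> {}" using poscone_zero by blast
  show "\<forall>y\<in>poscone v A. \<exists>m>1. (1 - m) *\<^sub>R y + m *\<^sub>R x \<in> poscone v A"
  proof
    fix y assume "y \<in> poscone v A"
    then obtain b where b: "\<And>i. i \<in> A \<Longrightarrow> b i \<ge> (0::real)" "y = (\<Sum>i\<in>A. b i *\<^sub>R v i)" by (rule posconeE) blast
    show "\<exists>m>1. (1 - m) *\<^sub>R y + m *\<^sub>R x \<in> poscone v A"
    proof (cases "A = {}")
      case True
      then show ?thesis using b(2) assms(3) by (intro exI[of _ 2]) simp
    next
      case False
      define e where "e = Min ((\<lambda>i. c i / (b i + 1)) ` A)"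
      have e: "e > 0" "\<And>i. i \<in> A \<Longrightarrow> e \<le> c i / (b i + 1)" unfolding e_def using False assms(1,2) b(1)
        by (auto intro!: divide_pos_pos add_nonneg_pos)
      have le: "(1 + e) * c i - e * b i \<ge> 0" if "i \<in> A" for i
      proof -
        have "b i + 1 > 0" using b(1)[OF that] by simp
        then have "e * (b i + 1) \<le> c i" using e(2)[OF that] by (simp add: le_divide_eq)
        moreover have "e * c i > 0" using e(1) assms(2)[OF that] by simp
        ultimately show ?thesis using e(1) by (simp add: algebra_simps)
      qed
      have "(1 - (1 + e)) *\<^sub>R y + (1 + e) *\<^sub>R x = (1 + e) *\<^sub>R x - e *\<^sub>R y" by (simp add: algebra_simps)
      also have "\<dots> = (\<Sum>i\<in>A. ((1 + e) * c i - e * b i) *\<^sub>R v i)"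
        unfolding b(2) assms(3) scaleR_diff_left sum_subtractf scaleR_sum_right by simp
      finally have "(1 - (1 + e)) *\<^sub>R y + (1 + e) *\<^sub>R x = (\<Sum>i\<in>A. ((1 + e) * c i - e * b i) *\<^sub>R v i)" .
      then show ?thesis using posconeI[of A "\<lambda>i. (1 + e) * c i - e * b i" v] le e(1) by (intro exI[of _ "1 + e"]) auto
    qed
  qed
qed

text \<open>The span misses the interior of the cap, so the form is positive semidefinite on it, and
  a null vector of a semidefinite form is orthogonal to the whole span. Here this null vector is the
  point of tangency.\<close>

lemma tangent_faceD:
  fixes v :: "'i \<Rightarrow> real \<times> (real ^ 'n::finite)"
  assumes A: "finite A" "inj_on v A" "independent (v ` A)" and T: "tangent_face (poscone v A \<inter> sphere 0 1)"
  shows "\<exists>c. (\<forall>i\<in>A. c i > 0) \<and> lor (\<Sum>i\<in>A. c i *\<^sub>R v i) (\<Sum>i\<in>A. c i *\<^sub>R v i) = 0 \<and> fst (\<Sum>i\<in>A. c i *\<^sub>R v i) > 0 \<and>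
     (\<forall>y\<in>span (v ` A). lor (\<Sum>i\<in>A. c i *\<^sub>R v i) y = 0)"
proof -
  let ?F = "poscone v A \<inter> sphere 0 1"
  have hull: "convex_cone hull ?F = poscone v A" by (rule convex_cone_hull_sphere) (rule convex_cone_poscone)
  obtain x where "x \<in> spherical_relint ?F \<inter> cap_boundary" and disj: "spherical_span ?F \<inter> cap_interior = {}"
    using T unfolding tangent_face_def by auto
  then have x: "x \<in> rel_interior (poscone v A)" "x \<in> sphere 0 1" "fst x \<ge> 0" "lor x x = 0"
    unfolding spherical_relint_def hull by (auto simp: cap_boundary_iff)
  have "x \<in> poscone v A" using x(1) rel_interior_subset by blast
  then obtain c where c: "x = (\<Sum>i\<in>A. c i *\<^sub>R v i)" by (rule posconeE)
  have cpos: "c i > 0" if "i \<in> A" for i using rel_interior_poscone_pos[OF A x(1) c that] .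
  have fx: "fst x > 0"
  proof -
    have "norm (snd x) = fst x" using null_norm x by blast
    moreover have "x \<noteq> 0" using x(2) by auto
    ultimately show ?thesis using x(3) by (auto simp: prod_eq_iff less_le)
  qed
  have spanF: "span ?F = span (v ` A)"
  proof -
    have "span ?F = span (poscone v A)"
    proof (intro subset_antisym span_minimal subspace_span)
      show "?F \<subseteq> span (poscone v A)" using span_superset by blast
      have "convex_cone hull ?F \<subseteq> span ?F" by (rule hull_minimal) (auto simp: span_superset convex_cone_span)
      then show "poscone v A \<subseteq> span ?F" unfolding hull .
    qed
    then show ?thesis using span_poscone[OF A(1)] by metis
  qed
  have psd: "lor y y \<ge> 0" if y: "y \<in> span (v ` A)" for y
  proof (rule ccontr)
    assume "\<not> lor y y \<ge> 0"
    then have ly: "lor y y < 0" by simp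
    then have f0: "fst y \<noteq> 0" by (auto simp: lor_def) (metis inner_ge_zero not_less)
    then have y0: "norm y > 0" by auto
    \<comment> \<open>Scales \<open>y\<close> to the unit sphere and, by the sign, to positive
      height; a timelike vector then lands in the interior of the cap.\<close>
    define s where "s = sgn (fst y) / norm y"
    have s0: "s * s > 0" using f0 y0 unfolding s_def by (auto simp: sgn_real_def)
    have "s *\<^sub>R y \<in> span ?F" unfolding spanF using y by (simp add: span_scale)
    moreover have "s *\<^sub>R y \<in> sphere 0 1" using f0 y0 unfolding s_def by (auto simp: sgn_real_def)
    moreover have "fst (s *\<^sub>R y) > 0" using f0 y0 unfolding s_def by (auto simp: sgn_real_def divide_neg_pos mult_neg_neg zero_less_divide_iff)
    moreover have "lor (s *\<^sub>R y) (s *\<^sub>R y) = (s * s) * lor y y" by (simp add: lor_simps)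
    then have "lor (s *\<^sub>R y) (s *\<^sub>R y) < 0" using s0 ly by (simp add: mult_pos_neg)
    ultimately have "s *\<^sub>R y \<in> spherical_span ?F \<inter> cap_interior"
      unfolding spherical_span_def using cap_interiorI[of "s *\<^sub>R y"] by auto
    then show False using disj by auto
  qed
  have "lor x y = 0" if y: "y \<in> span (v ` A)" for y
  proof (rule ccontr)
    assume ne: "lor x y \<noteq> 0"
    have xs: "x \<in> span (v ` A)" using \<open>x \<in> poscone v A\<close> poscone_subset_span by blast
    \<comment> \<open>Makes the linear term of
      \<open>lor (x + t *\<^sub>R y) (x + t *\<^sub>R y)\<close> negative and dominant; the summand
      1 avoids a zero denominator.\<close>
    define t where "t = - lor x y / (lor y y + 1)"
    have ly: "lor y y \<ge> 0" using psd y by blast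
    have "x + t *\<^sub>R y \<in> span (v ` A)" using xs y by (intro span_add span_scale)
    then have "lor (x + t *\<^sub>R y) (x + t *\<^sub>R y) \<ge> 0" by (rule psd)
    then have "2 * t * lor x y + t * t * lor y y \<ge> 0" using x(4) by (simp add: lor_simps lor_commute[of y x] algebra_simps)
    moreover have "(2 * t * lor x y + t * t * lor y y) * ((lor y y + 1) * (lor y y + 1)) < 0"
    proof -
      have tD: "t * (lor y y + 1) = - lor x y" using ly by (simp add: t_def)
      have "(2 * t * lor x y + t * t * lor y y) * ((lor y y + 1) * (lor y y + 1)) =
        2 * (t * (lor y y + 1)) * lor x y * (lor y y + 1) + (t * (lor y y + 1)) * (t * (lor y y + 1)) * lor y y"
        by (simp add: algebra_simps)
      also have "\<dots> = 2 * (- lor x y) * lor x y * (lor y y + 1) + (- lor x y) * (- lor x y) * lor y y" unfolding tD ..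
      also have "\<dots> = - (lor x y * lor x y) * (lor y y + 2)" by (simp add: algebra_simps)
      finally have "(2 * t * lor x y + t * t * lor y y) * ((lor y y + 1) * (lor y y + 1)) = - (lor x y * lor x y) * (lor y y + 2)" .
      moreover have "lor x y * lor x y > 0" using ne by (metis not_real_square_gt_zero)
      ultimately show ?thesis using ly by (simp add: mult_neg_pos)
    qed
    moreover have "(lor y y + 1) * (lor y y + 1) > 0" using ly by simp
    ultimately show False by (simp add: mult_less_0_iff not_le[symmetric])
  qed
  then show ?thesis using cpos x(4) fx c by blast
qed

section \<open>A simplex stacked on four facets\<close>

text \<open>Step \<open>m\<close> stacks the vertex \<open>d + 1 + m\<close> onto the facet opposite
  to \<open>m\<close>. For \<open>d = 3\<close> four steps use up all facets of the original
  simplex.\<close>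

fun multi_stack :: "nat \<Rightarrow> nat \<Rightarrow> nat set set" where
  "multi_stack d 0 = {F. F \<subseteq> {0..d} \<and> card F = d}"
| "multi_stack d (Suc m) = stack_family (multi_stack d m) ({0..d} - {m}) (d + 1 + m)"

lemma multi_stack_props:
  assumes "m \<le> d + 1" "d \<ge> 2"
  shows "stacked_family d (multi_stack d m)" "\<Union>(multi_stack d m) = {0..d + m}"
    "\<And>i. m \<le> i \<Longrightarrow> i \<le> d \<Longrightarrow> {0..d} - {i} \<in> multi_stack d m"
    "\<And>i j. i < m \<Longrightarrow> j \<le> d \<Longrightarrow> j \<noteq> i \<Longrightarrow> insert (d + 1 + i) ({0..d} - {i} - {j}) \<in> multi_stack d m"
proof -
  have "stacked_family d (multi_stack d m) \<and> \<Union>(multi_stack d m) = {0..d + m} \<and>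
    (\<forall>i. m \<le> i \<longrightarrow> i \<le> d \<longrightarrow> {0..d} - {i} \<in> multi_stack d m) \<and>
    (\<forall>i j. i < m \<longrightarrow> j \<le> d \<longrightarrow> j \<noteq> i \<longrightarrow> insert (d + 1 + i) ({0..d} - {i} - {j}) \<in> multi_stack d m)"
    using assms(1)
  proof (induction m)
    case 0
    have "i \<in> \<Union>{F. F \<subseteq> {0..d} \<and> card F = d}" if "i \<le> d" for i
    proof -
      obtain j where j: "j \<le> d" "j \<noteq> i" using assms(2) by (metis le0 not_numeral_le_zero)
      have "{0..d} - {j} \<in> {F. F \<subseteq> {0..d} \<and> card F = d}" "i \<in> {0..d} - {j}" using that j by auto
      then show ?thesis by blast
    qed
    then have "\<Union>{F. F \<subseteq> {0..d} \<and> card F = d} = {0..d}" by auto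
    then show ?case by (auto intro: stacked_family.base)
  next
    case (Suc m)
    let ?F = "{0..d} - {m}" and ?p = "d + 1 + m"
    have IH: "stacked_family d (multi_stack d m)" "\<Union>(multi_stack d m) = {0..d + m}"
      "\<And>i. m \<le> i \<Longrightarrow> i \<le> d \<Longrightarrow> {0..d} - {i} \<in> multi_stack d m"
      "\<And>i j. i < m \<Longrightarrow> j \<le> d \<Longrightarrow> j \<noteq> i \<Longrightarrow> insert (d + 1 + i) ({0..d} - {i} - {j}) \<in> multi_stack d m" using Suc by auto
    have F: "?F \<in> multi_stack d m" using IH(3)[of m] Suc.prems by simp
    have p: "?p \<notin> \<Union>(multi_stack d m)" unfolding IH(2) by simp
    have 1: "stacked_family d (multi_stack d (Suc m))" using stacked_family.step[OF IH(1) F p] by simp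
    have ff: "facet_family d (multi_stack d m)" using stacked_family_facet_family[OF IH(1)] assms(2) by simp
    have "\<Union>(multi_stack d (Suc m)) = insert ?p {0..d + m}" using Union_stack_family[OF ff F assms(2)] IH(2) by simp
    then have 2: "\<Union>(multi_stack d (Suc m)) = {0..d + Suc m}" by auto
    have 3: "{0..d} - {i} \<in> multi_stack d (Suc m)" if "Suc m \<le> i" "i \<le> d" for i
    proof -
      have "m \<in> {0..d} - {i}" "m \<notin> ?F" using that by auto
      then have "{0..d} - {i} \<noteq> ?F" by blast
      then show ?thesis using IH(3)[of i] that by (simp add: stack_family_def)
    qed
    have 4: "insert (d + 1 + i) ({0..d} - {i} - {j}) \<in> multi_stack d (Suc m)" if ij: "i < Suc m" "j \<le> d" "j \<noteq> i" for i j
    proof (cases "i = m")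
      case True
      have "j \<in> ?F" using ij True by auto
      then show ?thesis unfolding True by (auto simp: stack_family_def)
    next
      case False
      then have "insert (d + 1 + i) ({0..d} - {i} - {j}) \<in> multi_stack d m" using IH(4) ij by auto
      moreover have "insert (d + 1 + i) ({0..d} - {i} - {j}) \<noteq> ?F" by (auto simp: set_eq_iff intro!: exI[of _ "d + 1 + i"])
      ultimately show ?thesis by (simp add: stack_family_def)
    qed
    show ?case using 1 2 3 4 by blast
  qed
  then show "stacked_family d (multi_stack d m)" "\<Union>(multi_stack d m) = {0..d + m}"
    "\<And>i. m \<le> i \<Longrightarrow> i \<le> d \<Longrightarrow> {0..d} - {i} \<in> multi_stack d m"
    "\<And>i j. i < m \<Longrightarrow> j \<le> d \<Longrightarrow> j \<noteq> i \<Longrightarrow> insert (d + 1 + i) ({0..d} - {i} - {j}) \<in> multi_stack d m" by blast+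
qed

lemma independent_from_coeffs:
  fixes v :: "'i \<Rightarrow> 'a::real_vector"
  assumes "finite A" "\<And>c. (\<Sum>i\<in>A. c i *\<^sub>R v i) = 0 \<Longrightarrow> \<forall>i\<in>A. c i = (0::real)"
  shows "inj_on v A" "independent (v ` A)"
proof -
  show inj: "inj_on v A"
  proof (rule inj_onI, rule ccontr)
    fix i j assume ij: "i \<in> A" "j \<in> A" "v i = v j" "i \<noteq> j"
    have "(\<Sum>k\<in>A. (if k = i then 1 else if k = j then - 1 else 0) *\<^sub>R v k) = (\<Sum>k\<in>{i, j}. (if k = i then 1 else if k = j then - 1 else 0) *\<^sub>R v k)"
      using assms(1) ij by (intro sum.mono_neutral_right) auto
    also have "\<dots> = 0" using ij by simp
    finally show False using assms(2)[of "\<lambda>k. if k = i then 1 else if k = j then - 1 else 0"] ij by auto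
  qed
  show "independent (v ` A)"
  proof (rule independent_if_scalars_zero)
    fix f x assume "(\<Sum>x\<in>v ` A. f x *\<^sub>R x) = 0" "x \<in> v ` A"
    then show "f x = 0" using assms(2)[of "\<lambda>i. f (v i)"] inj by (auto simp: sum.reindex)
  qed (use assms(1) in simp)
qed

lemma opposite_signs:
  fixes x y a b :: real
  assumes "x * a + y * b = 0" "a < 0" "b < 0"
  shows "(x > 0 \<longleftrightarrow> y < 0) \<and> (x < 0 \<longleftrightarrow> y > 0)"
proof -
  define q where "q = a / b"
  have "y = - (q * x)" using assms by (simp add: q_def field_simps)
  moreover have "q > 0" using assms by (simp add: q_def divide_neg_neg)
  ultimately show ?thesis by (simp add: zero_less_mult_iff mult_less_0_iff)
qed

lemma lor_causal_sum:
  assumes "finite R" "\<And>l. l \<in> R \<Longrightarrow> lor (x l) (x l) = 0 \<and> fst (x l) > 0 \<and> a l > (0::real)"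
  shows "lor (\<Sum>l\<in>R. a l *\<^sub>R x l) (\<Sum>l\<in>R. a l *\<^sub>R x l) \<le> 0 \<and> fst (\<Sum>l\<in>R. a l *\<^sub>R x l) \<ge> 0"
  using assms
proof (induction R)
  case (insert y R)
  let ?s = "\<Sum>l\<in>R. a l *\<^sub>R x l"
  have s: "lor ?s ?s \<le> 0" "fst ?s \<ge> 0" using insert by auto
  have y: "lor (a y *\<^sub>R x y) (a y *\<^sub>R x y) = 0" "fst (a y *\<^sub>R x y) \<ge> 0" using insert.prems[of y] by (auto simp: lor_simps)
  have "lor (a y *\<^sub>R x y) ?s \<le> 0" using lor_causal_le[of "a y *\<^sub>R x y" ?s] s y by simp
  moreover have "lor (a y *\<^sub>R x y + ?s) (a y *\<^sub>R x y + ?s) = lor (a y *\<^sub>R x y) (a y *\<^sub>R x y) + lor ?s ?s + 2 * lor (a y *\<^sub>R x y) ?s"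
    unfolding lor_simps(1,2) by (simp only: lor_commute[of ?s "a y *\<^sub>R x y"])
  ultimately have "lor (a y *\<^sub>R x y + ?s) (a y *\<^sub>R x y + ?s) \<le> 0" using s y by linarith
  then show ?case using insert s y by simp
qed (simp add: lor_simps)

text \<open>The \<open>k\<close> labels in \<open>G\<close> avoid 0, 1, 2, 3, which is possible
  since \<open>k + 3 \<le> d\<close>. Modulo their span the other simplex vertices become null
  vectors, and the stacked vertices keep their coefficients, so \<open>four_null_vectors\<close>
  applies.\<close>

lemma multi_stack_not_scribed:
  fixes Q :: "(real \<times> (real ^ 'n::finite)) set"
  assumes d: "d = CARD('n)" "k + 3 \<le> d" and Q: "spherical_polytope Q" "spherical_dim Q = int d"
    and iso: "lattice_isomorphic (face_poset (multi_stack d 4)) (spherical_faces Q)" and scr: "scribed k Q"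
  shows False
proof -
  let ?FF = "multi_stack d 4"
  have d3: "4 \<le> d + 1" "d \<ge> 2" using d by auto
  note M = multi_stack_props[OF d3]
  have FF: "facet_family d ?FF" using stacked_family_facet_family[OF M(1)] d3 by simp
  note K = spherical_polytope_cone[OF Q(1)]
  have "\<exists>v n. realizes ?FF v n \<and> convex_cone hull Q = poscone v (\<Union>?FF)"
  proof (rule realizes_from_lattice[OF FF])
    show "lattice_isomorphic (face_poset ?FF) {G. G face_of convex_cone hull Q \<and> G \<noteq> {}}"
      using nonempty_faces_isomorphic[OF K(2)] iso lattice_isomorphic_sym lattice_isomorphic_trans by blast
    show "aff_dim (convex_cone hull Q) = int DIM(real \<times> (real ^ 'n))" using Q(2) d unfolding spherical_dim_def by simp
  qed (use d d3 K convex_cone_convex_cone_hull in auto)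
  then obtain v n where R: "realizes ?FF v n" and Qv: "convex_cone hull Q = poscone v (\<Union>?FF)" by auto
  note RD = realizesD[OF R]
  \<comment> \<open>The facet at the stacked vertex \<open>d + 1 + i\<close> that omits
    \<open>i\<close> and \<open>j\<close>; on the simplex vertices its normal is nonzero only at
    these two.\<close>
  define H where "H i j = insert (d + 1 + i) ({0..d} - {i} - {j})" for i j
  have HF: "H i j \<in> ?FF" if "i < 4" "j \<le> d" "j \<noteq> i" for i j unfolding H_def using M(4) that by blast
  have V: "\<Union>?FF = {0..d + 4}" by (rule M(2))
  define p where "p i = v (d + 1 + i)" for i
  have n0: "n (H i j) \<bullet> v l = 0" if "i < 4" "j \<le> d" "j \<noteq> i" "l \<le> d" "l \<noteq> i" "l \<noteq> j" for i j l
    using RD(1)[OF HF[OF that(1-3)]] that unfolding H_def by auto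
  have np: "n (H i j) \<bullet> p i = 0" if "i < 4" "j \<le> d" "j \<noteq> i" for i j
    using RD(1)[OF HF[OF that]] unfolding H_def p_def by auto
  have ni: "n (H i j) \<bullet> v i < 0" "n (H i j) \<bullet> v j < 0" if "i < 4" "j \<le> d" "j \<noteq> i" for i j
    using RD(2)[OF HF[OF that], of i] RD(2)[OF HF[OF that], of j] that d unfolding V H_def by auto
  have nq: "n (H i j) \<bullet> p m < 0" if "i < 4" "j \<le> d" "j \<noteq> i" "m < 4" "m \<noteq> i" for i j m
    using RD(2)[OF HF[OF that(1-3)], of "d + 1 + m"] that unfolding V H_def p_def by auto
  have nsum: "n (H i j) \<bullet> (\<Sum>l\<in>{0..d}. c l *\<^sub>R v l) = c i * (n (H i j) \<bullet> v i) + c j * (n (H i j) \<bullet> v j)"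
    if "i < 4" "j \<le> d" "j \<noteq> i" for i j c
  proof -
    have "n (H i j) \<bullet> (\<Sum>l\<in>{0..d}. c l *\<^sub>R v l) = (\<Sum>l\<in>{0..d}. c l * (n (H i j) \<bullet> v l))" by (simp add: inner_sum_right)
    also have "\<dots> = (\<Sum>l\<in>{i, j}. c l * (n (H i j) \<bullet> v l))"
      using n0[OF that] that d by (intro sum.mono_neutral_right) auto
    finally show ?thesis using that by simp
  qed
  \<comment> \<open>No facet contains all simplex vertices, so their independence has to be derived.
    The normals of \<open>H i j\<close> give \<open>c 0\<close>, \<open>c 1\<close>,
    \<open>c 2\<close> pairwise opposite signs, so \<open>c 0\<close> and \<open>c 1\<close> vanish;
    the other vertices lie on the facet \<open>H 0 1\<close>.\<close>
  have indep: "inj_on v {0..d}" "independent (v ` {0..d})"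
  proof -
    have "\<forall>i\<in>{0..d}. c i = 0" if c: "(\<Sum>l\<in>{0..d}. c l *\<^sub>R v l) = 0" for c
    proof -
      have opp: "c i * (n (H i j) \<bullet> v i) + c j * (n (H i j) \<bullet> v j) = 0" if "i < 4" "j < 4" "j \<noteq> i" for i j
        using nsum[of i j c] c that d by simp
      have opp2: "(c i > 0 \<longleftrightarrow> c j < 0) \<and> (c i < 0 \<longleftrightarrow> c j > 0)" if "i < 4" "j < 4" "j \<noteq> i" for i j
        using opposite_signs[OF opp[OF that]] ni[of i j] that d by simp
      have "(c 0 > 0 \<longleftrightarrow> c 1 < 0) \<and> (c 0 < 0 \<longleftrightarrow> c 1 > 0)" "(c 0 > 0 \<longleftrightarrow> c 2 < 0) \<and> (c 0 < 0 \<longleftrightarrow> c 2 > 0)"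
        "(c 1 > 0 \<longleftrightarrow> c 2 < 0) \<and> (c 1 < 0 \<longleftrightarrow> c 2 > 0)" by (rule opp2; simp)+
      then have c01: "c 0 = 0" "c 1 = 0" by linarith+
      have fac: "inj_on v (H 0 1)" "independent (v ` H 0 1)" using RD(3,4)[OF HF[of 0 1]] d by auto
      let ?B = "{0..d} - {0} - {1}"
      have B: "?B \<subseteq> H 0 1" unfolding H_def by auto
      have "(\<Sum>l\<in>?B. c l *\<^sub>R v l) = (\<Sum>l\<in>{0..d}. c l *\<^sub>R v l)"
        using c01 by (intro sum.mono_neutral_left) auto
      also have "\<dots> = (\<Sum>l\<in>?B. 0 *\<^sub>R v l)" using c by simp
      finally have eqB: "(\<Sum>l\<in>?B. c l *\<^sub>R v l) = (\<Sum>l\<in>?B. 0 *\<^sub>R v l)" .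
      have iB: "inj_on v ?B" "independent (v ` ?B)"
        using inj_on_subset[OF fac(1) B] independent_mono[OF fac(2) image_mono[OF B]] by auto
      have "c l = 0" if "l \<in> ?B" for l
        using independent_sum_eqD[OF iB _ eqB that] by simp
      then show ?thesis using c01 by (metis Diff_iff singletonD)
    qed
    then show "inj_on v {0..d}" "independent (v ` {0..d})" using independent_from_coeffs[of "{0..d}" v] by auto
  qed
  have "span (v ` {0..d}) = UNIV"
  proof -
    have "card (v ` {0..d}) = DIM(real \<times> (real ^ 'n))" using indep(1) d by (simp add: card_image)
    then show ?thesis using indep(2) by (metis card_eq_dim dim_UNIV finite_atLeastAtMost finite_imageI order_refl subset_UNIV top.extremum_uniqueI)
  qed
  then have "\<exists>b. p i = (\<Sum>l\<in>{0..d}. b l *\<^sub>R v l)" for i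
  proof -
    have "p i \<in> span (v ` {0..d})" using \<open>span (v ` {0..d}) = UNIV\<close> by auto
    then obtain u where "p i = (\<Sum>w\<in>v ` {0..d}. u w *\<^sub>R w)" by (auto simp: span_finite)
    then have "p i = (\<Sum>l\<in>{0..d}. u (v l) *\<^sub>R v l)" using indep(1) by (simp add: sum.reindex)
    then show ?thesis by (rule exI[of _ "\<lambda>l. u (v l)"])
  qed
  then obtain b where b: "\<And>i. p i = (\<Sum>l\<in>{0..d}. b i l *\<^sub>R v l)" by metis
  have bopp: "b i i * (n (H i j) \<bullet> v i) + b i j * (n (H i j) \<bullet> v j) = 0" if "i < 4" "j \<le> d" "j \<noteq> i" for i j
    using nsum[OF that, of "b i"] np[OF that] b[of i] by simp
  \<comment> \<open>\<open>p i\<close> lies beyond the facet opposite to \<open>i\<close>. With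
    coefficient 0 at \<open>i\<close> it would be the zero vector; with a positive one all others
    would be negative, and \<open>p i\<close> would violate the inequality of some
    \<open>H j m\<close>.\<close>
  have bneg: "b i i < 0" if i: "i < 4" for i
  proof (rule ccontr)
    assume "\<not> b i i < 0"
    define j :: nat where "j = (if i = 0 then 1 else 0)"
    \<comment> \<open>A third label besides \<open>i\<close> and \<open>j\<close>; it is at most 3
      and therefore at most \<open>d\<close>.\<close>
    define m :: nat where "m = (if i = 2 \<or> j = 2 then 3 else if i = 1 \<or> j = 1 then 2 else 1)"
    have jm: "j < 4" "j \<noteq> i" "m \<le> d" "m \<noteq> i" "m \<noteq> j" unfolding j_def m_def using d by auto
    have jd: "j \<le> d" "i \<le> d" using jm d i by auto
    consider "b i i = 0" | "b i i > 0" using \<open>\<not> b i i < 0\<close> by linarith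
    then show False
    proof cases
      case 1
      have "b i l = 0" if "l \<le> d" for l using bopp[OF i that] ni[OF i that] 1 by (cases "l = i") auto
      then have "p i = 0" unfolding b by simp
      then show False using nq[OF jm(1) _ _ i, of m] jm by auto
    next
      case 2
      have neg: "b i l < 0" if "l \<le> d" "l \<noteq> i" for l
      proof -
        have "b i i * (n (H i l) \<bullet> v i) < 0" using 2 ni(1)[OF i that] by (simp add: mult_pos_neg)
        then have "b i l * (n (H i l) \<bullet> v l) > 0" using bopp[OF i that] by linarith
        then show ?thesis using ni(2)[OF i that] by (simp add: zero_less_mult_iff)
      qed
      have "n (H j m) \<bullet> p i = b i j * (n (H j m) \<bullet> v j) + b i m * (n (H j m) \<bullet> v m)"
        using nsum[OF jm(1,3,5), of "b i"] b[of i] by simp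
      moreover have "b i j * (n (H j m) \<bullet> v j) > 0" "b i m * (n (H j m) \<bullet> v m) > 0"
        using ni[OF jm(1,3,5)] neg[OF jd(1) jm(2)] neg[OF jm(3,4)] by (auto simp: mult_neg_neg)
      ultimately show False using nq[OF jm(1,3,5) i] jm by auto
    qed
  qed
  define a where "a i l = b i l / (- b i i)" for i l
  have a_eq: "a i j = (n (H i j) \<bullet> v i) / (n (H i j) \<bullet> v j)" if "i < 4" "j \<le> d" "j \<noteq> i" for i j
  proof -
    have 1: "b i i < 0" "n (H i j) \<bullet> v j < 0" using bneg ni(2) that by auto
    then show ?thesis using bopp[OF that] unfolding a_def by (simp add: field_simps)
  qed
  have a_pos: "a i j > 0" if "i < 4" "j \<le> d" "j \<noteq> i" for i j
    unfolding a_eq[OF that] using ni[OF that] by (simp add: divide_neg_neg)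
  \<comment> \<open>Convexity at the ridge without \<open>i\<close> and \<open>j\<close>: the vertex
    \<open>p i\<close> is strictly beneath the facet \<open>H j i\<close> of the neighbouring
    attached simplex.\<close>
  have a_prod: "a i j * a j i > 1" if ij: "i < 4" "j < 4" "i \<noteq> j" for i j
  proof -
    have jd: "j \<le> d" "i \<le> d" using ij d by auto
    have "b i i * (n (H j i) \<bullet> v i) + b i j * (n (H j i) \<bullet> v j) < 0"
      using nsum[OF ij(2) jd(2) ij(3), of "b i"] nq[OF ij(2) jd(2) ij(3) ij(1) ij(3)] b[of i] by simp
    moreover have bij: "b i j = a i j * (- b i i)" unfolding a_def using bneg[OF ij(1)] by simp
    ultimately have "(- b i i) * (a i j * (n (H j i) \<bullet> v j) - (n (H j i) \<bullet> v i)) < 0" by (simp add: algebra_simps)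
    then have "a i j * (n (H j i) \<bullet> v j) < n (H j i) \<bullet> v i" using bneg[OF ij(1)] by (simp add: mult_less_0_iff zero_less_mult_iff)
    then show ?thesis unfolding a_eq[OF ij(2) jd(2) ij(3)] using ni(2)[OF ij(2) jd(2) ij(3)] by (simp add: less_divide_eq)
  qed
  define p' where "p' i = (1 / (- b i i)) *\<^sub>R p i" for i
  have p': "p' i = (\<Sum>l\<in>{0..d} - {i}. a i l *\<^sub>R v l) - v i" if i: "i < 4" for i
  proof -
    have "i \<in> {0..d}" using i d by auto
    have "p' i = (\<Sum>l\<in>{0..d}. a i l *\<^sub>R v l)" unfolding p'_def b a_def by (simp add: scaleR_sum_right)
    also have "\<dots> = a i i *\<^sub>R v i + (\<Sum>l\<in>{0..d} - {i}. a i l *\<^sub>R v l)" using \<open>i \<in> {0..d}\<close> by (simp add: sum.remove)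
    also have "a i i = - 1" unfolding a_def using bneg[OF i] by simp
    finally show ?thesis by simp
  qed
  define G where "G = {4..<4 + k}"
  have G: "G \<subseteq> {0..d}" "finite G" "card G = k" unfolding G_def using d by auto
  define U where "U = span (v ` G)"
  \<comment> \<open>The tangency point of the \<open>k\<close>-face on \<open>insert q G\<close>,
    scaled to coefficient 1 at \<open>q\<close>, represents \<open>v q\<close> modulo
    \<open>U\<close> and is null and orthogonal to \<open>U\<close>.\<close>
  have tang: "\<exists>u\<in>U. lor (v q + u) (v q + u) = 0 \<and> fst (v q + u) > 0 \<and> (\<forall>y\<in>U. lor (v q + u) y = 0)"
    if q: "q \<notin> G" and F: "F \<in> ?FF" "insert q G \<subseteq> F" for q F
  proof -
    let ?A = "insert q G"
    have A: "finite ?A" "inj_on v ?A" "independent (v ` ?A)" "card ?A = k + 1"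
      using G q inj_on_subset[OF RD(3)[OF F(1)] F(2)] independent_mono[OF RD(4)[OF F(1)] image_mono[OF F(2)]] by auto
    have Af: "?A \<in> face_poset ?FF" using F by (auto simp: face_poset_def)
    let ?S = "poscone v ?A \<inter> sphere 0 1"
    have "?S \<in> spherical_faces Q" unfolding spherical_faces_poscone[OF FF R Qv] using Af by blast
    moreover have "spherical_dim ?S = int k" unfolding spherical_dim_def
      using convex_cone_hull_sphere[OF convex_cone_poscone, of v ?A] aff_dim_poscone[OF A(1-3)] A(4) by simp
    ultimately have "tangent_face ?S" using scr unfolding scribed_def by blast
    then obtain c where c: "\<forall>i\<in>?A. c i > 0" "lor (\<Sum>i\<in>?A. c i *\<^sub>R v i) (\<Sum>i\<in>?A. c i *\<^sub>R v i) = 0" "fst (\<Sum>i\<in>?A. c i *\<^sub>R v i) > 0"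
      "\<forall>y\<in>span (v ` ?A). lor (\<Sum>i\<in>?A. c i *\<^sub>R v i) y = 0" using tangent_faceD[OF A(1-3)] by blast
    define u where "u = (1 / c q) *\<^sub>R (\<Sum>i\<in>G. c i *\<^sub>R v i)"
    have cq: "c q > 0" using c(1) by simp
    have x: "v q + u = (1 / c q) *\<^sub>R (\<Sum>i\<in>?A. c i *\<^sub>R v i)"
      unfolding u_def using q G(2) cq by (simp add: scaleR_add_right)
    have "u \<in> U" unfolding u_def U_def by (intro span_scale span_sum) (auto intro: span_base)
    moreover have "U \<subseteq> span (v ` ?A)" unfolding U_def by (intro span_mono) auto
    ultimately have "\<forall>y\<in>U. lor (\<Sum>i\<in>?A. c i *\<^sub>R v i) y = 0" using c(4) by blast
    then have "\<forall>y\<in>U. lor (v q + u) y = 0" unfolding x lor_simps(5) by simp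
    moreover have "lor (v q + u) (v q + u) = 0" unfolding x lor_simps(5,6) c(2) by simp
    moreover have "fst (v q + u) > 0" unfolding x fst_scaleR using c(3) cq by simp
    ultimately show ?thesis using \<open>u \<in> U\<close> by blast
  qed
  have tangv: "\<exists>u\<in>U. lor (v q + u) (v q + u) = 0 \<and> fst (v q + u) > 0 \<and> (\<forall>y\<in>U. lor (v q + u) y = 0)"
    if q: "q \<in> {0..d} - G" for q
  proof -
    \<comment> \<open>Two labels below 4 and different from \<open>q\<close>, so that the facet
      \<open>H i j\<close> contains \<open>q\<close> and all of \<open>G\<close>.\<close>
    define i :: nat where "i = (if q = 0 then 1 else 0)"
    define j :: nat where "j = (if q = 0 \<or> q = 1 then 2 else 1)"
    have ij: "i < 4" "j < 4" "j \<noteq> i" "q \<noteq> i" "q \<noteq> j" "j \<le> d" unfolding i_def j_def using d by auto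
    have "insert q G \<subseteq> H i j" unfolding H_def using q ij G G_def by auto
    then show ?thesis using tang[OF _ HF[OF ij(1,6,3)]] q by auto
  qed
  then obtain u where u: "\<And>q. q \<in> {0..d} - G \<Longrightarrow> u q \<in> U \<and> lor (v q + u q) (v q + u q) = 0 \<and> fst (v q + u q) > 0 \<and> (\<forall>y\<in>U. lor (v q + u q) y = 0)"
    by metis
  define x where "x q = v q + u q" for q
  have x: "lor (x q) (x q) = 0" "fst (x q) > 0" "\<And>y. y \<in> U \<Longrightarrow> lor (x q) y = 0" "u q \<in> U" if "q \<in> {0..d} - G" for q
    using u[OF that] unfolding x_def by auto
  have tangp: "\<exists>w\<in>U. lor (p' i + w) (p' i + w) = 0 \<and> (\<forall>y\<in>U. lor (p' i + w) y = 0)" if i: "i < 4" for i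
  proof -
    define j :: nat where "j = (if i = 0 then 1 else 0)"
    have ij: "j < 4" "j \<noteq> i" "j \<le> d" unfolding j_def using d by auto
    have sub: "insert (d + 1 + i) G \<subseteq> H i j" unfolding H_def using i ij G G_def by auto
    have "d + 1 + i \<notin> G" using G by auto
    then obtain w where w: "w \<in> U" "lor (v (d + 1 + i) + w) (v (d + 1 + i) + w) = 0" "\<forall>y\<in>U. lor (v (d + 1 + i) + w) y = 0"
      using tang[OF _ HF[OF i ij(3,2)] sub] by blast
    have e: "p' i + (1 / (- b i i)) *\<^sub>R w = (1 / (- b i i)) *\<^sub>R (v (d + 1 + i) + w)" unfolding p'_def p_def by (simp add: scaleR_add_right)
    have "(1 / (- b i i)) *\<^sub>R w \<in> U" using w(1) unfolding U_def by (rule span_scale)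
    moreover have "lor (p' i + (1 / (- b i i)) *\<^sub>R w) (p' i + (1 / (- b i i)) *\<^sub>R w) = 0" unfolding e lor_simps(5,6) w(2) by simp
    moreover have "\<forall>y\<in>U. lor (p' i + (1 / (- b i i)) *\<^sub>R w) y = 0" using w(3) unfolding e lor_simps(5) by simp
    ultimately show ?thesis by blast
  qed
  define Rr where "Rr = {4 + k..d}"
  have split: "{0..d} = {0,1,2,3} \<union> G \<union> Rr" unfolding G_def Rr_def using d by auto
  have dj: "{0,1,2,3} \<inter> G = {}" "{0,1,2,3} \<inter> Rr = {}" "G \<inter> Rr = {}" unfolding G_def Rr_def by auto
  have Rsub: "Rr \<subseteq> {0..d} - G" unfolding Rr_def G_def by auto
  have Isub: "{0,1,2,3} \<subseteq> {0..d} - G" unfolding G_def using d by auto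
  \<comment> \<open>The share of the simplex vertices outside \<open>G\<close> and 0, 1, 2, 3;
    \<open>Rr\<close> is empty for \<open>d = k + 3\<close>. As a positive combination of future
    null vectors it is causal.\<close>
  define r where "r i = (\<Sum>l\<in>Rr. a i l *\<^sub>R x l)" for i
  have r: "lor (r i) (r i) \<le> 0" "fst (r i) \<ge> 0" if i: "i < 4" for i
  proof -
    have "lor (x l) (x l) = 0 \<and> fst (x l) > 0 \<and> a i l > 0" if "l \<in> Rr" for l
    proof -
      have "l \<in> {0..d} - G" "l \<noteq> i" using that Rsub i by (auto simp: Rr_def)
      then show ?thesis using x a_pos[OF i, of l] by auto
    qed
    then show "lor (r i) (r i) \<le> 0" "fst (r i) \<ge> 0" unfolding r_def using lor_causal_sum[of Rr x "a i"] by (auto simp: Rr_def)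
  qed
  \<comment> \<open>\<open>y\<close> and the projected apex \<open>p' i + w\<close> differ by some
    \<open>e\<close> in \<open>U\<close>. Both are orthogonal to \<open>U\<close>, so
    \<open>e\<close> is null and orthogonal to both, and \<open>y\<close> inherits norm 0.\<close>
  have null: "lor y y = 0" if i: "i < 4" and y: "y = (\<Sum>l\<in>{0,1,2,3} - {i}. a i l *\<^sub>R x l) - x i + r i" for i y
  proof -
    obtain w where w: "w \<in> U" "lor (p' i + w) (p' i + w) = 0" "\<forall>z\<in>U. lor (p' i + w) z = 0" using tangp[OF i] by blast
    have iI: "i \<in> {0,1,2,3}" using i by auto
    define e where "e = (p' i + w) - y"
    have disj: "{0..d} - {i} = ({0,1,2,3} - {i}) \<union> G \<union> Rr" "({0,1,2,3} - {i}) \<inter> G = {}" "(({0,1,2,3} - {i}) \<union> G) \<inter> Rr = {}"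
    proof -
      have *: "X = I \<union> G \<union> Rr \<Longrightarrow> i \<in> I \<Longrightarrow> I \<inter> G = {} \<Longrightarrow> I \<inter> Rr = {} \<Longrightarrow> G \<inter> Rr = {} \<Longrightarrow>
        X - {i} = (I - {i}) \<union> G \<union> Rr \<and> (I - {i}) \<inter> G = {} \<and> ((I - {i}) \<union> G) \<inter> Rr = {}" for X I by blast
      show "{0..d} - {i} = ({0,1,2,3} - {i}) \<union> G \<union> Rr" "({0,1,2,3} - {i}) \<inter> G = {}" "(({0,1,2,3} - {i}) \<union> G) \<inter> Rr = {}"
        by (rule *[OF split iI dj, THEN conjunct1] *[OF split iI dj, THEN conjunct2, THEN conjunct1]
            *[OF split iI dj, THEN conjunct2, THEN conjunct2])+
    qed
    have "(\<Sum>l\<in>{0..d} - {i}. a i l *\<^sub>R v l) = (\<Sum>l\<in>{0,1,2,3} - {i}. a i l *\<^sub>R v l) + (\<Sum>l\<in>G. a i l *\<^sub>R v l) + (\<Sum>l\<in>Rr. a i l *\<^sub>R v l)"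
    proof -
      have "sum f (({0,1,2,3} - {i}) \<union> G \<union> Rr) = sum f (({0,1,2,3} - {i}) \<union> G) + sum f Rr" for f :: "nat \<Rightarrow> real \<times> (real ^ 'n)"
        by (rule sum.union_disjoint[OF _ _ disj(3)]) (use G(2) in \<open>simp_all add: Rr_def\<close>)
      moreover have "sum f (({0,1,2,3} - {i}) \<union> G) = sum f ({0,1,2,3} - {i}) + sum f G" for f :: "nat \<Rightarrow> real \<times> (real ^ 'n)"
        by (rule sum.union_disjoint[OF _ _ disj(2)]) (use G(2) in simp_all)
      ultimately show ?thesis unfolding disj(1) by simp
    qed
    then have e_eq: "e = w + (\<Sum>l\<in>G. a i l *\<^sub>R v l) + u i - (\<Sum>l\<in>{0,1,2,3} - {i}. a i l *\<^sub>R u l) - (\<Sum>l\<in>Rr. a i l *\<^sub>R u l)"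
      unfolding e_def p'[OF i] y r_def x_def by (simp add: scaleR_add_right sum.distrib)
    have "(\<Sum>l\<in>G. a i l *\<^sub>R v l) \<in> U" unfolding U_def by (intro span_sum span_scale) (auto intro: span_base)
    moreover have "u i \<in> U" using x(4)[of i] iI Isub by blast
    moreover have "(\<Sum>l\<in>{0,1,2,3} - {i}. a i l *\<^sub>R u l) \<in> U" unfolding U_def
      by (intro span_sum span_scale) (use x(4) Isub U_def in blast)
    moreover have "(\<Sum>l\<in>Rr. a i l *\<^sub>R u l) \<in> U" unfolding U_def
      by (intro span_sum span_scale) (use x(4) Rsub U_def in blast)
    ultimately have eU: "e \<in> U" unfolding e_eq using w(1) unfolding U_def by (intro span_add span_diff)
    have ye: "lor y e = 0"
    proof -
      have xe: "lor (x l) e = 0" if "l \<in> {0,1,2,3} \<union> Rr" for l using x(3)[of l e] eU that Isub Rsub by blast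
      have "(\<Sum>l\<in>{0,1,2,3} - {i}. a i l * lor (x l) e) = 0" by (intro sum.neutral ballI) (metis DiffD1 UnI1 xe mult_zero_right)
      moreover have "(\<Sum>l\<in>Rr. a i l * lor (x l) e) = 0" by (intro sum.neutral ballI) (metis UnI2 xe mult_zero_right)
      moreover have "lor (x i) e = 0" using xe iI by blast
      ultimately show ?thesis unfolding y r_def by (simp only: lor_simps lor_sum)
    qed
    have pe: "lor (p' i + w) e = 0" using w(3) eU by blast
    have ee: "lor e e = 0" using pe ye by (simp add: e_def lor_simps)
    have "p' i + w = y + e" unfolding e_def by simp
    then have "lor (y + e) (y + e) = 0" using w(2) by simp
    then show ?thesis using ye ee by (simp add: lor_simps lor_commute[of e y])
  qed
  \<comment> \<open>\<open>x l\<close> agrees with \<open>v l\<close> modulo \<open>U\<close>, so a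
    relation among the \<open>x l\<close> lifts to one among the independent
    \<open>v l\<close>.\<close>
  have xind: "c1 = 0 \<and> c2 = 0 \<and> c3 = 0 \<and> c4 = 0"
    if "c1 *\<^sub>R x 0 + c2 *\<^sub>R x 1 + c3 *\<^sub>R x 2 + c4 *\<^sub>R x 3 = 0" for c1 c2 c3 c4
  proof -
    let ?w = "c1 *\<^sub>R u 0 + c2 *\<^sub>R u 1 + c3 *\<^sub>R u 2 + c4 *\<^sub>R u 3"
    have "u 0 \<in> U" "u 1 \<in> U" "u 2 \<in> U" "u 3 \<in> U" using x(4) Isub by auto
    then have "?w \<in> U" unfolding U_def by (intro span_add span_scale)
    then obtain g where "?w = (\<Sum>z\<in>v ` G. g z *\<^sub>R z)" unfolding U_def using G(2) by (auto simp: span_finite)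
    then have g: "?w = (\<Sum>l\<in>G. g (v l) *\<^sub>R v l)" using inj_on_subset[OF indep(1) G(1)] by (simp add: sum.reindex)
    define cc where "cc l = (if l = 0 then c1 else if l = 1 then c2 else if l = 2 then c3 else if l = 3 then c4 else if l \<in> G then g (v l) else 0)" for l
    have "(\<Sum>l\<in>{0..d}. cc l *\<^sub>R v l) = (\<Sum>l\<in>{0,1,2,3} \<union> G. cc l *\<^sub>R v l)"
      unfolding split using G(2) by (intro sum.mono_neutral_right) (auto simp: cc_def G_def Rr_def)
    also have "\<dots> = (\<Sum>l\<in>{0,1,2,3}. cc l *\<^sub>R v l) + (\<Sum>l\<in>G. cc l *\<^sub>R v l)"
      using G(2) by (intro sum.union_disjoint) (auto simp: G_def)
    also have "(\<Sum>l\<in>G. cc l *\<^sub>R v l) = ?w" unfolding g by (intro sum.cong) (auto simp: cc_def G_def)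
    also have "(\<Sum>l\<in>{0,1,2,3}. cc l *\<^sub>R v l) = c1 *\<^sub>R v 0 + c2 *\<^sub>R v 1 + c3 *\<^sub>R v 2 + c4 *\<^sub>R v 3"
      by (simp add: cc_def add.assoc)
    also have "\<dots> + ?w = c1 *\<^sub>R x 0 + c2 *\<^sub>R x 1 + c3 *\<^sub>R x 2 + c4 *\<^sub>R x 3"
      unfolding x_def by (simp add: scaleR_add_right)
    also have "\<dots> = (\<Sum>l\<in>{0..d}. 0 *\<^sub>R v l)" using that by simp
    finally have fin: "(\<Sum>l\<in>{0..d}. cc l *\<^sub>R v l) = (\<Sum>l\<in>{0..d}. 0 *\<^sub>R v l)" .
    have "cc l = 0" if "l \<in> {0..d}" for l using independent_sum_eqD[OF indep _ fin that] by simp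
    then have "cc 0 = 0" "cc 1 = 0" "cc 2 = 0" "cc 3 = 0" using d by auto
    then show ?thesis by (simp add: cc_def)
  qed
  have I: "0 \<in> {0..d} - G" "1 \<in> {0..d} - G" "2 \<in> {0..d} - G" "3 \<in> {0..d} - G" using Isub by auto
  have dI: "1 \<le> d" "2 \<le> d" "3 \<le> d" using d by auto
  have dif: "{0,1,2,3} - {0} = {1,2,3::nat}" "{0,1,2,3} - {1} = {0,2,3::nat}" "{0,1,2,3} - {2} = {0,1,3::nat}" "{0,1,2,3} - {3} = {0,1,2::nat}" by auto
  show False
  proof (rule four_null_vectors[of "x 0" "x 1" "x 2" "x 3" "r 0" "r 1" "r 2" "r 3" "a 0 1" "a 0 2" "a 0 3" "a 1 0" "a 1 2" "a 1 3" "a 2 0" "a 2 1" "a 2 3" "a 3 0" "a 3 1" "a 3 2"])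
    show "lor (x 0) (x 0) = 0" "lor (x 1) (x 1) = 0" "lor (x 2) (x 2) = 0" "lor (x 3) (x 3) = 0"
      "fst (x 0) > 0" "fst (x 1) > 0" "fst (x 2) > 0" "fst (x 3) > 0" using x I by blast+
    show "lor (r 0) (r 0) \<le> 0" "lor (r 1) (r 1) \<le> 0" "lor (r 2) (r 2) \<le> 0" "lor (r 3) (r 3) \<le> 0"
      "fst (r 0) \<ge> 0" "fst (r 1) \<ge> 0" "fst (r 2) \<ge> 0" "fst (r 3) \<ge> 0" using r by auto
    show "a 0 1 > 0" "a 0 2 > 0" "a 0 3 > 0" "a 1 0 > 0" "a 1 2 > 0" "a 1 3 > 0" "a 2 0 > 0" "a 2 1 > 0" "a 2 3 > 0"
      "a 3 0 > 0" "a 3 1 > 0" "a 3 2 > 0" using a_pos dI by auto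
    show "a 0 1 * a 1 0 > 1" "a 0 2 * a 2 0 > 1" "a 0 3 * a 3 0 > 1" "a 1 2 * a 2 1 > 1" "a 1 3 * a 3 1 > 1" "a 2 3 * a 3 2 > 1"
      using a_prod by auto
    show "lor y y = 0" if "y = a 0 1 *\<^sub>R x 1 + a 0 2 *\<^sub>R x 2 + a 0 3 *\<^sub>R x 3 - x 0 + r 0" for y
      using null[of 0 y] that unfolding dif by (simp add: add.assoc)
    show "lor y y = 0" if "y = a 1 0 *\<^sub>R x 0 + a 1 2 *\<^sub>R x 2 + a 1 3 *\<^sub>R x 3 - x 1 + r 1" for y
      using null[of 1 y] that unfolding dif by (simp add: add.assoc)
    show "lor y y = 0" if "y = a 2 0 *\<^sub>R x 0 + a 2 1 *\<^sub>R x 1 + a 2 3 *\<^sub>R x 3 - x 2 + r 2" for y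
      using null[of 2 y] that unfolding dif by (simp add: add.assoc)
    show "lor y y = 0" if "y = a 3 0 *\<^sub>R x 0 + a 3 1 *\<^sub>R x 1 + a 3 2 *\<^sub>R x 2 - x 3 + r 3" for y
      using null[of 3 y] that unfolding dif by (simp add: add.assoc)
    show "c1 = 0 \<and> c2 = 0 \<and> c3 = 0 \<and> c4 = 0" if "c1 *\<^sub>R x 0 + c2 *\<^sub>R x 1 + c3 *\<^sub>R x 2 + c4 *\<^sub>R x 3 = 0" for c1 c2 c3 c4
      by (rule xind[OF that])
  qed
qed

section \<open>Stacking with prescribed Lorentz norms\<close>

text \<open>Turns a Euclidean normal into a normal for \<open>lor\<close>, the pole of the
  hyperplane. For \<open>lor m m = 0\<close> the pole lies in its hyperplane and gives the point of
  tangency.\<close>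

definition lor_dual :: "real \<times> 'b::euclidean_space \<Rightarrow> real \<times> 'b" where
  "lor_dual x = (- fst x, snd x)"

lemma inner_lor_dual: "m \<bullet> lor_dual x = lor m x" "lor (lor_dual m) x = m \<bullet> x" "lor (lor_dual m) (lor_dual m) = lor m m"
  by (simp_all add: lor_dual_def lor_def inner_prod_def)

text \<open>The span of the face lies in a hyperplane with null pole. No timelike vector is
  orthogonal to a nonzero null vector, and a null vector orthogonal to the pole is parallel to it,
  so the tangency point is unique.\<close>

lemma tangent_faceI:
  fixes v :: "'i \<Rightarrow> real \<times> (real ^ 'n::finite)"
  assumes A: "finite A" and m: "lor m m = 0" "fst m < 0" "\<And>i. i \<in> A \<Longrightarrow> m \<bullet> v i = 0"
    and c: "lor_dual m = (\<Sum>i\<in>A. c i *\<^sub>R v i)" "\<And>i. i \<in> A \<Longrightarrow> c i > 0"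
  shows "tangent_face (poscone v A \<inter> sphere 0 1)"
proof -
  let ?F = "poscone v A \<inter> sphere 0 1" and ?x = "(1 / norm (lor_dual m)) *\<^sub>R lor_dual m"
  have hull: "convex_cone hull ?F = poscone v A" by (rule convex_cone_hull_sphere) (rule convex_cone_poscone)
  have fd: "fst (lor_dual m) > 0" using m(2) by (simp add: lor_dual_def)
  then have nd: "norm (lor_dual m) > 0" by auto
  have orth: "m \<bullet> y = 0" if "y \<in> span (v ` A)" for y
    using that by (induction rule: span_induct) (auto simp: subspace_hyperplane m(3))
  have spanF: "span ?F \<subseteq> span (v ` A)"
    using poscone_subset_span[of v A] by (intro span_minimal) auto
  have xr: "?x \<in> rel_interior (poscone v A)"
    by (rule rel_interior_posconeI[OF A, of "\<lambda>i. c i / norm (lor_dual m)"])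
      (use c nd in \<open>auto simp: scaleR_sum_right\<close>)
  have xb: "?x \<in> cap_boundary" unfolding cap_boundary_iff
    using nd fd m(1) by (simp add: lor_simps inner_lor_dual)
  have uniq: "y = ?x" if y: "y \<in> rel_interior (poscone v A)" "y \<in> cap_boundary" for y
  proof -
    have yb: "norm y = 1" "fst y \<ge> 0" "lor y y = 0" using y(2) unfolding cap_boundary_iff by auto
    have "y \<in> span (v ` A)" using y(1) rel_interior_subset poscone_subset_span by blast
    then have "lor (lor_dual m) y = 0" using orth by (simp add: inner_lor_dual)
    then have par: "fst (lor_dual m) *\<^sub>R y = fst y *\<^sub>R lor_dual m"
      using lor_null_parallel[of "lor_dual m" y] fd m(1) yb by (simp add: inner_lor_dual)
    then have "norm (fst (lor_dual m) *\<^sub>R y) = norm (fst y *\<^sub>R lor_dual m)" by simp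
    then have f: "fst (lor_dual m) = fst y * norm (lor_dual m)" using fd yb by simp
    then have "fst y \<noteq> 0" using fd by auto
    have "fst y *\<^sub>R (norm (lor_dual m) *\<^sub>R y) = fst y *\<^sub>R lor_dual m" using par unfolding f by simp
    then have "norm (lor_dual m) *\<^sub>R y = lor_dual m" using \<open>fst y \<noteq> 0\<close> by (metis scaleR_cancel_left)
    then have "(1 / norm (lor_dual m)) *\<^sub>R (norm (lor_dual m) *\<^sub>R y) = ?x" by simp
    then show ?thesis using nd by simp
  qed
  have "spherical_relint ?F \<inter> cap_boundary = {?x}"
  proof (intro subset_antisym subsetI)
    fix y assume "y \<in> spherical_relint ?F \<inter> cap_boundary"
    then show "y \<in> {?x}" using uniq unfolding spherical_relint_def hull by auto
  next
    fix y assume "y \<in> {?x}"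
    then have "y = ?x" by simp
    then show "y \<in> spherical_relint ?F \<inter> cap_boundary" using xr xb unfolding spherical_relint_def hull by (simp add: cap_boundary_iff)
  qed
  moreover have "spherical_span ?F \<inter> cap_interior = {}"
  proof (rule ccontr)
    assume "spherical_span ?F \<inter> cap_interior \<noteq> {}"
    then obtain y where y: "y \<in> span ?F" "y \<in> cap_interior" unfolding spherical_span_def by auto
    have "lor y y < 0" using cap_interiorD(3)[OF y(2)] .
    moreover have "m \<bullet> y = 0" using orth y(1) spanF by blast
    then have "lor y (lor_dual m) = 0" using inner_lor_dual(2)[of m y] lor_commute[of y] by simp
    moreover have "lor_dual m \<noteq> 0" using nd by auto
    ultimately have "lor (lor_dual m) (lor_dual m) > 0" using lor_orthogonal_timelike by blast
    then show False using m(1) by (simp add: inner_lor_dual)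
  qed
  ultimately show ?thesis unfolding tangent_face_def by blast
qed

text \<open>\<open>q F\<close> is the apex of the simplex of the stacking behind the facet \<open>F\<close>, and \<open>c F j\<close> is the normal of
  the facet of that simplex opposite to \<open>j\<close>.\<close>

definition lorentz_config :: "'i set set \<Rightarrow> ('i \<Rightarrow> real \<times> (real ^ 'n::finite)) \<Rightarrow> ('i set \<Rightarrow> real \<times> (real ^ 'n)) \<Rightarrow>
    ('i set \<Rightarrow> 'i) \<Rightarrow> ('i set \<Rightarrow> 'i \<Rightarrow> real \<times> (real ^ 'n)) \<Rightarrow> bool" where
  "lorentz_config FF v n q c \<longleftrightarrow> realizes FF v n \<and> (1, 0) \<in> poscone v (\<Union>FF) \<and>
     (\<forall>F\<in>FF. q F \<in> \<Union>FF - F \<and>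
        (\<forall>j\<in>F. c F j \<bullet> v (q F) = 0 \<and> c F j \<bullet> v j < 0 \<and> (\<forall>i\<in>F. i \<noteq> j \<longrightarrow> c F j \<bullet> v i = 0))) \<and>
     (\<forall>F\<in>FF. \<forall>G\<in>FF. F \<noteq> G \<longrightarrow> lor (n F) (n G) < 0)"

lemma lorentz_configD:
  assumes "lorentz_config FF v n q c"
  shows "realizes FF v n" "(1, 0) \<in> poscone v (\<Union>FF)" "\<And>F. F \<in> FF \<Longrightarrow> q F \<in> \<Union>FF" "\<And>F. F \<in> FF \<Longrightarrow> q F \<notin> F"
    "\<And>F j. F \<in> FF \<Longrightarrow> j \<in> F \<Longrightarrow> c F j \<bullet> v (q F) = 0" "\<And>F j. F \<in> FF \<Longrightarrow> j \<in> F \<Longrightarrow> c F j \<bullet> v j < 0"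
    "\<And>F j i. F \<in> FF \<Longrightarrow> j \<in> F \<Longrightarrow> i \<in> F \<Longrightarrow> i \<noteq> j \<Longrightarrow> c F j \<bullet> v i = 0"
    "\<And>F G. F \<in> FF \<Longrightarrow> G \<in> FF \<Longrightarrow> F \<noteq> G \<Longrightarrow> lor (n F) (n G) < 0"
  using assms unfolding lorentz_config_def by auto

text \<open>If \<open>m\<close> is the normal of another facet, then \<open>m = (\<Sum>j\<in>F. \<alpha> j *\<^sub>R c F j) + \<gamma> *\<^sub>R n F\<close> with nonnegative
  coefficients, and \<open>lor m (n F) < 0\<close> says that \<open>\<gamma>\<close> is small compared with the \<open>\<alpha> j\<close>. The new vertex \<open>x\<close>
  satisfies \<open>m \<bullet> x = \<gamma> - (\<Sum>j\<in>F. \<alpha> j * a j)\<close>.\<close>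

lemma lorentz_config_stack:
  fixes v :: "'i \<Rightarrow> real \<times> (real ^ 'n::finite)"
  assumes FF: "facet_family d FF" and d: "d = CARD('n)" "d \<ge> 2" and L: "lorentz_config FF v n q c"
    and F: "F \<in> FF" and p: "p \<notin> \<Union>FF"
    and eps: "lor (n F) (n F) > 0"
    and g: "\<And>j. j \<in> F \<Longrightarrow> lor (n F) (c F j) < 0" "\<And>j k. j \<in> F \<Longrightarrow> k \<in> F \<Longrightarrow> j \<noteq> k \<Longrightarrow> lor (c F j) (c F k) < 0"
      "\<And>j. j \<in> F \<Longrightarrow> lor (n F) (n F) * lor (c F j) (c F j) \<le> (lor (n F) (c F j))\<^sup>2"
    and a: "\<And>j. j \<in> F \<Longrightarrow> a j * lor (n F) (n F) > - lor (n F) (c F j)"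
    and m: "\<And>j. m j = c F j + a j *\<^sub>R n F"
    and mm: "\<And>j k. j \<in> F \<Longrightarrow> k \<in> F \<Longrightarrow> j \<noteq> k \<Longrightarrow> lor (m j) (m k) < 0"
  shows "\<exists>v' n' q' c'. lorentz_config (stack_family FF F p) v' n' q' c' \<and>
    (\<forall>G\<in>FF - {F}. n' G = n G \<and> c' G = c G) \<and>
    (\<forall>j\<in>F. n' (insert p (F - {j})) = m j \<and> c' (insert p (F - {j})) = (\<lambda>k. if k = p then - n F else m k))"
proof -
  note D = facet_familyD[OF FF]
  note LD = lorentz_configD[OF L]
  note RD = realizesD[OF LD(1)]
  have finF: "finite F" "card F = d" "p \<notin> F" using D F p by auto
  let ?\<epsilon> = "lor (n F) (n F)"
  let ?w = "v (q F)"
  have nw: "n F \<bullet> ?w < 0" by (rule RD(2)[OF F LD(3)[OF F] LD(4)[OF F]])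
  have cv: "c F j \<bullet> v j < 0" if "j \<in> F" for j using LD(6)[OF F that] .
  have sp: "span (insert ?w (v ` F)) = UNIV"
    using facet_spans(3)[OF RD(3,4)[OF F] finF(1), of "n F" ?w] finF d RD(1)[OF F] nw by simp
  \<comment> \<open>Solves \<open>n F \<bullet> x = 1\<close> and
    \<open>c F j \<bullet> x = - a j\<close>, so that all \<open>m j\<close> vanish at
    \<open>x\<close>. It is explicit because the rays \<open>?w\<close> and \<open>v j\<close> are
    dual to the normals up to scaling.\<close>
  define x where "x = (1 / (n F \<bullet> ?w)) *\<^sub>R ?w - (\<Sum>j\<in>F. (a j / (c F j \<bullet> v j)) *\<^sub>R v j)"
  have nx: "n F \<bullet> x = 1" unfolding x_def using nw RD(1)[OF F] by (simp add: inner_diff_right inner_sum_right)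
  have cx: "c F j \<bullet> x = - a j" if j: "j \<in> F" for j
  proof -
    have "(\<Sum>i\<in>F. (a i / (c F i \<bullet> v i)) * (c F j \<bullet> v i)) = (a j / (c F j \<bullet> v j)) * (c F j \<bullet> v j)"
      using finF(1) j LD(7)[OF F j] by (subst sum.remove[OF _ j]) auto
    then show ?thesis unfolding x_def using LD(5)[OF F j] cv[OF j] by (simp add: inner_diff_right inner_sum_right)
  qed
  have mx: "m j \<bullet> x = 0" if "j \<in> F" for j unfolding m using cx[OF that] nx by (simp add: inner_add_left)
  have mv: "m j \<bullet> v i = 0" if "j \<in> F" "i \<in> F" "i \<noteq> j" for i j
    unfolding m using LD(7)[OF F that] RD(1)[OF F that(2)] by (simp add: inner_add_left)
  have mv': "m j \<bullet> v j < 0" if "j \<in> F" for j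
    unfolding m using cv[OF that] RD(1)[OF F that] by (simp add: inner_add_left)
  have G: "n G \<bullet> x < 0 \<and> (\<forall>j\<in>F. lor (n G) (m j) < 0)" if G: "G \<in> FF" "G \<noteq> F" for G
  proof -
    have le: "n G \<bullet> v i \<le> 0" if "i \<in> \<Union>FF" for i
      using RD(1,2)[OF G(1)] that by (cases "i \<in> G") (auto intro: less_imp_le)
    \<comment> \<open>The coefficients of \<open>n G\<close> in the basis of the normals of the
      simplex behind \<open>F\<close>, read off at its vertices, where all but one of these normals
      vanish.\<close>
    define \<gamma> where "\<gamma> = (n G \<bullet> ?w) / (n F \<bullet> ?w)"
    define \<alpha> where "\<alpha> j = (n G \<bullet> v j) / (c F j \<bullet> v j)" for j
    have \<gamma>: "\<gamma> \<ge> 0" unfolding \<gamma>_def using nw le[OF LD(3)[OF F]] by (simp add: divide_nonpos_neg)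
    have \<alpha>: "\<alpha> j \<ge> 0" if "j \<in> F" for j unfolding \<alpha>_def using cv[OF that] le[of j] that F by (intro divide_nonpos_neg) auto
    have "n G - ((\<Sum>j\<in>F. \<alpha> j *\<^sub>R c F j) + \<gamma> *\<^sub>R n F) = 0"
    proof (rule spanning_inner_zero[OF sp])
      fix y assume "y \<in> insert ?w (v ` F)"
      then consider "y = ?w" | i where "i \<in> F" "y = v i" by auto
      then show "(n G - ((\<Sum>j\<in>F. \<alpha> j *\<^sub>R c F j) + \<gamma> *\<^sub>R n F)) \<bullet> y = 0"
      proof cases
        case 1
        then show ?thesis using LD(5)[OF F] nw by (simp add: inner_diff_left inner_add_left inner_sum_left \<gamma>_def)
      next
        case 2
        have "(\<Sum>j\<in>F - {i}. \<alpha> j * (c F j \<bullet> v i)) = 0"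
          by (intro sum.neutral ballI) (metis DiffE LD(7)[OF F _ 2(1)] insertI1 mult_zero_right)
        then have "(\<Sum>j\<in>F. \<alpha> j * (c F j \<bullet> v i)) = \<alpha> i * (c F i \<bullet> v i)"
          unfolding sum.remove[OF finF(1) 2(1)] by simp
        then show ?thesis using 2 cv[OF 2(1)] RD(1)[OF F 2(1)]
          by (simp add: inner_diff_left inner_add_left inner_sum_left \<alpha>_def)
      qed
    qed
    then have nG: "n G = (\<Sum>j\<in>F. \<alpha> j *\<^sub>R c F j) + \<gamma> *\<^sub>R n F" by simp
    define T where "T = (\<Sum>k\<in>F. \<alpha> k * (- lor (n F) (c F k)))"
    have lorF: "lor (n G) (n F) = \<gamma> * ?\<epsilon> - T"
      unfolding nG T_def by (simp add: lor_simps lor_sum sum_negf lor_commute)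
    then have T: "\<gamma> * ?\<epsilon> < T" using LD(8)[OF G(1) F G(2)] by simp
    have "n G \<bullet> x = \<gamma> - (\<Sum>j\<in>F. \<alpha> j * a j)" unfolding nG using nx cx by (simp add: inner_add_left inner_sum_left sum_negf)
    moreover have "T \<le> (\<Sum>j\<in>F. \<alpha> j * a j) * ?\<epsilon>"
      unfolding T_def sum_distrib_right mult.assoc
      by (intro sum_mono mult_left_mono) (use \<alpha> a in \<open>auto intro: less_imp_le\<close>)
    then have "\<gamma> < (\<Sum>j\<in>F. \<alpha> j * a j)" using T eps by (smt (verit) mult_less_cancel_right_pos)
    ultimately have 1: "n G \<bullet> x < 0" by simp
    have 2: "lor (n G) (m j) < 0" if j: "j \<in> F" for j
    proof -
      let ?gj = "- lor (n F) (c F j)"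
      have gj: "?gj > 0" using g(1)[OF j] by simp
      have aj: "a j * ?\<epsilon> > ?gj" using a[OF j] .
      have "lor (n G) (c F j) = (\<Sum>k\<in>F. \<alpha> k * lor (c F k) (c F j)) - \<gamma> * ?gj"
        unfolding nG by (simp add: lor_simps lor_sum)
      also have "(\<Sum>k\<in>F. \<alpha> k * lor (c F k) (c F j)) = \<alpha> j * lor (c F j) (c F j) + (\<Sum>k\<in>F - {j}. \<alpha> k * lor (c F k) (c F j))"
        using finF(1) j by (simp add: sum.remove)
      finally have l1: "lor (n G) (c F j) = \<alpha> j * lor (c F j) (c F j) + (\<Sum>k\<in>F - {j}. \<alpha> k * lor (c F k) (c F j)) - \<gamma> * ?gj" .
      have l2: "(\<Sum>k\<in>F - {j}. \<alpha> k * lor (c F k) (c F j)) \<le> 0"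
      proof (intro sum_nonpos mult_nonneg_nonpos)
        fix k assume "k \<in> F - {j}"
        then show "0 \<le> \<alpha> k" "lor (c F k) (c F j) \<le> 0" using \<alpha>[of k] g(2)[OF _ j, of k] by auto
      qed
      have "lor (n G) (m j) = lor (n G) (c F j) + a j * (\<gamma> * ?\<epsilon> - T)" unfolding m lor_simps lorF ..
      then have "lor (n G) (m j) \<le> (\<alpha> j * lor (c F j) (c F j) - \<gamma> * ?gj) + a j * (\<gamma> * ?\<epsilon> - T)"
        using l1 l2 by linarith
      \<comment> \<open>Multiplied by \<open>?\<epsilon>\<close>, the bound
        \<open>a j * ?\<epsilon> > ?gj\<close> can be used against the negative factor
        \<open>\<gamma> * ?\<epsilon> - T\<close>. The terms with \<open>\<gamma>\<close> cancel,
        and \<open>T \<ge> \<alpha> j * ?gj\<close> together with \<open>g(3)\<close> settles the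
        sign.\<close>
      then have "lor (n G) (m j) * ?\<epsilon> \<le> ((\<alpha> j * lor (c F j) (c F j) - \<gamma> * ?gj) + a j * (\<gamma> * ?\<epsilon> - T)) * ?\<epsilon>"
        using eps by (intro mult_right_mono) auto
      also have "\<dots> = (\<alpha> j * lor (c F j) (c F j) - \<gamma> * ?gj) * ?\<epsilon> + (a j * ?\<epsilon>) * (\<gamma> * ?\<epsilon> - T)"
        by (simp add: algebra_simps)
      also have "(a j * ?\<epsilon>) * (\<gamma> * ?\<epsilon> - T) < ?gj * (\<gamma> * ?\<epsilon> - T)" using aj T by (intro mult_strict_right_mono_neg) auto
      also have "(\<alpha> j * lor (c F j) (c F j) - \<gamma> * ?gj) * ?\<epsilon> + ?gj * (\<gamma> * ?\<epsilon> - T) = \<alpha> j * (?\<epsilon> * lor (c F j) (c F j)) - ?gj * T"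
        by (simp add: algebra_simps)
      also have "?gj * T \<ge> ?gj * (\<alpha> j * ?gj)"
      proof -
        have "\<alpha> j * ?gj \<le> T" unfolding T_def by (rule member_le_sum[OF j]) (use \<alpha> g(1) finF(1) in \<open>auto intro!: mult_nonneg_nonpos intro: less_imp_le\<close>)
        then show ?thesis using gj by (intro mult_left_mono) auto
      qed
      then have "\<alpha> j * (?\<epsilon> * lor (c F j) (c F j)) - ?gj * T \<le> \<alpha> j * (?\<epsilon> * lor (c F j) (c F j) - (lor (n F) (c F j))\<^sup>2)"
        by (simp add: algebra_simps power2_eq_square)
      also have "\<dots> \<le> 0" using \<alpha>[OF j] g(3)[OF j] by (intro mult_nonneg_nonpos) auto
      finally show ?thesis using eps by (simp add: mult_less_0_iff)
    qed
    show ?thesis using 1 2 by blast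
  qed
  define jj where "jj H = (THE j. j \<in> F \<and> H = insert p (F - {j}))" for H
  define n' where "n' H = (if H \<in> FF then n H else m (jj H))" for H
  \<comment> \<open>Behind a new facet lies the new simplex, with the dropped vertex
    \<open>j\<close> as apex; its facet opposite to \<open>p\<close> is \<open>F\<close> seen from
    the other side, which explains \<open>- n F\<close> in \<open>c'\<close>.\<close>
  define q' where "q' H = (if H \<in> FF then q H else jj H)" for H
  define c' where "c' H = (if H \<in> FF then c H else (\<lambda>k. if k = p then - n F else m k))" for H
  define v' where "v' = v(p := x)"
  have jj: "jj (insert p (F - {j})) = j" "insert p (F - {j}) \<notin> FF" if "j \<in> F" for j
    unfolding jj_def using that finF(3) p by (auto intro!: the_equality)
  have n'F: "n' (insert p (F - {j})) = m j" "q' (insert p (F - {j})) = j" "c' (insert p (F - {j})) = (\<lambda>k. if k = p then - n F else m k)"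
    if "j \<in> F" for j unfolding n'_def q'_def c'_def using jj[OF that] by auto
  have n'G: "n' H = n H" "q' H = q H" "c' H = c H" if "H \<in> FF" for H unfolding n'_def q'_def c'_def using that by auto
  have V': "\<Union>(stack_family FF F p) = insert p (\<Union>FF)" by (rule Union_stack_family[OF FF F d(2)])
  have v'V: "v' i = v i" if "i \<in> \<Union>FF" for i using that p unfolding v'_def by auto
  have v'p: "v' p = x" unfolding v'_def by simp
  have R': "realizes (stack_family FF F p) v' n'"
    unfolding v'_def by (rule realizes_stack[OF FF LD(1) _ d(2) F p, where m = m]) (use d nx G mx mv mv' n'F n'G in auto)
  have cases: "(\<exists>j\<in>F. H = insert p (F - {j})) \<or> (H \<in> FF \<and> H \<noteq> F)" if "H \<in> stack_family FF F p" for H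
    using that by (auto simp: stack_family_def)
  have "lorentz_config (stack_family FF F p) v' n' q' c'"
    unfolding lorentz_config_def
  proof (intro conjI ballI impI)
    show "realizes (stack_family FF F p) v' n'" by (rule R')
    have "poscone v (\<Union>FF) = poscone v' (\<Union>FF)" unfolding poscone_def using v'V by (metis (no_types, lifting) sum.cong)
    then show "(1, 0) \<in> poscone v' (\<Union>(stack_family FF F p))"
      using LD(2) poscone_mono[of "\<Union>FF" "insert p (\<Union>FF)" v'] D(6) unfolding V' by blast
  next
    fix H assume H: "H \<in> stack_family FF F p"
    show "q' H \<in> \<Union>(stack_family FF F p) - H"
      using cases[OF H]
    proof
      assume "\<exists>j\<in>F. H = insert p (F - {j})"
      then obtain j where j: "j \<in> F" "H = insert p (F - {j})" by auto
      have "j \<noteq> p" using j finF(3) by auto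
      then show ?thesis unfolding V' j(2) n'F(2)[OF j(1)] using j(1) F by auto
    next
      assume "H \<in> FF \<and> H \<noteq> F"
      then show ?thesis unfolding V' using n'G(2) LD(3,4) by auto
    qed
    fix j assume j: "j \<in> H"
    have "c' H j \<bullet> v' (q' H) = 0 \<and> c' H j \<bullet> v' j < 0 \<and> (\<forall>i\<in>H. i \<noteq> j \<longrightarrow> c' H j \<bullet> v' i = 0)"
      using cases[OF H]
    proof
      assume "\<exists>k\<in>F. H = insert p (F - {k})"
      then obtain k where k: "k \<in> F" "H = insert p (F - {k})" by auto
      have v'F: "v' i = v i" if "i \<in> F" for i using v'V[of i] that F by auto
      have "q' H = k" "c' H j = (if j = p then - n F else m j)" using n'F[OF k(1)] k(2) by auto
      then show ?thesis
      proof (cases "j = p")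
        case True
        then show ?thesis using \<open>q' H = k\<close> \<open>c' H j = _\<close> v'F k RD(1)[OF F] v'p nx by auto
      next
        case False
        then have "j \<in> F" "j \<noteq> k" using j k by auto
        then show ?thesis using False \<open>q' H = k\<close> \<open>c' H j = _\<close> v'F k mv mv' mx v'p by auto
      qed
    next
      assume "H \<in> FF \<and> H \<noteq> F"
      then have H': "H \<in> FF" by simp
      have v'H: "v' i = v i" if "i \<in> H" for i using v'V[of i] that H' by auto
      have "v' (q H) = v (q H)" using v'V LD(3)[OF H'] by blast
      then show ?thesis using n'G[OF H'] LD(5-7)[OF H'] j v'H by auto
    qed
    then show "c' H j \<bullet> v' (q' H) = 0" "c' H j \<bullet> v' j < 0" "\<And>i. i \<in> H \<Longrightarrow> i \<noteq> j \<Longrightarrow> c' H j \<bullet> v' i = 0" by blast+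
  next
    fix H K assume H: "H \<in> stack_family FF F p" and K: "K \<in> stack_family FF F p" and ne: "H \<noteq> K"
    have mixed: "lor (n' K) (n' (insert p (F - {j}))) < 0" if "K \<in> FF \<and> K \<noteq> F" "j \<in> F" for j K
      using that G n'F n'G by simp
    show "lor (n' H) (n' K) < 0"
      using cases[OF H]
    proof
      assume "\<exists>j\<in>F. H = insert p (F - {j})"
      then obtain j where j: "j \<in> F" "H = insert p (F - {j})" by auto
      show ?thesis using cases[OF K]
      proof
        assume "\<exists>k\<in>F. K = insert p (F - {k})"
        then obtain k where k: "k \<in> F" "K = insert p (F - {k})" by auto
        then have "j \<noteq> k" using j ne by auto
        then show ?thesis using j k mm n'F by simp
      next
        assume "K \<in> FF \<and> K \<noteq> F"
        then show ?thesis using mixed j by (simp add: lor_commute)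
      qed
    next
      assume H': "H \<in> FF \<and> H \<noteq> F"
      show ?thesis using cases[OF K]
      proof
        assume "\<exists>k\<in>F. K = insert p (F - {k})"
        then show ?thesis using mixed H' by auto
      next
        assume "K \<in> FF \<and> K \<noteq> F"
        then show ?thesis using LD(8) ne n'G H' by simp
      qed
    qed
  qed
  then show ?thesis using n'F n'G by (intro exI[of _ v'] exI[of _ n'] exI[of _ q'] exI[of _ c']) auto
qed

section \<open>Simplices whose normals have prescribed Lorentz products\<close>

lemma regular_simplex_exists:
  assumes "d = CARD('n::finite)"
  shows "\<exists>u :: nat \<Rightarrow> real ^ 'n. \<forall>i\<in>{0..d}. \<forall>j\<in>{0..d}. u i \<bullet> u j = (if i = j then 1 else - 1 / real d)"
proof -
  have d: "real d > 0" using assms by (simp add: zero_less_card_finite)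
  have "card {1..d} = card (UNIV :: 'n set)" using assms by simp
  then obtain h where h: "bij_betw h {1..d} (UNIV :: 'n set)"
    using finite_same_card_bij[of "{1..d}" "UNIV :: 'n set"] by auto
  define one :: "real ^ 'n" where "one = (\<chi> i. 1)"
  have oo: "one \<bullet> one = real d" unfolding one_def inner_vec_def using assms by simp
  have oa: "one \<bullet> axis k 1 = 1" "axis k 1 \<bullet> one = 1" for k :: 'n
    unfolding one_def by (simp_all add: inner_axis inner_axis')
  have aa: "(axis k 1 :: real ^ 'n) \<bullet> axis l 1 = (if k = l then 1 else 0)" for k l :: 'n
    by (simp add: inner_axis_axis)
  \<comment> \<open>One vertex is \<open>- r *\<^sub>R one\<close>, the others are
    \<open>\<alpha> *\<^sub>R axis k 1 + \<beta> *\<^sub>R one\<close>. The products with the first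
    vertex require \<open>\<alpha> + real d * \<beta> = r\<close>, those among the others determine
    \<open>\<alpha>\<close>.\<close>
  define r where "r = 1 / sqrt (real d)"
  have r2: "r * r = 1 / real d" unfolding r_def using d by simp
  define \<alpha> where "\<alpha> = sqrt ((real d + 1) / real d)"
  have \<alpha>2: "\<alpha> * \<alpha> = (real d + 1) / real d" unfolding \<alpha>_def using d by simp
  define \<beta> where "\<beta> = (r - \<alpha>) / real d"
  have \<beta>d: "real d * \<beta> = r - \<alpha>" unfolding \<beta>_def using d by simp
  have b1: "2 * \<alpha> * \<beta> + real d * \<beta> * \<beta> = - 1 / real d"
  proof -
    have "real d * (2 * \<alpha> * \<beta> + real d * \<beta> * \<beta>) = 2 * \<alpha> * (real d * \<beta>) + (real d * \<beta>) * (real d * \<beta>)" by (simp add: algebra_simps)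
    also have "\<dots> = r * r - \<alpha> * \<alpha>" unfolding \<beta>d by (simp add: algebra_simps)
    also have "\<dots> = real d * (- 1 / real d)" unfolding r2 \<alpha>2 using d by (simp add: field_simps)
    finally have "real d * (2 * \<alpha> * \<beta> + real d * \<beta> * \<beta>) = real d * (- 1 / real d)" .
    then show ?thesis using d by (metis mult_left_cancel less_irrefl)
  qed
  define u where "u i = (if i = 0 then - r *\<^sub>R one else \<alpha> *\<^sub>R axis (h i) 1 + \<beta> *\<^sub>R one)" for i :: nat
  have "u i \<bullet> u j = (if i = j then 1 else - 1 / real d)" if ij: "i \<in> {0..d}" "j \<in> {0..d}" for i j
  proof -
    have hinj: "h i = h j \<longleftrightarrow> i = j" if "i \<noteq> 0" "j \<noteq> 0"
      using h ij that unfolding bij_betw_def inj_on_def by (metis atLeastAtMost_iff less_one not_le)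
    have 0: "(- r *\<^sub>R one) \<bullet> (- r *\<^sub>R one) = 1" using r2 oo d by (simp add: mult.assoc[symmetric])
    have 1: "(- r *\<^sub>R one) \<bullet> (\<alpha> *\<^sub>R axis k 1 + \<beta> *\<^sub>R one) = - 1 / real d" for k
    proof -
      have "(- r *\<^sub>R one) \<bullet> (\<alpha> *\<^sub>R axis k 1 + \<beta> *\<^sub>R one) = - (r * (\<alpha> + real d * \<beta>))"
        by (simp add: inner_add_right oa oo algebra_simps)
      then show ?thesis unfolding \<beta>d using r2 by simp
    qed
    have 2: "(\<alpha> *\<^sub>R axis k 1 + \<beta> *\<^sub>R one) \<bullet> (\<alpha> *\<^sub>R axis l 1 + \<beta> *\<^sub>R one) = (if k = l then 1 else - 1 / real d)" for k l
    proof -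
      have "(\<alpha> *\<^sub>R axis k 1 + \<beta> *\<^sub>R one) \<bullet> (\<alpha> *\<^sub>R axis l 1 + \<beta> *\<^sub>R one) = (if k = l then \<alpha> * \<alpha> else 0) + (2 * \<alpha> * \<beta> + real d * \<beta> * \<beta>)"
        by (simp add: inner_add_left inner_add_right oa oo aa algebra_simps)
      moreover have "(real d + 1) / real d + - 1 / real d = 1" using d by (simp add: field_simps)
      ultimately show ?thesis unfolding b1 \<alpha>2 by (cases "k = l") simp_all
    qed
    have 3: "(\<alpha> *\<^sub>R axis k 1 + \<beta> *\<^sub>R one) \<bullet> (- r *\<^sub>R one) = - 1 / real d" for k using 1 by (metis inner_commute)
    show ?thesis unfolding u_def using 0 1 2 3 hinj by (simp split: if_split)
  qed
  then show ?thesis by blast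
qed

text \<open>Models the vectors \<open>sqrt lam *\<^sub>R (- t i, u i)\<close> with \<open>u\<close>
  a regular simplex: in the chart \<open>x\<^sub>0 = 1\<close> facet \<open>i\<close> has distance
  \<open>t i\<close> from the centre. The \<open>t i\<close> tune the individual norms,
  \<open>lam\<close> the common scale.\<close>

definition normal_frame :: "nat \<Rightarrow> real \<Rightarrow> (nat \<Rightarrow> real) \<Rightarrow> (nat \<Rightarrow> real \<times> (real ^ 'n::finite)) \<Rightarrow> bool" where
  "normal_frame d lam t N \<longleftrightarrow> inj_on N {0..d} \<and> independent (N ` {0..d}) \<and>
    (\<forall>i\<in>{0..d}. N i \<bullet> (1, 0) = - sqrt lam * t i) \<and>
    (\<forall>i\<in>{0..d}. lor (N i) (N i) = lam * (1 - t i * t i)) \<and>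
    (\<forall>i\<in>{0..d}. \<forall>j\<in>{0..d}. i \<noteq> j \<longrightarrow> lor (N i) (N j) = - lam * (1 / real d + t i * t j))"

lemma normal_frameD:
  assumes "normal_frame d lam t N"
  shows "inj_on N {0..d}" "independent (N ` {0..d})"
    "\<And>i. i \<in> {0..d} \<Longrightarrow> N i \<bullet> (1, 0) = - sqrt lam * t i"
    "\<And>i. i \<in> {0..d} \<Longrightarrow> lor (N i) (N i) = lam * (1 - t i * t i)"
    "\<And>i j. i \<in> {0..d} \<Longrightarrow> j \<in> {0..d} \<Longrightarrow> i \<noteq> j \<Longrightarrow> lor (N i) (N j) = - lam * (1 / real d + t i * t j)"
  using assms unfolding normal_frame_def by blast+

lemma normal_frame_exists:
  assumes d: "d = CARD('n::finite)" and t: "\<And>i. i \<in> {0..d} \<Longrightarrow> t i > (0::real)" and lam: "lam > 0"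
  shows "\<exists>N :: nat \<Rightarrow> real \<times> (real ^ 'n). normal_frame d lam t N"
proof -
  have dpos: "real d > 0" using d by (simp add: zero_less_card_finite)
  obtain u :: "nat \<Rightarrow> real ^ 'n" where u: "\<And>i j. i \<in> {0..d} \<Longrightarrow> j \<in> {0..d} \<Longrightarrow> u i \<bullet> u j = (if i = j then 1 else - 1 / real d)"
    using regular_simplex_exists[OF d] by blast
  define N where "N i = sqrt lam *\<^sub>R (- t i, u i)" for i
  have lorN: "lor (N i) (N j) = lam * (u i \<bullet> u j - t i * t j)" for i j
  proof -
    have "lor (N i) (N j) = (sqrt lam * sqrt lam) * (u i \<bullet> u j - t i * t j)" unfolding N_def lor_simps by (simp add: lor_def)
    then show ?thesis using lam by simp
  qed
  have "\<forall>i\<in>{0..d}. c i = 0" if c: "(\<Sum>i\<in>{0..d}. c i *\<^sub>R N i) = 0" for c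
  proof -
    have "(\<Sum>i\<in>{0..d}. c i *\<^sub>R N i) = sqrt lam *\<^sub>R (- (\<Sum>i\<in>{0..d}. c i * t i), \<Sum>i\<in>{0..d}. c i *\<^sub>R u i)"
      unfolding N_def by (simp add: prod_eq_iff fst_sum snd_sum scaleR_sum_right sum_distrib_left sum_negf algebra_simps)
    then have z: "(\<Sum>i\<in>{0..d}. c i * t i) = 0" "(\<Sum>i\<in>{0..d}. c i *\<^sub>R u i) = 0" using c lam by (auto simp: zero_prod_def)
    \<comment> \<open>Products with the \<open>u j\<close> show that all \<open>c j\<close> are
      equal; since the \<open>t i\<close> are positive, the common value is 0.\<close>
    define S where "S = (\<Sum>i\<in>{0..d}. c i)"
    have cS: "c j * (real d + 1) = S" if j: "j \<in> {0..d}" for j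
    proof -
      have "(\<Sum>i\<in>{0..d}. c i *\<^sub>R u i) \<bullet> u j = 0" unfolding z(2) by simp
      then have "0 = (\<Sum>i\<in>{0..d}. c i * (u i \<bullet> u j))" by (simp add: inner_sum_left)
      also have "\<dots> = c j * (u j \<bullet> u j) + (\<Sum>i\<in>{0..d} - {j}. c i * (u i \<bullet> u j))" using j by (simp add: sum.remove)
      also have "(\<Sum>i\<in>{0..d} - {j}. c i * (u i \<bullet> u j)) = (\<Sum>i\<in>{0..d} - {j}. c i * (- 1 / real d))"
        using u j by (intro sum.cong) auto
      also have "\<dots> = (- 1 / real d) * (S - c j)" unfolding S_def using j by (simp add: sum.remove sum_distrib_left mult.commute)
      finally have "0 = c j + (- 1 / real d) * (S - c j)" using u[OF j j] by simp
      then show ?thesis using dpos by (simp add: field_simps)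
    qed
    have "S * (\<Sum>i\<in>{0..d}. t i) = (\<Sum>i\<in>{0..d}. (c i * (real d + 1)) * t i)" unfolding sum_distrib_left using cS by (intro sum.cong) auto
    also have "\<dots> = (real d + 1) * (\<Sum>i\<in>{0..d}. c i * t i)" unfolding sum_distrib_left by (intro sum.cong) auto
    finally have "S * (\<Sum>i\<in>{0..d}. t i) = 0" using z(1) by simp
    moreover have "(\<Sum>i\<in>{0..d}. t i) > 0" using t by (intro sum_pos) auto
    ultimately have "S = 0" by simp
    then show ?thesis using cS dpos by auto
  qed
  then have "inj_on N {0..d}" "independent (N ` {0..d})" using independent_from_coeffs[of "{0..d}" N] by auto
  moreover have "N i \<bullet> (1, 0) = - sqrt lam * t i" if "i \<in> {0..d}" for i unfolding N_def by simp
  moreover have "lor (N i) (N i) = lam * (1 - t i * t i)" if "i \<in> {0..d}" for i unfolding lorN using u that by simp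
  moreover have "lor (N i) (N j) = - lam * (1 / real d + t i * t j)" if "i \<in> {0..d}" "j \<in> {0..d}" "i \<noteq> j" for i j
    unfolding lorN u[OF that(1,2)] using that by (simp add: algebra_simps)
  ultimately have "normal_frame d lam t N" unfolding normal_frame_def by blast
  then show ?thesis by blast
qed

text \<open>The rays of the simplicial cone with the given outer normals, hence the value - 1. Each
  represents a linear functional with prescribed values on the independent normals.\<close>

lemma dual_vectors:
  fixes N :: "'i \<Rightarrow> 'a::euclidean_space"
  assumes "inj_on N I" "independent (N ` I)"
  shows "\<exists>v. \<forall>i\<in>I. \<forall>j\<in>I. N j \<bullet> v i = (if i = j then - 1 else 0)"
proof -
  have "\<exists>w. \<forall>j\<in>I. N j \<bullet> w = (if i = j then - 1 else 0)" if i: "i \<in> I" for i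
  proof -
    obtain f :: "'a \<Rightarrow> real" where f: "linear f" "\<forall>x\<in>N ` I. f x = (if x = N i then - 1 else 0)"
      using linear_independent_extend[OF assms(2), of "\<lambda>x. if x = N i then - 1 else 0"] by blast
    have fx: "f x = x \<bullet> (\<Sum>b\<in>Basis. f b *\<^sub>R b)" for x
    proof -
      have "f x = f (\<Sum>b\<in>Basis. (x \<bullet> b) *\<^sub>R b)" by (simp add: euclidean_representation)
      also have "\<dots> = (\<Sum>b\<in>Basis. (x \<bullet> b) * f b)" using f(1) by (simp add: linear_sum linear_scale)
      finally show ?thesis by (simp add: inner_sum_right mult.commute)
    qed
    have "f (N j) = (if i = j then - 1 else 0)" if "j \<in> I" for j
      using f(2) that i assms(1) by (auto simp: inj_on_def)
    then have "\<forall>j\<in>I. N j \<bullet> (\<Sum>b\<in>Basis. f b *\<^sub>R b) = (if i = j then - 1 else 0)" using fx by metis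
    then show ?thesis by blast
  qed
  then show ?thesis by metis
qed

text \<open>For a single simplex, the simplex behind each facet is the whole one, so
  \<open>c F\<close> is \<open>N\<close> for every \<open>F\<close>, and the apex \<open>q F\<close>
  is the label missing from \<open>F\<close>.\<close>

lemma lorentz_config_simplex:
  fixes N :: "nat \<Rightarrow> real \<times> (real ^ 'n::finite)"
  assumes d: "d = CARD('n)" "d \<ge> 2" and N: "inj_on N {0..d}" "independent (N ` {0..d})"
    "\<And>i. i \<in> {0..d} \<Longrightarrow> N i \<bullet> (1, 0) \<le> 0" "\<And>i j. i \<in> {0..d} \<Longrightarrow> j \<in> {0..d} \<Longrightarrow> i \<noteq> j \<Longrightarrow> lor (N i) (N j) < 0"
  shows "\<exists>v n q c. lorentz_config {F. F \<subseteq> {0..d} \<and> card F = d} v n q c \<and>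
    (\<forall>F\<in>{F. F \<subseteq> {0..d} \<and> card F = d}. q F \<in> {0..d} \<and> F = {0..d} - {q F} \<and> n F = N (q F) \<and> c F = N)"
proof -
  let ?FF = "{F. F \<subseteq> {0..d} \<and> card F = d}"
  have FF: "facet_family d ?FF" using facet_family_simplex d by simp
  have Un: "\<Union>?FF = {0..d}" using multi_stack_props(2)[of 0 d] d by simp
  have ex: "\<exists>i. i \<in> {0..d} \<and> F = {0..d} - {i}" if F: "F \<in> ?FF" for F
  proof -
    have "finite F" using F finite_subset by auto
    then have "card ({0..d} - F) = 1" using F by (simp add: card_Diff_subset)
    then obtain i where i: "{0..d} - F = {i}" by (auto simp: card_1_singleton_iff)
    then have "i \<in> {0..d}" "F = {0..d} - {i}" using F by blast+
    then show ?thesis by blast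
  qed
  define q where "q F = (SOME i. i \<in> {0..d} \<and> F = {0..d} - {i})" for F
  have q: "q F \<in> {0..d}" "F = {0..d} - {q F}" if "F \<in> ?FF" for F
    using someI_ex[OF ex[OF that]] unfolding q_def by auto
  have qF: "{0..d} - {i} \<in> ?FF" "q ({0..d} - {i}) = i" if i: "i \<in> {0..d}" for i
  proof -
    show 1: "{0..d} - {i} \<in> ?FF" using i by auto
    show "q ({0..d} - {i}) = i" using q[OF 1] i by blast
  qed
  obtain v where v: "\<And>i j. i \<in> {0..d} \<Longrightarrow> j \<in> {0..d} \<Longrightarrow> N j \<bullet> v i = (if i = j then - 1 else 0)"
    using dual_vectors[OF N(1,2)] by blast
  define n where "n F = N (q F)" for F
  define c where "c F = N" for F :: "nat set"
  have spN: "span (N ` {0..d}) = UNIV"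
  proof -
    have "card (N ` {0..d}) = DIM(real \<times> (real ^ 'n))" using N(1) d by (simp add: card_image)
    then show ?thesis using N(2) by (metis card_eq_dim dim_UNIV finite_atLeastAtMost finite_imageI order_refl subset_UNIV top.extremum_uniqueI)
  qed
  have Nsum: "N k \<bullet> (\<Sum>j\<in>A. b j *\<^sub>R v j) = - b k" if "A \<subseteq> {0..d}" "k \<in> A" for A b k
  proof -
    have "finite A" using that finite_subset by auto
    have vz: "N k \<bullet> v i = 0" if "i \<in> A" "i \<noteq> k" for i using v[OF subsetD[OF \<open>A \<subseteq> {0..d}\<close> that(1)] subsetD[OF \<open>A \<subseteq> {0..d}\<close> \<open>k \<in> A\<close>]] that by simp
    have "N k \<bullet> (\<Sum>j\<in>A. b j *\<^sub>R v j) = (\<Sum>j\<in>A. b j * (N k \<bullet> v j))" by (simp add: inner_sum_right)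
    also have "\<dots> = (\<Sum>j\<in>{k}. b j * (N k \<bullet> v j))" using that vz \<open>finite A\<close> by (intro sum.mono_neutral_right) auto
    finally show ?thesis using v[of k k] that by auto
  qed
  have R: "realizes ?FF v n"
    unfolding realizes_def Un
  proof (intro conjI ballI allI impI)
    fix F i assume F: "F \<in> ?FF" and i: "i \<in> F"
    have "i \<in> {0..d}" "i \<noteq> q F" using i q(2)[OF F] by blast+
    then show "n F \<bullet> v i = 0" unfolding n_def using v[of i "q F"] q(1)[OF F] by simp
  next
    fix F i assume F: "F \<in> ?FF" and i: "i \<in> {0..d} - F"
    then have "i = q F" using q[OF F] by blast
    then show "n F \<bullet> v i < 0" unfolding n_def using v[of i "q F"] q(1)[OF F] by simp
  next
    fix F assume F: "F \<in> ?FF"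
    have fF: "finite F" "F \<subseteq> {0..d}" using F finite_subset by auto
    have "\<forall>i\<in>F. b i = 0" if "(\<Sum>i\<in>F. b i *\<^sub>R v i) = 0" for b
    proof
      fix i assume "i \<in> F"
      then show "b i = 0" using Nsum[OF fF(2), of i b] that by simp
    qed
    then show "inj_on v F" "independent (v ` F)" using independent_from_coeffs[OF fF(1), of v] by auto
  next
    fix x assume x: "\<forall>F\<in>?FF. n F \<bullet> x \<le> 0"
    have Nx: "N i \<bullet> x \<le> 0" if "i \<in> {0..d}" for i using x qF[OF that] unfolding n_def by metis
    \<comment> \<open>The coefficients follow from \<open>N i \<bullet> v i = - 1\<close>.\<close>
    let ?y = "\<Sum>i\<in>{0..d}. (- (N i \<bullet> x)) *\<^sub>R v i"
    have "x - ?y = 0"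
    proof (rule spanning_inner_zero[OF spN])
      fix z assume "z \<in> N ` {0..d}"
      then obtain k where k: "k \<in> {0..d}" "z = N k" by auto
      then show "(x - ?y) \<bullet> z = 0" using Nsum[OF order_refl k(1), of "\<lambda>i. - (N i \<bullet> x)"]
        unfolding k(2) inner_commute[of _ "N k"] inner_diff_right by (simp del: scaleR_minus_left)
    qed
    then have "x = ?y" by simp
    moreover have "?y \<in> poscone v {0..d}" by (rule posconeI) (use Nx in simp)
    ultimately show "x \<in> poscone v {0..d}" by metis
  qed
  have "lorentz_config ?FF v n q c"
    unfolding lorentz_config_def
  proof (intro conjI ballI impI)
    show "realizes ?FF v n" by (rule R)
    show "(1, 0) \<in> poscone v (\<Union>?FF)" by (rule realizesD(5)[OF R]) (use N(3) q in \<open>auto simp: n_def\<close>)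
  next
    fix F assume F: "F \<in> ?FF"
    show "q F \<in> \<Union>?FF - F" unfolding Un using q[OF F] by blast
    fix j assume j: "j \<in> F"
    have jd: "j \<in> {0..d}" "j \<noteq> q F" using j q[OF F] by blast+
    show "c F j \<bullet> v (q F) = 0" unfolding c_def using v[OF q(1)[OF F] jd(1)] jd by simp
    show "c F j \<bullet> v j < 0" unfolding c_def using v[OF jd(1) jd(1)] by simp
    fix i assume i: "i \<in> F" "i \<noteq> j"
    have "i \<in> {0..d}" using i(1) q(2)[OF F] by blast
    then show "c F j \<bullet> v i = 0" unfolding c_def using v[of i j] jd(1) i(2) by simp
  next
    fix F G assume F: "F \<in> ?FF" and G: "G \<in> ?FF" and ne: "F \<noteq> G"
    have "q F \<noteq> q G" using q(2)[OF F] q(2)[OF G] ne by metis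
    then show "lor (n F) (n G) < 0" unfolding n_def using N(4) q(1) F G by blast
  qed
  moreover have "\<forall>F\<in>?FF. q F \<in> {0..d} \<and> F = {0..d} - {q F} \<and> n F = N (q F) \<and> c F = N"
    using q n_def c_def by blast
  ultimately show ?thesis by blast
qed

text \<open>Norm 1 and product - 1 make \<open>n F + c F j\<close> null; its pole is the tangency
  point of the ridge \<open>F - {j}\<close>, and the sign condition with \<open>(1, 0)\<close> gives
  this point positive height.\<close>

definition ridge_conf :: "'i set set \<Rightarrow> ('i \<Rightarrow> real \<times> (real ^ 'n::finite)) \<Rightarrow> ('i set \<Rightarrow> real \<times> (real ^ 'n)) \<Rightarrow>
    ('i set \<Rightarrow> 'i) \<Rightarrow> ('i set \<Rightarrow> 'i \<Rightarrow> real \<times> (real ^ 'n)) \<Rightarrow> bool" where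
  "ridge_conf FF v n q c \<longleftrightarrow> lorentz_config FF v n q c \<and> (\<forall>F\<in>FF. lor (n F) (n F) = 1 \<and>
     (\<forall>j\<in>F. lor (c F j) (c F j) = 1 \<and> lor (n F) (c F j) = - 1 \<and> (n F + c F j) \<bullet> (1, 0) < 0 \<and>
        (\<forall>k\<in>F. k \<noteq> j \<longrightarrow> lor (c F j) (c F k) = - 1)))"

text \<open>In the limiting case all normals are null with mutual products - 1.
  \<open>\<delta>\<close> bounds the deviation from this case, whereas \<open>\<tau>\<close>
  prescribes the norms of the facet normals exactly.\<close>

definition circ_conf :: "real \<Rightarrow> ('i set \<Rightarrow> real) \<Rightarrow> 'i set set \<Rightarrow> ('i \<Rightarrow> real \<times> (real ^ 'n::finite)) \<Rightarrow>
    ('i set \<Rightarrow> real \<times> (real ^ 'n)) \<Rightarrow> ('i set \<Rightarrow> 'i) \<Rightarrow> ('i set \<Rightarrow> 'i \<Rightarrow> real \<times> (real ^ 'n)) \<Rightarrow> bool" where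
  "circ_conf \<delta> \<tau> FF v n q c \<longleftrightarrow> lorentz_config FF v n q c \<and> (\<forall>F\<in>FF. lor (n F) (n F) = \<tau> F \<and>
     (\<forall>j\<in>F. 0 \<le> lor (c F j) (c F j) \<and> lor (c F j) (c F j) \<le> \<delta> \<and> \<bar>lor (n F) (c F j) + 1\<bar> \<le> \<delta> \<and>
        (\<forall>k\<in>F. k \<noteq> j \<longrightarrow> \<bar>lor (c F j) (c F k) + 1\<bar> \<le> \<delta>)))"

text \<open>With \<open>a = 2\<close> the new simplex is the mirror image of the old one in the stacked facet.\<close>

lemma ridge_conf_exists:
  assumes "stacked_family d FF" "d = CARD('n::finite)" "d \<ge> 2"
  shows "\<exists>v n q c. ridge_conf FF (v :: nat \<Rightarrow> real \<times> (real ^ 'n)) n q c"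
  using assms
proof (induction rule: stacked_family.induct)
  case base
  let ?FF = "{F. F \<subseteq> {0..d} \<and> card F = d}"
  have d: "real d \<ge> 2" using base by simp
  \<comment> \<open>Solves \<open>1 - t * t = 1 / real d + t * t\<close>, so that the norms equal
    the negated products; \<open>lam\<close> scales the common value to 1.\<close>
  define t where "t = sqrt ((real d - 1) / (2 * real d))"
  define lam where "lam = 2 * real d / (real d + 1)"
  have t: "t > 0" "t * t = (real d - 1) / (2 * real d)" unfolding t_def using d by auto
  have lam: "lam > 0" unfolding lam_def using d by simp
  have l1: "lam * (1 - t * t) = 1" "- lam * (1 / real d + t * t) = - 1"
  proof -
    have "1 - t * t = (real d + 1) / (2 * real d)" "1 / real d + t * t = (real d + 1) / (2 * real d)"
      unfolding t(2) using d by (simp_all add: field_simps)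
    moreover have "lam * ((real d + 1) / (2 * real d)) = 1" unfolding lam_def using d by simp
    ultimately show "lam * (1 - t * t) = 1" "- lam * (1 / real d + t * t) = - 1" by (simp_all only: mult_minus_left)
  qed
  obtain N :: "nat \<Rightarrow> real \<times> (real ^ 'n)" where N0: "normal_frame d lam (\<lambda>_. t) N"
    using normal_frame_exists[OF base(1) t(1) lam] by blast
  note N = normal_frameD[OF N0, unfolded l1]
  have neg: "N i \<bullet> (1, 0) < 0" if "i \<in> {0..d}" for i unfolding N(3)[OF that] using lam t(1) by simp
  obtain v n q c where L: "lorentz_config ?FF (v :: nat \<Rightarrow> real \<times> (real ^ 'n)) n q c"
    and Q: "\<And>F. F \<in> ?FF \<Longrightarrow> q F \<in> {0..d} \<and> F = {0..d} - {q F} \<and> n F = N (q F) \<and> c F = N"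
  proof -
    have "\<And>i. i \<in> {0..d} \<Longrightarrow> N i \<bullet> (1, 0) \<le> 0" using neg less_imp_le by blast
    moreover have "\<And>i j. i \<in> {0..d} \<Longrightarrow> j \<in> {0..d} \<Longrightarrow> i \<noteq> j \<Longrightarrow> lor (N i) (N j) < 0" using N(5) by simp
    ultimately have "\<exists>v n q c. lorentz_config ?FF (v :: nat \<Rightarrow> real \<times> (real ^ 'n)) n q c \<and>
        (\<forall>F\<in>?FF. q F \<in> {0..d} \<and> F = {0..d} - {q F} \<and> n F = N (q F) \<and> c F = N)"
      by (rule lorentz_config_simplex[OF base(1,2) N(1,2)])
    then obtain v n q c where "lorentz_config ?FF (v :: nat \<Rightarrow> real \<times> (real ^ 'n)) n q c \<and>
        (\<forall>F\<in>?FF. q F \<in> {0..d} \<and> F = {0..d} - {q F} \<and> n F = N (q F) \<and> c F = N)"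
      by (elim exE)
    then show thesis by (intro that[of v n q c]) blast+
  qed
  have "ridge_conf ?FF v n q c"
    unfolding ridge_conf_def
  proof (intro conjI ballI impI)
    show "lorentz_config ?FF v n q c" by (rule L)
    fix F assume F: "F \<in> ?FF"
    have QF: "q F \<in> {0..d}" "F = {0..d} - {q F}" "n F = N (q F)" "c F = N" using Q[OF F] by blast+
    show "lor (n F) (n F) = 1" unfolding QF(3) by (rule N(4)[OF QF(1)])
    fix j assume j: "j \<in> F"
    have jd: "j \<in> {0..d}" "q F \<noteq> j" using j QF(2) by blast+
    show "lor (c F j) (c F j) = 1" "lor (n F) (c F j) = - 1" unfolding QF(3,4) using N(4)[OF jd(1)] N(5)[OF QF(1) jd] by auto
    show "(n F + c F j) \<bullet> (1, 0) < 0" unfolding inner_add_left QF(3,4) using neg[OF QF(1)] neg[OF jd(1)] by simp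
    fix k assume k: "k \<in> F" "k \<noteq> j"
    have "k \<in> {0..d}" using k QF(2) by blast
    then show "lor (c F j) (c F k) = - 1" unfolding QF(4) using N(5)[OF jd(1), of k] k(2) by simp
  qed
  then show ?case by blast
next
  case (step FF F p)
  then obtain v n q c where R: "ridge_conf FF (v :: nat \<Rightarrow> real \<times> (real ^ 'n)) n q c" by auto
  have FF: "facet_family d FF" using stacked_family_facet_family[OF step.hyps(1)] step.prems by simp
  have L: "lorentz_config FF v n q c" using R unfolding ridge_conf_def by blast
  have RF: "lor (n G) (n G) = 1" "\<And>j. j \<in> G \<Longrightarrow> lor (c G j) (c G j) = 1" "\<And>j. j \<in> G \<Longrightarrow> lor (n G) (c G j) = - 1"
    "\<And>j. j \<in> G \<Longrightarrow> (n G + c G j) \<bullet> (1, 0) < 0" "\<And>j k. j \<in> G \<Longrightarrow> k \<in> G \<Longrightarrow> k \<noteq> j \<Longrightarrow> lor (c G j) (c G k) = - 1"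
    if "G \<in> FF" for G using R that unfolding ridge_conf_def by blast+
  note RFF = RF[OF step.hyps(2)]
  define m where "m j = c F j + (2::real) *\<^sub>R n F" for j
  have mm: "lor (m j) (m k) = - 1" if "j \<in> F" "k \<in> F" "j \<noteq> k" for j k
    unfolding m_def lor_simps using RFF(1) RFF(3) RFF(5) that by (simp add: lor_commute[of "c F j" "n F"])
  have m1: "lor (m j) (m j) = 1" if "j \<in> F" for j
    unfolding m_def lor_simps using RFF(1-3) that by (simp add: lor_commute[of "c F j" "n F"])
  have nm: "lor (n F) (m j) = 1" if "j \<in> F" for j
    unfolding m_def lor_simps using RFF(1,3) that by simp
  have "\<exists>v' n' q' c'. lorentz_config (stack_family FF F p) v' n' q' c' \<and>
    (\<forall>G\<in>FF - {F}. n' G = n G \<and> c' G = c G) \<and>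
    (\<forall>j\<in>F. n' (insert p (F - {j})) = m j \<and> c' (insert p (F - {j})) = (\<lambda>k. if k = p then - n F else m k))"
  proof (rule lorentz_config_stack[OF FF step.prems L step.hyps(2,3)])
    show "lor (n F) (n F) > 0" using RFF(1) by simp
    show "lor (n F) (c F j) < 0" if "j \<in> F" for j using RFF(3)[OF that] by simp
    show "lor (c F j) (c F k) < 0" if "j \<in> F" "k \<in> F" "j \<noteq> k" for j k using RFF(5)[of j k] that by simp
    show "lor (n F) (n F) * lor (c F j) (c F j) \<le> (lor (n F) (c F j))\<^sup>2" if "j \<in> F" for j using RFF(1) RFF(2,3)[OF that] by simp
    show "- lor (n F) (c F j) < 2 * lor (n F) (n F)" if "j \<in> F" for j using RFF(1) RFF(3)[OF that] by simp
    show "m j = c F j + 2 *\<^sub>R n F" for j by (rule m_def)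
    show "lor (m j) (m k) < 0" if "j \<in> F" "k \<in> F" "j \<noteq> k" for j k using mm[OF that] by simp
  qed
  then obtain v' n' q' c' where st: "lorentz_config (stack_family FF F p) v' n' q' c' \<and>
      (\<forall>G\<in>FF - {F}. n' G = n G \<and> c' G = c G) \<and>
      (\<forall>j\<in>F. n' (insert p (F - {j})) = m j \<and> c' (insert p (F - {j})) = (\<lambda>k. if k = p then - n F else m k))"
    by (elim exE)
  have L': "lorentz_config (stack_family FF F p) v' n' q' c'" using st by (rule conjunct1)
  have old: "n' G = n G \<and> c' G = c G" if "G \<in> FF" "G \<noteq> F" for G
    using st[THEN conjunct2, THEN conjunct1] that by blast
  have new: "n' (insert p (F - {j})) = m j \<and> c' (insert p (F - {j})) = (\<lambda>k. if k = p then - n F else m k)" if "j \<in> F" for j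
    using st[THEN conjunct2, THEN conjunct2] that by (rule bspec)
  have nF0: "n F \<bullet> (1, 0) \<le> 0" using realizes_le[OF lorentz_configD(1,2)[OF L] step.hyps(2)] .
  have pF: "p \<notin> F" using step.hyps by auto
  have "ridge_conf (stack_family FF F p) v' n' q' c'"
    unfolding ridge_conf_def
  proof (rule conjI[OF L'], rule ballI)
    fix H assume "H \<in> stack_family FF F p"
    then consider "H \<in> FF" "H \<noteq> F" | j where "j \<in> F" "H = insert p (F - {j})" by (auto simp: stack_family_def)
    then show "lor (n' H) (n' H) = 1 \<and>
     (\<forall>j\<in>H. lor (c' H j) (c' H j) = 1 \<and> lor (n' H) (c' H j) = - 1 \<and> (n' H + c' H j) \<bullet> (1, 0) < 0 \<and>
        (\<forall>k\<in>H. k \<noteq> j \<longrightarrow> lor (c' H j) (c' H k) = - 1))"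
    proof cases
      case 1
      then show ?thesis using old[OF 1] RF[OF 1(1)] by simp
    next
      case 2
      have nH: "n' H = m j" "c' H k = (if k = p then - n F else m k)" for k using new[OF 2(1)] 2(2) by auto
      have npF: "k \<noteq> p" if "k \<in> F" for k using that pF by auto
      show ?thesis
      proof (intro conjI ballI impI)
        show "lor (n' H) (n' H) = 1" using nH m1 2 by simp
        fix k assume k: "k \<in> H"
        have kF: "k \<noteq> p \<Longrightarrow> k \<in> F \<and> k \<noteq> j" using k 2 by auto
        show "lor (c' H k) (c' H k) = 1" unfolding nH using kF m1 RFF(1) by (simp add: lor_simps)
        show "lor (n' H) (c' H k) = - 1" unfolding nH using kF mm[of j k] nm[OF 2(1)] 2(1) by (auto simp: lor_simps lor_commute[of "m j"])
        \<comment> \<open>For \<open>k = p\<close> the ridge \<open>F - {j}\<close> is an old one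
          with the same sum of normals. Otherwise the sum splits into two old sums and
          \<open>2 *\<^sub>R n F\<close>, and \<open>n F \<bullet> (1, 0) \<le> 0\<close> because
          \<open>(1, 0)\<close> lies in the cone.\<close>
        show "(n' H + c' H k) \<bullet> (1, 0) < 0"
        proof (cases "k = p")
          case True
          have "n' H + c' H k = n F + c F j" unfolding nH m_def using True by (simp add: scaleR_2)
          then show ?thesis using RFF(4)[OF 2(1)] by simp
        next
          case False
          have "n' H + c' H k = (n F + c F j) + (n F + c F k) + 2 *\<^sub>R n F" unfolding nH m_def using False by (simp add: scaleR_2)
          then have "(n' H + c' H k) \<bullet> (1, 0) = (n F + c F j) \<bullet> (1, 0) + (n F + c F k) \<bullet> (1, 0) + 2 * (n F \<bullet> (1, 0))"
            by (simp only: inner_add_left inner_scaleR_left)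
          then show ?thesis using RFF(4)[OF 2(1)] RFF(4)[of k] kF False nF0 by linarith
        qed
        fix l assume l: "l \<in> H" "l \<noteq> k"
        have lF: "l \<noteq> p \<Longrightarrow> l \<in> F \<and> l \<noteq> j" using l 2 by auto
        show "lor (c' H k) (c' H l) = - 1" unfolding nH
          using kF lF l mm[of k l] nm[of k] nm[of l] by (auto simp: lor_simps lor_commute[of "m k" "n F"])
      qed
    qed
  qed
  then show ?case by blast
qed

text \<open>\<open>(g + s) / \<epsilon>\<close> is the larger root \<open>a\<close> of
  \<open>e - 2 * a * g + a\<^sup>2 * \<epsilon> = t\<close>, the norm condition on a new normal. The
  bound carries a factor \<open>\<epsilon>\<close>, from
  \<open>(s - g) * (s + g) = - \<epsilon> * (e - t)\<close>, because errors are divided by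
  \<open>\<epsilon>\<close> later.\<close>

lemma sqrt_perturbation:
  fixes g e t \<delta> \<epsilon> :: real
  assumes "0 < \<epsilon>" "\<epsilon> \<le> \<delta>" "\<delta> \<le> 1/20" "\<bar>g - 1\<bar> \<le> \<delta>" "0 \<le> e" "e \<le> \<delta>" "0 \<le> t" "t \<le> \<epsilon>"
  shows "\<exists>s. s > 0 \<and> s\<^sup>2 = g\<^sup>2 - \<epsilon> * (e - t) \<and> \<bar>s - g\<bar> \<le> 2 * \<epsilon> * \<delta>"
proof -
  have g: "g \<ge> 19/20" using assms by linarith
  have et: "\<bar>e - t\<bar> \<le> \<delta>" using assms by linarith
  have ed: "\<epsilon> * \<bar>e - t\<bar> \<le> \<epsilon> * \<delta>" using et assms(1) by (intro mult_left_mono) auto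
  have "\<epsilon> * \<delta> \<le> (1/20) * (1/20)" using assms by (intro mult_mono) auto
  moreover have "\<epsilon> * (e - t) \<le> \<epsilon> * \<bar>e - t\<bar>" using assms(1) by (intro mult_left_mono) auto
  moreover have "(19/20) * (19/20) \<le> g * g" using g by (intro mult_mono) auto
  ultimately have pos: "g\<^sup>2 - \<epsilon> * (e - t) > 0" using ed unfolding power2_eq_square by linarith
  define s where "s = sqrt (g\<^sup>2 - \<epsilon> * (e - t))"
  have s: "s > 0" "s\<^sup>2 = g\<^sup>2 - \<epsilon> * (e - t)" unfolding s_def using pos by auto
  have "\<bar>s - g\<bar> * (s + g) = \<bar>(s - g) * (s + g)\<bar>" using s(1) g by (simp add: abs_mult)
  also have "(s - g) * (s + g) = - (\<epsilon> * (e - t))" using s(2) by (simp add: power2_eq_square algebra_simps)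
  also have "\<bar>- (\<epsilon> * (e - t))\<bar> = \<epsilon> * \<bar>e - t\<bar>" using assms(1) by (simp add: abs_mult)
  finally have "\<bar>s - g\<bar> * (s + g) \<le> \<epsilon> * \<delta>" using ed by simp
  moreover have "\<bar>s - g\<bar> * (1/2) \<le> \<bar>s - g\<bar> * (s + g)" using s(1) g by (intro mult_left_mono) auto
  ultimately have "\<bar>s - g\<bar> * (1/2) \<le> \<epsilon> * \<delta>" by (rule order_trans[rotated])
  then have "\<bar>s - g\<bar> \<le> 2 * (\<epsilon> * \<delta>)" by simp
  then have "\<bar>s - g\<bar> \<le> 2 * \<epsilon> * \<delta>" by (simp only: mult.assoc)
  then show ?thesis using s by blast
qed

text \<open>Facets that are stacked later must cut the sphere, the others must be tangent to it. Prescribing all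
  the norms \<open>\<tau> F\<close> of the facet normals, up to a bound that depends on the stacking, makes the induction work.\<close>

lemma circ_conf_exists:
  assumes "stacked_family d FF" "d = CARD('n::finite)" "d \<ge> 2" "0 < \<delta>" "\<delta> \<le> 1/2"
  shows "\<exists>\<epsilon>>0. \<epsilon> \<le> \<delta> \<and> (\<forall>\<tau>. (\<forall>F\<in>FF. 0 \<le> \<tau> F \<and> \<tau> F \<le> \<epsilon>) \<longrightarrow>
    (\<exists>v n q c. circ_conf \<delta> \<tau> FF (v :: nat \<Rightarrow> real \<times> (real ^ 'n)) n q c))"
  using assms
proof (induction arbitrary: \<delta> rule: stacked_family.induct)
  case base
  let ?FF = "{F. F \<subseteq> {0..d} \<and> card F = d}"
  have d: "real d \<ge> 2" using base by simp
  \<comment> \<open>Chosen so that \<open>t i \<ge> 1 - 2 * \<epsilon>\<close> gives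
    \<open>t i * t j \<ge> 1 - 4 * \<epsilon> = 1 - \<delta>\<close>.\<close>
  define \<epsilon> where "\<epsilon> = \<delta> / 4"
  have eps: "\<epsilon> > 0" "\<epsilon> \<le> \<delta>" "4 * \<epsilon> = \<delta>" unfolding \<epsilon>_def using base by auto
  \<comment> \<open>Makes \<open>lam * (1 / real d + 1) = 1\<close>, so that for
    \<open>t i = 1\<close> the normals are null with products - 1.\<close>
  define lam where "lam = real d / (real d + 1)"
  have lam: "lam > 0" unfolding lam_def using d by simp
  have "\<exists>v n q c. circ_conf \<delta> \<tau> ?FF (v :: nat \<Rightarrow> real \<times> (real ^ 'n)) n q c" if \<tau>: "\<forall>F\<in>?FF. 0 \<le> \<tau> F \<and> \<tau> F \<le> \<epsilon>" for \<tau>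
  proof -
    have F: "{0..d} - {i} \<in> ?FF" if "i \<in> {0..d}" for i using that by auto
    define s where "s i = \<tau> ({0..d} - {i})" for i
    have s: "0 \<le> s i" "s i \<le> \<epsilon>" if "i \<in> {0..d}" for i using \<tau> F[OF that] unfolding s_def by blast+
    define t where "t i = sqrt (1 - s i / lam)" for i
    have sl: "0 \<le> s i / lam" "s i / lam \<le> 2 * \<epsilon>" if i: "i \<in> {0..d}" for i
    proof -
      show "0 \<le> s i / lam" using s[OF i] lam by simp
      have "2 * lam \<ge> 1" unfolding lam_def using d by (simp add: field_simps)
      then have "\<epsilon> * 1 \<le> \<epsilon> * (2 * lam)" using eps by (intro mult_left_mono) auto
      then show "s i / lam \<le> 2 * \<epsilon>" using s[OF i] lam by (simp add: divide_le_eq)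
    qed
    have arg: "1 - s i / lam > 0" "1 - s i / lam \<le> 1" if i: "i \<in> {0..d}" for i using sl[OF i] eps base by linarith+
    have t: "t i > 0" "t i \<le> 1" "t i * t i = 1 - s i / lam" if i: "i \<in> {0..d}" for i
      unfolding t_def using arg[OF i] by (auto simp: real_sqrt_le_1_iff)
    have tge: "t i \<ge> 1 - 2 * \<epsilon>" if i: "i \<in> {0..d}" for i
    proof -
      have "t i * t i \<le> t i * 1" using t[OF i] by (intro mult_left_mono) auto
      then show ?thesis using t(3)[OF i] sl[OF i] by linarith
    qed
    have tt: "1 - \<delta> \<le> t i * t j" "t i * t j \<le> 1" if ij: "i \<in> {0..d}" "j \<in> {0..d}" for i j
    proof -
      have "(1 - 2 * \<epsilon>) * (1 - 2 * \<epsilon>) \<le> t i * t j" using tge ij eps base t(1) by (intro mult_mono) (auto intro: less_imp_le)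
      moreover have "(1 - 2 * \<epsilon>) * (1 - 2 * \<epsilon>) = 1 - 4 * \<epsilon> + 4 * (\<epsilon> * \<epsilon>)" by (simp add: algebra_simps)
      moreover have "\<epsilon> * \<epsilon> \<ge> 0" by simp
      moreover note eps(3)
      ultimately show "1 - \<delta> \<le> t i * t j" by linarith
      show "t i * t j \<le> 1" using t ij by (intro mult_le_one) (auto intro: less_imp_le)
    qed
    obtain N :: "nat \<Rightarrow> real \<times> (real ^ 'n)" where N0: "normal_frame d lam t N"
      using normal_frame_exists[OF base(1) _ lam, of t] t(1) by blast
    note N = normal_frameD[OF N0]
    have neg: "N i \<bullet> (1, 0) \<le> 0" if "i \<in> {0..d}" for i unfolding N(3)[OF that] using lam t(1)[OF that] by simp
    have Ns: "lor (N i) (N i) = s i" if "i \<in> {0..d}" for i unfolding N(4)[OF that] t(3)[OF that] using lam by simp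
    have Ng: "\<bar>lor (N i) (N j) + 1\<bar> \<le> \<delta>" if ij: "i \<in> {0..d}" "j \<in> {0..d}" "i \<noteq> j" for i j
    proof -
      have e: "lor (N i) (N j) + 1 = lam * (1 - t i * t j)" 
      proof -
        have l: "lam * (1 / real d) = 1 / (real d + 1)" "lam + 1 / (real d + 1) = 1" unfolding lam_def using d by (simp_all add: field_simps)
        have "- lam * (1 / real d + t i * t j) + 1 = - (lam * (1 / real d)) - lam * (t i * t j) + 1"
          by (simp only: distrib_left mult_minus_left)
        also have "\<dots> = lam * (1 - t i * t j)" unfolding l(1) right_diff_distrib using l(2) by linarith
        finally show ?thesis unfolding N(5)[OF ij] .
      qed
      have "lam \<le> 1" unfolding lam_def using d by simp
      then have "lam * (1 - t i * t j) \<le> 1 * (1 - t i * t j)" using tt[OF ij(1,2)] by (intro mult_right_mono) auto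
      moreover have nn: "0 \<le> lam * (1 - t i * t j)" using lam tt[OF ij(1,2)] by simp
      moreover have "1 * (1 - t i * t j) \<le> \<delta>" using tt(1)[OF ij(1,2)] by (simp add: diff_le_eq add.commute)
      ultimately show ?thesis unfolding e abs_of_nonneg[OF nn] by (metis order_trans)
    qed
    have Nneg: "lor (N i) (N j) < 0" if ij: "i \<in> {0..d}" "j \<in> {0..d}" "i \<noteq> j" for i j
      using Ng[OF ij] base by linarith
    obtain v n q c where L: "lorentz_config ?FF (v :: nat \<Rightarrow> real \<times> (real ^ 'n)) n q c"
      and Q: "\<And>F. F \<in> ?FF \<Longrightarrow> q F \<in> {0..d} \<and> F = {0..d} - {q F} \<and> n F = N (q F) \<and> c F = N"
    proof -
      have "\<exists>v n q c. lorentz_config ?FF (v :: nat \<Rightarrow> real \<times> (real ^ 'n)) n q c \<and>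
        (\<forall>F\<in>?FF. q F \<in> {0..d} \<and> F = {0..d} - {q F} \<and> n F = N (q F) \<and> c F = N)"
        by (rule lorentz_config_simplex[OF base(1,2) N(1,2) neg Nneg])
      then obtain v n q c where "lorentz_config ?FF (v :: nat \<Rightarrow> real \<times> (real ^ 'n)) n q c \<and>
        (\<forall>F\<in>?FF. q F \<in> {0..d} \<and> F = {0..d} - {q F} \<and> n F = N (q F) \<and> c F = N)"
        by (elim exE)
      then show thesis by (intro that[of v n q c]) blast+
    qed
    have "circ_conf \<delta> \<tau> ?FF v n q c"
      unfolding circ_conf_def
    proof (rule conjI[OF L], rule ballI)
      fix F assume F: "F \<in> ?FF"
      have QF: "q F \<in> {0..d}" "F = {0..d} - {q F}" "n F = N (q F)" "c F = N" using Q[OF F] by blast+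
      have sF: "s (q F) = \<tau> F" unfolding s_def using QF(2) by metis
      show "lor (n F) (n F) = \<tau> F \<and> (\<forall>j\<in>F. 0 \<le> lor (c F j) (c F j) \<and> lor (c F j) (c F j) \<le> \<delta> \<and> \<bar>lor (n F) (c F j) + 1\<bar> \<le> \<delta> \<and>
        (\<forall>k\<in>F. k \<noteq> j \<longrightarrow> \<bar>lor (c F j) (c F k) + 1\<bar> \<le> \<delta>))"
      proof (intro conjI ballI impI)
        show "lor (n F) (n F) = \<tau> F" unfolding QF(3) Ns[OF QF(1)] by (rule sF)
        fix j assume j: "j \<in> F"
        have jd: "j \<in> {0..d}" "q F \<noteq> j" using j QF(2) by blast+
        show "0 \<le> lor (c F j) (c F j)" "lor (c F j) (c F j) \<le> \<delta>" unfolding QF(4) Ns[OF jd(1)] using s[OF jd(1)] eps by auto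
        show "\<bar>lor (n F) (c F j) + 1\<bar> \<le> \<delta>" unfolding QF(3,4) using Ng QF(1) jd by blast
        fix k assume k: "k \<in> F" "k \<noteq> j"
        have "k \<in> {0..d}" using k QF(2) by blast
        then show "\<bar>lor (c F j) (c F k) + 1\<bar> \<le> \<delta>" unfolding QF(4) using Ng jd(1) k(2) by blast
      qed
    qed
    then show ?thesis by blast
  qed
  then show ?case using eps by blast
next
  case (step FF F p)
  \<comment> \<open>One stacking enlarges the deviation from \<open>\<delta>'\<close> to at most
    \<open>9 * \<delta>'\<close>; the divisor 20 leaves room and also ensures
    \<open>\<delta>' \<le> 1/20\<close>.\<close>
  define \<delta>' where "\<delta>' = \<delta> / 20"
  have \<delta>': "0 < \<delta>'" "\<delta>' \<le> 1/2" "20 * \<delta>' = \<delta>" "\<delta>' \<le> 1/20" unfolding \<delta>'_def using step.prems by auto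
  obtain \<epsilon> where eps: "\<epsilon> > 0" "\<epsilon> \<le> \<delta>'" and IH: "\<And>\<tau>. (\<forall>F\<in>FF. 0 \<le> \<tau> F \<and> \<tau> F \<le> \<epsilon>) \<Longrightarrow>
    \<exists>v n q c. circ_conf \<delta>' \<tau> FF (v :: nat \<Rightarrow> real \<times> (real ^ 'n)) n q c"
    using step.IH[OF step.prems(1,2) \<delta>'(1,2)] by blast
  have FF: "facet_family d FF" using stacked_family_facet_family[OF step.hyps(1)] step.prems by simp
  have pF: "p \<notin> F" using step.hyps by auto
  have "\<exists>v n q c. circ_conf \<delta> \<tau> (stack_family FF F p) (v :: nat \<Rightarrow> real \<times> (real ^ 'n)) n q c"
    if \<tau>: "\<forall>H\<in>stack_family FF F p. 0 \<le> \<tau> H \<and> \<tau> H \<le> \<epsilon>" for \<tau>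
  proof -
    \<comment> \<open>The facet about to be stacked receives the full norm
      \<open>\<epsilon> > 0\<close> and so cuts the sphere. The induction hypothesis allows any
      norms up to \<open>\<epsilon>\<close>, so all other facets get their final norms already
      now.\<close>
    define \<sigma> where "\<sigma> H = (if H = F then \<epsilon> else \<tau> H)" for H
    have "\<forall>H\<in>FF. 0 \<le> \<sigma> H \<and> \<sigma> H \<le> \<epsilon>" unfolding \<sigma>_def using \<tau> eps by (auto simp: stack_family_def)
    then obtain v n q c where C: "circ_conf \<delta>' \<sigma> FF (v :: nat \<Rightarrow> real \<times> (real ^ 'n)) n q c" using IH by blast
    have L: "lorentz_config FF v n q c" using C unfolding circ_conf_def by blast
    have CF: "lor (n G) (n G) = \<sigma> G" "\<And>j. j \<in> G \<Longrightarrow> 0 \<le> lor (c G j) (c G j)" "\<And>j. j \<in> G \<Longrightarrow> lor (c G j) (c G j) \<le> \<delta>'"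
      "\<And>j. j \<in> G \<Longrightarrow> \<bar>lor (n G) (c G j) + 1\<bar> \<le> \<delta>'" "\<And>j k. j \<in> G \<Longrightarrow> k \<in> G \<Longrightarrow> k \<noteq> j \<Longrightarrow> \<bar>lor (c G j) (c G k) + 1\<bar> \<le> \<delta>'"
      if "G \<in> FF" for G using C that unfolding circ_conf_def by blast+
    note CFF = CF[OF step.hyps(2)]
    have e: "lor (n F) (n F) = \<epsilon>" using CFF(1) by (simp add: \<sigma>_def)
    define g where "g j = - lor (n F) (c F j)" for j
    have g: "\<bar>g j - 1\<bar> \<le> \<delta>'" if "j \<in> F" for j using CFF(4)[OF that] unfolding g_def by linarith
    define t where "t j = \<tau> (insert p (F - {j}))" for j
    have t: "0 \<le> t j" "t j \<le> \<epsilon>" if "j \<in> F" for j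
    proof -
      have "insert p (F - {j}) \<in> stack_family FF F p" using that by (auto simp: stack_family_def)
      then show "0 \<le> t j" "t j \<le> \<epsilon>" unfolding t_def using \<tau> by blast+
    qed
    have "\<forall>j\<in>F. \<exists>s. s > 0 \<and> s\<^sup>2 = (g j)\<^sup>2 - \<epsilon> * (lor (c F j) (c F j) - t j) \<and> \<bar>s - g j\<bar> \<le> 2 * \<epsilon> * \<delta>'"
      using sqrt_perturbation[OF eps \<delta>'(4)] g CFF(2,3) t by blast
    then obtain s where s: "\<And>j. j \<in> F \<Longrightarrow> s j > 0 \<and> (s j)\<^sup>2 = (g j)\<^sup>2 - \<epsilon> * (lor (c F j) (c F j) - t j) \<and> \<bar>s j - g j\<bar> \<le> 2 * \<epsilon> * \<delta>'"
      by metis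
    have ed: "\<epsilon> * \<delta>' \<le> \<delta>' / 20" using eps \<delta>' by (simp add: mult_right_mono[of \<epsilon> "1/20" \<delta>', simplified])
    \<comment> \<open>The larger root, since \<open>a j * \<epsilon> > g j\<close> is what puts the
      new vertex beneath the other facets.\<close>
    define a where "a j = (g j + s j) / \<epsilon>" for j
    have a\<epsilon>: "a j * \<epsilon> = g j + s j" for j unfolding a_def using eps by simp
    define m where "m j = c F j + a j *\<^sub>R n F" for j
    have lmm: "lor (m j) (m k) = lor (c F j) (c F k) - a k * g j - a j * g k + a j * (a k * \<epsilon>)" for j k
      unfolding m_def lor_simps e g_def by (simp add: lor_commute[of "c F j" "n F"] algebra_simps)
    have m1: "lor (m j) (m j) = t j" if j: "j \<in> F" for j
    proof -
      have "\<epsilon> * lor (m j) (m j) = \<epsilon> * lor (c F j) (c F j) - 2 * (a j * \<epsilon>) * g j + (a j * \<epsilon>) * (a j * \<epsilon>)"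
        unfolding lmm by (simp add: algebra_simps)
      also have "\<dots> = \<epsilon> * lor (c F j) (c F j) + (s j)\<^sup>2 - (g j)\<^sup>2" unfolding a\<epsilon> by (simp add: algebra_simps power2_eq_square)
      also have "\<dots> = \<epsilon> * t j" using s[OF j] by (simp add: algebra_simps)
      finally show ?thesis using eps by simp
    qed
    have mm: "\<bar>lor (m j) (m k) + 1\<bar> \<le> \<delta>" if jk: "j \<in> F" "k \<in> F" "k \<noteq> j" for j k
    proof -
      \<comment> \<open>Although \<open>a j\<close> is of order \<open>1 / \<epsilon>\<close>, the
        large terms cancel: the difference depends only on the errors \<open>s j - g j\<close> and
        \<open>s k - g k\<close>, which contain a factor \<open>\<epsilon>\<close>
        themselves.\<close>
      have "\<epsilon> * (lor (m j) (m k) - lor (c F j) (c F k)) = (a j * \<epsilon>) * (a k * \<epsilon>) - (a k * \<epsilon>) * g j - (a j * \<epsilon>) * g k"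
        unfolding lmm by (simp add: algebra_simps)
      also have "\<dots> = (s j - g j) * s k + g j * (s k - g k)" unfolding a\<epsilon> by (simp add: algebra_simps)
      finally have eq: "\<epsilon> * (lor (m j) (m k) - lor (c F j) (c F k)) = (s j - g j) * s k + g j * (s k - g k)" .
      have sk: "\<bar>s k\<bar> \<le> 2" "\<bar>g j\<bar> \<le> 2" using s[OF jk(2)] g[OF jk(1)] g[OF jk(2)] ed \<delta>' by linarith+
      have "\<bar>(s j - g j) * s k\<bar> \<le> (2 * \<epsilon> * \<delta>') * 2" unfolding abs_mult using s[OF jk(1)] sk eps \<delta>' by (intro mult_mono) auto
      moreover have "\<bar>g j * (s k - g k)\<bar> \<le> 2 * (2 * \<epsilon> * \<delta>')" unfolding abs_mult using s[OF jk(2)] sk by (intro mult_mono) auto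
      ultimately have "\<bar>\<epsilon> * (lor (m j) (m k) - lor (c F j) (c F k))\<bar> \<le> \<epsilon> * (8 * \<delta>')" unfolding eq by linarith
      then have "\<epsilon> * \<bar>lor (m j) (m k) - lor (c F j) (c F k)\<bar> \<le> \<epsilon> * (8 * \<delta>')" using eps by (simp add: abs_mult)
      then have "\<bar>lor (m j) (m k) - lor (c F j) (c F k)\<bar> \<le> 8 * \<delta>'" using eps by simp
      then show ?thesis using CFF(5)[OF jk] \<delta>' by linarith
    qed
    have nm: "lor (n F) (m j) = s j" for j unfolding m_def lor_simps e using a\<epsilon>[of j] by (simp add: g_def)
    have s1: "\<bar>1 - s j\<bar> \<le> \<delta>" if "j \<in> F" for j using s[OF that] g[OF that] ed \<delta>' by linarith
    have "\<exists>v' n' q' c'. lorentz_config (stack_family FF F p) v' n' q' c' \<and>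
      (\<forall>G\<in>FF - {F}. n' G = n G \<and> c' G = c G) \<and>
      (\<forall>j\<in>F. n' (insert p (F - {j})) = m j \<and> c' (insert p (F - {j})) = (\<lambda>k. if k = p then - n F else m k))"
    proof (rule lorentz_config_stack[OF FF step.prems(1,2) L step.hyps(2,3)])
      show "lor (n F) (n F) > 0" using e eps by simp
      show "lor (n F) (c F j) < 0" if "j \<in> F" for j using CFF(4)[OF that] \<delta>' by linarith
      show "lor (c F j) (c F k) < 0" if "j \<in> F" "k \<in> F" "j \<noteq> k" for j k using CFF(5)[of j k] that \<delta>' by fastforce
      show "lor (n F) (n F) * lor (c F j) (c F j) \<le> (lor (n F) (c F j))\<^sup>2" if "j \<in> F" for j
      proof -
        have "lor (n F) (n F) * lor (c F j) (c F j) \<le> (1/2) * (1/2)" unfolding e using CFF(2,3)[OF that] eps \<delta>' by (intro mult_mono) auto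
        moreover have "(1/2) * (1/2) \<le> g j * g j" using g[OF that] \<delta>' by (intro mult_mono) linarith+
        ultimately show ?thesis unfolding g_def power2_eq_square by simp
      qed
      show "- lor (n F) (c F j) < a j * lor (n F) (n F)" if "j \<in> F" for j unfolding e a\<epsilon> using s[OF that] by (simp add: g_def)
      show "m j = c F j + a j *\<^sub>R n F" for j by (rule m_def)
      show "lor (m j) (m k) < 0" if "j \<in> F" "k \<in> F" "j \<noteq> k" for j k using mm[of j k] that step.prems by fastforce
    qed
    then obtain v' n' q' c' where st: "lorentz_config (stack_family FF F p) v' n' q' c' \<and>
        (\<forall>G\<in>FF - {F}. n' G = n G \<and> c' G = c G) \<and>
        (\<forall>j\<in>F. n' (insert p (F - {j})) = m j \<and> c' (insert p (F - {j})) = (\<lambda>k. if k = p then - n F else m k))"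
      by (elim exE)
    have L': "lorentz_config (stack_family FF F p) v' n' q' c'" using st by (rule conjunct1)
    have old: "n' G = n G \<and> c' G = c G" if "G \<in> FF" "G \<noteq> F" for G
      using st[THEN conjunct2, THEN conjunct1] that by blast
    have new: "n' (insert p (F - {j})) = m j \<and> c' (insert p (F - {j})) = (\<lambda>k. if k = p then - n F else m k)" if "j \<in> F" for j
      using st[THEN conjunct2, THEN conjunct2] that by (rule bspec)
    have "circ_conf \<delta> \<tau> (stack_family FF F p) v' n' q' c'"
      unfolding circ_conf_def
    proof (rule conjI[OF L'], rule ballI)
      fix H assume "H \<in> stack_family FF F p"
      then consider "H \<in> FF" "H \<noteq> F" | j where "j \<in> F" "H = insert p (F - {j})" by (auto simp: stack_family_def)
      then show "lor (n' H) (n' H) = \<tau> H \<and>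
       (\<forall>j\<in>H. 0 \<le> lor (c' H j) (c' H j) \<and> lor (c' H j) (c' H j) \<le> \<delta> \<and> \<bar>lor (n' H) (c' H j) + 1\<bar> \<le> \<delta> \<and>
          (\<forall>k\<in>H. k \<noteq> j \<longrightarrow> \<bar>lor (c' H j) (c' H k) + 1\<bar> \<le> \<delta>))"
      proof cases
        case 1
        have le: "\<delta>' \<le> \<delta>" using \<delta>' by linarith
        have "lor (n H) (n H) = \<tau> H" using CF(1)[OF 1(1)] 1(2) by (simp add: \<sigma>_def)
        then show ?thesis using old[OF 1] CF(2-5)[OF 1(1)] le by (auto intro: order_trans[OF _ le])
      next
        case 2
        have nH: "n' H = m j" "c' H k = (if k = p then - n F else m k)" for k using new[OF 2(1)] 2(2) by auto
        show ?thesis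
        proof (intro conjI ballI impI)
          show "lor (n' H) (n' H) = \<tau> H" using nH m1[OF 2(1)] 2(2) by (simp add: t_def)
          fix k assume k: "k \<in> H"
          have kF: "k \<noteq> p \<Longrightarrow> k \<in> F \<and> k \<noteq> j" using k 2 by auto
          have "lor (c' H k) (c' H k) = (if k = p then \<epsilon> else t k)" unfolding nH using kF m1 e by (simp add: lor_simps)
          then show "0 \<le> lor (c' H k) (c' H k)" "lor (c' H k) (c' H k) \<le> \<delta>" using kF t[of k] eps \<delta>' by (auto split: if_splits)
          show "\<bar>lor (n' H) (c' H k) + 1\<bar> \<le> \<delta>"
          proof (cases "k = p")
            case True
            then show ?thesis unfolding nH using nm[of j] s1[OF 2(1)] by (simp add: lor_simps lor_commute[of "m j"])
          next
            case False
            then show ?thesis unfolding nH using mm[OF 2(1), of k] kF by auto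
          qed
          fix l assume l: "l \<in> H" "l \<noteq> k"
          have lF: "l \<noteq> p \<Longrightarrow> l \<in> F \<and> l \<noteq> j" using l 2 by auto
          show "\<bar>lor (c' H k) (c' H l) + 1\<bar> \<le> \<delta>"
          proof (cases "k = p")
            case True
            then show ?thesis unfolding nH using lF l nm[of l] s1[of l] by (auto simp: lor_simps)
          next
            case False
            show ?thesis
            proof (cases "l = p")
              case True
              then show ?thesis unfolding nH using False kF nm[of k] s1[of k] by (auto simp: lor_simps lor_commute[of "m k"])
            next
              case False
              then show ?thesis unfolding nH using \<open>k \<noteq> p\<close> kF lF mm[of k l] l(2) by auto
            qed
          qed
        qed
      qed
    qed
    then show ?thesis by blast
  qed
  then show ?case using eps \<delta>' by (intro exI[of _ \<epsilon>]) auto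
qed

section \<open>Scribed polytopes from the configurations\<close>

lemma aff_dim_poscone_full:
  fixes v :: "'i \<Rightarrow> 'a::euclidean_space"
  assumes FF: "facet_family d FF" and d: "d + 1 = DIM('a)" "d \<ge> 1" and R: "realizes FF v n"
  shows "aff_dim (poscone v (\<Union>FF)) = int (d + 1)"
proof -
  obtain F where F: "F \<in> FF" using facet_familyD(2)[OF FF] by auto
  have fin: "finite (\<Union>FF)" by (rule facet_familyD(6)[OF FF])
  obtain i where i: "i \<in> \<Union>FF" "i \<notin> F" using facet_family_neq_Union[OF FF F d(2)] F by blast
  have "n F \<bullet> v i < 0" by (rule realizesD(2)[OF R F i])
  then have "span (insert (v i) (v ` F)) = UNIV"
    using facet_spans(3)[OF realizesD(3,4)[OF R F] facet_familyD(3)[OF FF F], of "n F" "v i"]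
      realizesD(1)[OF R F] facet_familyD(4)[OF FF F] d by simp
  moreover have "insert (v i) (v ` F) \<subseteq> v ` \<Union>FF" using i F by blast
  ultimately have "span (v ` \<Union>FF) = UNIV" using span_mono[of "insert (v i) (v ` F)" "v ` \<Union>FF"] by auto
  then have "dim (poscone v (\<Union>FF)) = DIM('a)" using span_poscone[OF fin, of v] by (metis dim_span dim_UNIV)
  moreover have "aff_dim (poscone v (\<Union>FF)) = int (dim (poscone v (\<Union>FF)))"
    by (rule aff_dim_zero) (simp add: hull_inc poscone_zero)
  ultimately show ?thesis using d by simp
qed

text \<open>If \<open>x\<close> and \<open>- x\<close> are both in the cone, every normal vanishes
  at \<open>x\<close>; a facet that misses \<open>i\<close> then forces the coefficient of
  \<open>v i\<close> to be zero.\<close>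

lemma realizes_spherical_polytope:
  fixes v :: "'i \<Rightarrow> 'a::euclidean_space"
  assumes FF: "facet_family d FF" and d: "d \<ge> 1" and R: "realizes FF v n"
  shows "spherical_polytope (poscone v (\<Union>FF) \<inter> sphere 0 1)"
  unfolding spherical_polytope_def
proof (intro conjI exI[of _ "n ` FF"])
  note D = facet_familyD[OF FF]
  let ?K = "poscone v (\<Union>FF)"
  show "finite (n ` FF)" using D(1) by simp
  show "0 \<notin> n ` FF"
  proof
    assume "0 \<in> n ` FF"
    then obtain F where F: "F \<in> FF" "n F = 0" by auto
    obtain i where "i \<in> \<Union>FF" "i \<notin> F" using facet_family_neq_Union[OF FF F(1) d] F(1) by blast
    then show False using realizesD(2)[OF R F(1)] F(2) by force
  qed
  have "x \<in> ?K \<longleftrightarrow> (\<forall>F\<in>FF. n F \<bullet> x \<le> 0)" for x using realizesD(5)[OF R] realizes_le[OF R] by blast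
  then show "?K \<inter> sphere 0 1 = sphere 0 1 \<inter> (\<Inter>a\<in>n ` FF. closed_hemisphere a)"
    unfolding closed_hemisphere_def using D(2) by auto
  show "\<forall>x\<in>?K \<inter> sphere 0 1. - x \<notin> ?K \<inter> sphere 0 1"
  proof (intro ballI notI)
    fix x assume x: "x \<in> ?K \<inter> sphere 0 1" and mx: "- x \<in> ?K \<inter> sphere 0 1"
    from x have "x \<in> ?K" by blast
    then obtain c where c: "\<And>i. i \<in> \<Union>FF \<Longrightarrow> c i \<ge> (0::real)" "x = (\<Sum>i\<in>\<Union>FF. c i *\<^sub>R v i)"
      by (rule posconeE) blast
    have "c i = 0" if i: "i \<in> \<Union>FF" for i
    proof -
      obtain F where F: "F \<in> FF" "i \<notin> F" using facet_family_missed[OF FF i] by auto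
      have "n F \<bullet> x \<le> 0" "n F \<bullet> (- x) \<le> 0" using realizes_le[OF R _ F(1)] x mx by blast+
      then have "n F \<bullet> (\<Sum>i\<in>\<Union>FF. c i *\<^sub>R v i) = 0" using c(2) by simp
      then show ?thesis using realizes_face_coeffs[OF R D(6) F(1), of c i] c(1) i F(2) by metis
    qed
    then have "x = 0" using c(2) by simp
    then show False using x by simp
  qed
qed

text \<open>\<open>k < d\<close> excludes the polytope itself, so the labels of the face lie in one
  facet, are independent there, and their number is the dimension of the cone.\<close>

lemma spherical_face_obtain:
  fixes v :: "'i \<Rightarrow> 'a::euclidean_space"
  assumes FF: "facet_family d FF" and d: "d + 1 = DIM('a)" and R: "realizes FF v n"
    and X: "X \<in> spherical_faces (poscone v (\<Union>FF) \<inter> sphere 0 1)" "spherical_dim X = int k" and k: "k < d"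
  shows "\<exists>F\<in>FF. \<exists>A\<subseteq>F. card A = k + 1 \<and> X = poscone v A \<inter> sphere 0 1"
proof -
  have hull: "convex_cone hull (poscone v (\<Union>FF) \<inter> sphere 0 1) = poscone v (\<Union>FF)"
    by (rule convex_cone_hull_sphere[OF convex_cone_poscone])
  obtain A where A: "A \<in> face_poset FF" "X = poscone v A \<inter> sphere 0 1"
    using X(1) unfolding spherical_faces_poscone[OF FF R hull] by blast
  have dimX: "aff_dim (poscone v A) = int k + 1"
    using X(2) convex_cone_hull_sphere[OF convex_cone_poscone, of v A] unfolding spherical_dim_def A(2) by simp
  have "A \<noteq> \<Union>FF" using dimX aff_dim_poscone_full[OF FF d _ R] k by auto
  then obtain F where F: "F \<in> FF" "A \<subseteq> F" using A(1) by (auto simp: face_poset_def)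
  have "finite A" using F facet_familyD(3)[OF FF] finite_subset by blast
  then have "aff_dim (poscone v A) = int (card A)"
    by (rule aff_dim_poscone[OF _ inj_on_subset[OF realizesD(3)[OF R F(1)] F(2)]
      independent_mono[OF realizesD(4)[OF R F(1)] image_mono[OF F(2)]]])
  then have "card A = k + 1" using dimX by simp
  then show ?thesis using A(2) F by blast
qed

text \<open>\<open>y\<close> is expanded in the vertices of the simplex behind \<open>F\<close>:
  \<open>n F\<close> isolates the coefficient of the apex, \<open>c F j\<close> that of
  \<open>v j\<close>.\<close>

lemma lorentz_config_expand:
  fixes v :: "'i \<Rightarrow> real \<times> (real ^ 'n::finite)"
  assumes FF: "facet_family d FF" and d: "d = CARD('n)" and L: "lorentz_config FF v n q c" and F: "F \<in> FF"
  shows "\<exists>b. (n F \<bullet> y = 0 \<longrightarrow> y = (\<Sum>i\<in>F. b i *\<^sub>R v i)) \<and> (\<forall>j\<in>F. c F j \<bullet> y = b j * (c F j \<bullet> v j))"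
proof -
  note LD = lorentz_configD[OF L]
  note RD = realizesD[OF LD(1)]
  have finF: "finite F" "card F = d" using facet_familyD(3,4)[OF FF F] by auto
  let ?w = "v (q F)"
  have nw: "n F \<bullet> ?w < 0" by (rule RD(2)[OF F LD(3)[OF F] LD(4)[OF F]])
  have "span (insert ?w (v ` F)) = UNIV"
    using facet_spans(3)[OF RD(3,4)[OF F] finF(1), of "n F" ?w] finF d RD(1)[OF F] nw by simp
  then have "y \<in> span (insert ?w (v ` F))" by simp
  then obtain k where "y - k *\<^sub>R ?w \<in> span (v ` F)" by (auto simp: span_breakdown_eq)
  then obtain u where u: "y - k *\<^sub>R ?w = (\<Sum>z\<in>v ` F. u z *\<^sub>R z)" using finF(1) by (auto simp: span_finite)
  define b where "b i = u (v i)" for i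
  have y: "y = k *\<^sub>R ?w + (\<Sum>i\<in>F. b i *\<^sub>R v i)" using u RD(3)[OF F] by (simp add: sum.reindex b_def algebra_simps)
  have "n F \<bullet> y = k * (n F \<bullet> ?w)" unfolding y using RD(1)[OF F] by (simp add: inner_add_right inner_sum_right)
  then have "n F \<bullet> y = 0 \<Longrightarrow> y = (\<Sum>i\<in>F. b i *\<^sub>R v i)" using nw y by auto
  moreover have "c F j \<bullet> y = b j * (c F j \<bullet> v j)" if j: "j \<in> F" for j
  proof -
    have z: "(\<Sum>i\<in>F - {j}. b i * (c F j \<bullet> v i)) = 0"
      by (intro sum.neutral ballI) (metis DiffE LD(7)[OF F j] insertI1 mult_zero_right)
    have "c F j \<bullet> y = (\<Sum>i\<in>F. b i * (c F j \<bullet> v i))" unfolding y using LD(5)[OF F j] by (simp add: inner_add_right inner_sum_right)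
    then show ?thesis unfolding sum.remove[OF finF(1) j] z by simp
  qed
  ultimately show ?thesis by blast
qed

text \<open>The pole of the null normal \<open>n F\<close> is the tangency point. That
  \<open>lor (n F) (c F j) < 0\<close> puts it strictly inside the other facets of the simplex
  behind \<open>F\<close>, so its coefficients on \<open>F\<close> are positive.\<close>

lemma circ_conf_scribed:
  fixes v :: "nat \<Rightarrow> real \<times> (real ^ 'n::finite)"
  assumes FF: "facet_family d FF" and d: "d = CARD('n)" "d \<ge> 1" and C: "circ_conf (1/2) (\<lambda>_. 0) FF v n q c"
  shows "scribed (d - 1) (poscone v (\<Union>FF) \<inter> sphere 0 1)"
  unfolding scribed_def
proof (intro ballI impI)
  have L: "lorentz_config FF v n q c" using C unfolding circ_conf_def by blast
  note R = lorentz_configD(1)[OF L]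
  fix X assume X: "X \<in> spherical_faces (poscone v (\<Union>FF) \<inter> sphere 0 1)" "spherical_dim X = int (d - 1)"
  have "d + 1 = DIM(real \<times> (real ^ 'n))" using d by simp
  then obtain F A where F: "F \<in> FF" "A \<subseteq> F" "card A = d - 1 + 1" "X = poscone v A \<inter> sphere 0 1"
    using spherical_face_obtain[OF FF _ R X] d by auto
  have finF: "finite F" "card F = d" using facet_familyD(3,4)[OF FF F(1)] by auto
  then have "A = F" using F(2,3) d by (intro card_subset_eq) auto
  have CF: "lor (n F) (n F) = 0" "\<And>j. j \<in> F \<Longrightarrow> lor (n F) (c F j) < 0"
    using C F(1) unfolding circ_conf_def by fastforce+
  obtain b where b: "n F \<bullet> lor_dual (n F) = 0 \<longrightarrow> lor_dual (n F) = (\<Sum>i\<in>F. b i *\<^sub>R v i)"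
    "\<And>j. j \<in> F \<Longrightarrow> c F j \<bullet> lor_dual (n F) = b j * (c F j \<bullet> v j)" using lorentz_config_expand[OF FF d(1) L F(1), of "lor_dual (n F)"] by blast
  have "tangent_face (poscone v F \<inter> sphere 0 1)"
  proof (rule tangent_faceI[OF finF(1), of "n F" v b])
    show "lor (n F) (n F) = 0" by (rule CF(1))
    show "n F \<bullet> v i = 0" if "i \<in> F" for i using realizesD(1)[OF R F(1) that] .
    show "lor_dual (n F) = (\<Sum>i\<in>F. b i *\<^sub>R v i)" using b(1) CF(1) by (simp add: inner_lor_dual)
    show "b j > 0" if "j \<in> F" for j
    proof -
      have "b j * (c F j \<bullet> v j) < 0" using b(2)[OF that] CF(2)[OF that] by (simp add: inner_lor_dual lor_commute)
      then show ?thesis using lorentz_configD(6)[OF L F(1) that] by (simp add: mult_less_0_iff)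
    qed
    \<comment> \<open>That \<open>(1, 0)\<close> belongs to the cone makes the pole
      future-directed.\<close>
    have "fst (n F) \<le> 0" using realizes_le[OF R lorentz_configD(2)[OF L] F(1)] by (simp add: inner_prod_def)
    moreover have "fst (n F) \<noteq> 0"
    proof
      assume "fst (n F) = 0"
      then have "n F = 0" using CF(1) by (simp add: lor_def prod_eq_iff)
      then show False using realizesD(2)[OF R F(1) lorentz_configD(3,4)[OF L F(1)]] lorentz_configD(3,4)[OF L F(1)] by simp
    qed
    ultimately show "fst (n F) < 0" by simp
  qed
  then show "tangent_face X" using F(4) \<open>A = F\<close> by simp
qed

text \<open>\<open>n F + c F j\<close> is the null normal of a hyperplane through the ridge
  \<open>F - {j}\<close>. Its product with \<open>c F j\<close> is 0 and with every other
  \<open>c F k\<close> is - 2, so its pole has coefficient 0 at \<open>j\<close> and positive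
  coefficients on the ridge.\<close>

lemma ridge_conf_scribed:
  fixes v :: "nat \<Rightarrow> real \<times> (real ^ 'n::finite)"
  assumes FF: "facet_family d FF" and d: "d = CARD('n)" "d \<ge> 2" and C: "ridge_conf FF v n q c"
  shows "scribed (d - 2) (poscone v (\<Union>FF) \<inter> sphere 0 1)"
  unfolding scribed_def
proof (intro ballI impI)
  have L: "lorentz_config FF v n q c" using C unfolding ridge_conf_def by blast
  note R = lorentz_configD(1)[OF L]
  fix X assume X: "X \<in> spherical_faces (poscone v (\<Union>FF) \<inter> sphere 0 1)" "spherical_dim X = int (d - 2)"
  have "d + 1 = DIM(real \<times> (real ^ 'n))" using d by simp
  then obtain F A where F: "F \<in> FF" "A \<subseteq> F" "card A = d - 2 + 1" "X = poscone v A \<inter> sphere 0 1"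
    using spherical_face_obtain[OF FF _ R X] d by auto
  have finF: "finite F" "card F = d" using facet_familyD(3,4)[OF FF F(1)] by auto
  have "card (F - A) = 1" using F(2,3) finF d finite_subset[OF F(2) finF(1)] by (simp add: card_Diff_subset)
  then obtain j where j: "F - A = {j}" by (auto simp: card_1_singleton_iff)
  have A: "A = F - {j}" "j \<in> F" "finite A" using j F(2) finF(1) finite_subset by blast+
  have CF: "lor (n F) (n F) = 1" "lor (c F j) (c F j) = 1" "lor (n F) (c F j) = - 1" "(n F + c F j) \<bullet> (1, 0) < 0"
     "\<And>k. k \<in> F \<Longrightarrow> lor (n F) (c F k) = - 1" "\<And>k. k \<in> F \<Longrightarrow> k \<noteq> j \<Longrightarrow> lor (c F j) (c F k) = - 1"
    using C F(1) A(2) unfolding ridge_conf_def by blast+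
  let ?m = "n F + c F j"
  obtain b where b: "n F \<bullet> lor_dual ?m = 0 \<longrightarrow> lor_dual ?m = (\<Sum>i\<in>F. b i *\<^sub>R v i)"
    "\<And>k. k \<in> F \<Longrightarrow> c F k \<bullet> lor_dual ?m = b k * (c F k \<bullet> v k)" using lorentz_config_expand[OF FF d(1) L F(1), of "lor_dual ?m"] by blast
  have bj: "b j = 0"
  proof -
    have "b j * (c F j \<bullet> v j) = lor (c F j) ?m" using b(2)[OF A(2)] by (simp add: inner_lor_dual)
    also have "\<dots> = 0" using CF(2,3) by (simp add: lor_simps lor_commute[of "c F j" "n F"])
    finally show ?thesis using lorentz_configD(6)[OF L F(1) A(2)] by simp
  qed
  have "tangent_face (poscone v A \<inter> sphere 0 1)"
  proof (rule tangent_faceI[OF A(3), of ?m v b])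
    show "lor ?m ?m = 0" using CF(1-3) by (simp add: lor_simps lor_commute[of "c F j" "n F"])
    show "?m \<bullet> v i = 0" if "i \<in> A" for i
      using realizesD(1)[OF R F(1), of i] lorentz_configD(7)[OF L F(1) A(2), of i] that A(1) by (simp add: inner_add_left)
    have "n F \<bullet> lor_dual ?m = 0" using CF(1,3) by (simp add: inner_lor_dual lor_simps)
    then have "lor_dual ?m = (\<Sum>i\<in>F. b i *\<^sub>R v i)" using b(1) by blast
    also have "\<dots> = (\<Sum>i\<in>A. b i *\<^sub>R v i)" unfolding A(1) sum.remove[OF finF(1) A(2)] bj by simp
    finally show "lor_dual ?m = (\<Sum>i\<in>A. b i *\<^sub>R v i)" .
    show "b k > 0" if "k \<in> A" for k
    proof -
      have k: "k \<in> F" "k \<noteq> j" using that A(1) by auto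
      have "b k * (c F k \<bullet> v k) = lor (c F k) ?m" using b(2)[OF k(1)] by (simp add: inner_lor_dual)
      also have "\<dots> = - 2" using CF(5)[OF k(1)] CF(6)[OF k] by (simp add: lor_simps lor_commute[of "c F k"])
      finally show ?thesis using lorentz_configD(6)[OF L F(1) k(1)] by (smt (verit) mult_nonpos_nonpos)
    qed
    show "fst ?m < 0" using CF(4) by (simp add: inner_prod_def)
  qed
  then show "tangent_face X" using F(4) by simp
qed

lemma scribable_from_conf:
  fixes P :: "(real ^ 'n::finite) set" and v :: "nat \<Rightarrow> real \<times> (real ^ 'n)"
  assumes FF: "facet_family CARD('n) FF" and R: "realizes FF v n" and iso: "lattice_isomorphic (face_poset FF) (faces P)"
    and s: "scribed k (poscone v (\<Union>FF) \<inter> sphere 0 1)"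
  shows "scribable k P"
proof -
  let ?Q = "poscone v (\<Union>FF) \<inter> sphere 0 1"
  have hull: "convex_cone hull ?Q = poscone v (\<Union>FF)" by (rule convex_cone_hull_sphere[OF convex_cone_poscone])
  have "spherical_polytope ?Q" using realizes_spherical_polytope[OF FF _ R] by (simp add: Suc_le_eq)
  moreover have "spherical_dim ?Q = int CARD('n)" unfolding spherical_dim_def hull
    using aff_dim_poscone_full[OF FF _ _ R] by (simp add: Suc_le_eq)
  moreover have "lattice_isomorphic (faces P) (spherical_faces ?Q)"
    using lattice_isomorphic_trans[OF lattice_isomorphic_sym[OF iso] lattice_isomorphic_spherical_faces[OF FF R hull]] .
  ultimately show ?thesis unfolding scribable_def realization_def using s by blast
qed

theorem theorem1:
  assumes "CARD('n::finite) \<ge> 3"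
  shows "(\<forall>k. k + 3 \<le> CARD('n) \<longrightarrow>
            (\<exists>P :: (real ^ 'n) set. stacked P \<and> \<not> scribable k P)) \<and>
         (\<forall>P :: (real ^ 'n) set. stacked P \<longrightarrow>
            scribable (CARD('n) - 1) P \<and> scribable (CARD('n) - 2) P)"
proof (intro conjI allI impI)
  let ?d = "CARD('n)"
  have d2: "?d \<ge> 2" "?d \<ge> 1" using assms by auto
  fix k assume k: "k + 3 \<le> ?d"
  \<comment> \<open>The same combinatorial type serves for all \<open>k\<close>.\<close>
  have "stacked_family ?d (multi_stack ?d 4)" using multi_stack_props(1)[of 4 ?d] assms by simp
  then obtain P :: "(real ^ 'n) set" where P: "stacked P" "lattice_isomorphic (face_poset (multi_stack ?d 4)) (faces P)"
    using stacked_exists[of ?d "multi_stack ?d 4"] d2 by blast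
  have "\<not> scribable k P"
  proof
    assume "scribable k P"
    then obtain Q :: "(real \<times> (real ^ 'n)) set" where Q: "spherical_polytope Q" "spherical_dim Q = int ?d"
      "lattice_isomorphic (faces P) (spherical_faces Q)" "scribed k Q"
      unfolding scribable_def realization_def by blast
    show False
      using multi_stack_not_scribed[OF refl k Q(1,2) lattice_isomorphic_trans[OF P(2) Q(3)] Q(4)] .
  qed
  then show "\<exists>P :: (real ^ 'n) set. stacked P \<and> \<not> scribable k P" using P(1) by blast
next
  let ?d = "CARD('n)"
  have d2: "?d \<ge> 2" "?d \<ge> 1" using assms by auto
  fix P :: "(real ^ 'n) set" assume "stacked P"
  then obtain FF where FF: "stacked_family ?d FF" and iso: "lattice_isomorphic (face_poset FF) (faces P)"
    using stacked_lattice d2(1) by blast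
  have ff: "facet_family ?d FF" by (rule stacked_family_facet_family[OF FF d2(2)])
  \<comment> \<open>Prescribing norm 0 everywhere is admissible for any \<open>\<epsilon>\<close>
    and makes every facet tangent.\<close>
  have "\<exists>v n q c. circ_conf (1/2) (\<lambda>_. 0) FF (v :: nat \<Rightarrow> real \<times> (real ^ 'n)) n q c"
    using circ_conf_exists[OF FF refl d2(1), of "1/2"] by fastforce
  then obtain v n q c where C: "circ_conf (1/2) (\<lambda>_. 0) FF (v :: nat \<Rightarrow> real \<times> (real ^ 'n)) n q c" by blast
  then have "realizes FF v n" unfolding circ_conf_def using lorentz_configD(1) by blast
  then show "scribable (?d - 1) P"
    using scribable_from_conf[OF ff _ iso] circ_conf_scribed[OF ff refl d2(2) C] by blast
  obtain v n q c where C: "ridge_conf FF (v :: nat \<Rightarrow> real \<times> (real ^ 'n)) n q c"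
    using ridge_conf_exists[OF FF refl d2(1)] by blast
  then have "realizes FF v n" unfolding ridge_conf_def using lorentz_configD(1) by blast
  then show "scribable (?d - 2) P"
    using scribable_from_conf[OF ff _ iso] ridge_conf_scribed[OF ff refl d2(1) C] by blast
qed

end
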